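(* Let $\mathcal{H}$ be a complex Hilbert space, $V\in\mathcal{I}(\mathcal{H})$ and $v=iXV-iVY\in (T\mathcal{I}(\mathcal{H}))_V$ (with $X^*=X$, $Y^*=Y$). Let $\mathbf{V}=\begin{pmatrix} 0 & v \\ v^* & 0 \end{pmatrix}\in (T(\Delta\cdot\epsilon_V))_{\epsilon_V}$ and let $\mathbf{A}_0$ be a diagonal minimal lifting for $\mathbf{V}$. Then the curve $$\delta(t)=e^{it\mathbf{A}_0}\,\epsilon_V\,e^{-it\mathbf{A}_0},$$ which satisfies $\delta(0)=\epsilon_V$ and $\dot\delta(0)=\mathbf{V}$, has minimal length along its path in $\Delta\cdot\epsilon_V$ for $|t|\le \frac{\pi}{2|v|_V}$. Moreover, it also has minimal length along its path among curves in the bigger manifold $\mathcal{O}_{\epsilon_V}$, in the same time interval.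
   Context: $\mathcal{I}(\mathcal{H})=\{V\in\mathcal{B}(\mathcal{H}): VV^*V=V\}$ is the set of partial isometries, with tangent spaces $(T\mathcal{I}(\mathcal{H}))_V=\{iXV-iVY: X^*=X,\ Y^*=Y\in\mathcal{B}(\mathcal{H})\}$ and Finsler norm $$|v|_V=\inf\{\max\{\|A\|,\|B\|\}: A^*=A,\ B^*=B\in\mathcal{B}(\mathcal{H}),\ iAV-iVB=v\}.$$ For $V\in\mathcal{I}(\mathcal{H})$ put $\epsilon_V=\begin{pmatrix} 0 & V \\ V^* & 0 \end{pmatrix}\in\mathcal{B}(\mathcal{H}\times\mathcal{H})$, a selfadjoint operator with $\epsilon_V^3=\epsilon_V$. Let $\mathcal{U}(\mathcal{H}\times\mathcal{H})$ be the unitary group of $\mathcal{H}\times\mathcal{H}$ and $\mathcal{O}_{\epsilon_V}=\{\mathbf{U}\epsilon_V\mathbf{U}^*:\mathbf{U}\in\mathcal{U}(\mathcal{H}\times\mathcal{H})\}$, a submanifold of $\mathcal{B}(\mathcal{H}\times\mathcal{H})$. Its tangent space at $\epsilon\in\mathcal{O}_{\epsilon_V}$ is $\{i(\mathbf{X}\epsilon-\epsilon\mathbf{X}):\mathbf{X}^*=\mathbf{X}\in\mathcal{B}(\mathcal{H}\times\mathcal{H})\}$, with Finsler norm $|w|_\epsilon=\inf\{\|\mathbf{X}\|:\mathbf{X}^*=\mathbf{X},\ i(\mathbf{X}\epsilon-\epsilon\mathbf{X})=w\}$. $\Delta\cdot\epsilon_V=\{\epsilon_{UVW^*}: U,W\in\mathcal{U}(\mathcal{H})\}\subset\mathcal{O}_{\epsilon_V}$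 is the orbit of $\epsilon_V$ under conjugation by the block diagonal unitaries $\begin{pmatrix} U & 0 \\ 0 & W \end{pmatrix}$; it is identified with the connected component of $V$ in $\mathcal{I}(\mathcal{H})$ via $V'\mapsto\epsilon_{V'}$. A tangent vector to $\Delta\cdot\epsilon_V$ at $\epsilon_{V'}$ has the form $\begin{pmatrix} 0 & w \\ w^* & 0 \end{pmatrix}$ with $w\in(T\mathcal{I}(\mathcal{H}))_{V'}$, and its Finsler norm in $\Delta\cdot\epsilon_V$ is $|w|_{V'}$. Diagonal minimal lifting: let $\mathbf{A}=\begin{pmatrix} A_1 & 0 \\ 0 & A_2 \end{pmatrix}$ be selfadjoint with $i(\mathbf{A}\epsilon_V-\epsilon_V\mathbf{A})=\mathbf{V}$ (i.e. $iA_1V-iVA_2=v$). Let $\mathbf{X}=\begin{pmatrix} X_{11} & X_{12} \\ X_{12}^* & X_{22} \end{pmatrix}$ be a selfadjoint operator commuting with $\epsilon_V$ such that $\|\mathbf{A}+\mathbf{X}\|\le\|\mathbf{A}+\mathbf{Y}\|$ for all selfadjoint $\mathbf{Y}$ commuting with $\epsilon_V$ (such $\mathbf{X}$ exists). Put $\mathbf{X}_0=\begin{pmatrix} X_{11} & 0 \\ 0 & X_{22} \end{pmatrix}$. Any operator $\mathbf{A}_0=\mathbf{A}+\mathbf{X}_0$ obtained in this way is called a diagonal minimal lifting for $\mathbf{V}$. Given a manifold $M$ with a Finsler norm $|\cdot|_m$ on each tangent space, the length of a smooth curve $\gamma:I\to M$ is $\ell(\gamma)=\int_I|\dot\gamma(t)|_{\gamma(t)}\,dt$.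 A curve $\delta$ in $M$ has minimal length along its path for $|t|\le T$ if for every $[t_0,t_1]\subset[-T,T]$ and every smooth curve $\gamma$ in $M$ joining $\delta(t_0)$ and $\delta(t_1)$ one has $\ell(\delta|_{[t_0,t_1]})\le\ell(\gamma)$. If $v=0$, the bound $\pi/(2|v|_V)$ is read as $+\infty$.
   Formalization: Minimality is proved for subintervals [t0,t1] of [-T,T] with t1-t0 ≤ T, T=π/(2|v|_V), not for all subintervals: for H=C, V=1, v=i the curve δ is a closed loop of length π on [-π,π], so the unrestricted claim fails. *)

theory Defs
  imports "HOL-Analysis.Analysis"
begin

section \<open>Complex Hilbert spaces\<close>

class scaleC =
  fixes scaleC :: "complex \<Rightarrow> 'a \<Rightarrow> 'a" (infixr "*\<^sub>C" 75)

text \<open>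
  A complex Hilbert space, built on top of the underlying real Hilbert space: the norm and the
  real inner product of the library are induced by the complex inner product, which is antilinear
  in the first and linear in the second argument. Positive definiteness of \<open>cinner\<close> comes
  from \<open>real_inner\<close> through \<open>inner_eq_Re_cinner\<close>.
\<close>
class complex_hilbert = scaleC + real_inner + complete_space +
  fixes cinner :: "'a \<Rightarrow> 'a \<Rightarrow> complex"
  assumes scaleC_add_right: "c *\<^sub>C (x + y) = c *\<^sub>C x + c *\<^sub>C y"
    and scaleC_add_left: "(c + d) *\<^sub>C x = c *\<^sub>C x + d *\<^sub>C x"
    and scaleC_scaleC: "c *\<^sub>C d *\<^sub>C x = (c * d) *\<^sub>C x"
    and scaleR_eq_scaleC: "r *\<^sub>R x = complex_of_real r *\<^sub>C x"
    and cinner_commute: "cinner x y = cnj (cinner y x)"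
    and cinner_add_right: "cinner x (y + z) = cinner x y + cinner x z"
    and cinner_scaleC_right: "cinner x (c *\<^sub>C y) = c * cinner x y"
    and inner_eq_Re_cinner: "inner x y = Re (cinner x y)"

instantiation complex :: complex_hilbert
begin
definition scaleC_complex :: "complex \<Rightarrow> complex \<Rightarrow> complex" where "scaleC_complex c x = c * x"
definition cinner_complex :: "complex \<Rightarrow> complex \<Rightarrow> complex" where "cinner_complex x y = cnj x * y"
instance
  by standard (auto simp: scaleC_complex_def cinner_complex_def algebra_simps inner_complex_def
      scaleR_conv_of_real)
end

instantiation prod :: (complex_hilbert, complex_hilbert) complex_hilbert
begin
definition scaleC_prod :: "complex \<Rightarrow> 'a \<times> 'b \<Rightarrow> 'a \<times> 'b" where
  "scaleC_prod c p = (c *\<^sub>C fst p, c *\<^sub>C snd p)"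
definition cinner_prod :: "'a \<times> 'b \<Rightarrow> 'a \<times> 'b \<Rightarrow> complex" where
  "cinner_prod p q = cinner (fst p) (fst q) + cinner (snd p) (snd q)"
instance
proof
  fix x y :: "'a \<times> 'b"
  show "cinner x y = cnj (cinner y x)"
    using cinner_commute[of "fst x" "fst y"] cinner_commute[of "snd x" "snd y"]
    by (simp add: cinner_prod_def)
qed (auto simp: scaleC_prod_def cinner_prod_def scaleC_add_right scaleC_add_left scaleC_scaleC
      scaleR_eq_scaleC cinner_add_right cinner_scaleC_right inner_eq_Re_cinner inner_prod_def
      algebra_simps prod_eq_iff)
end

lemma norm_scaleC: "norm (c *\<^sub>C x) = cmod c * norm (x :: 'a :: complex_hilbert)"
proof -
  have "cinner (c *\<^sub>C x) (c *\<^sub>C x) = c * cnj (cinner x (c *\<^sub>C x))"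
    by (metis cinner_commute cinner_scaleC_right)
  also have "\<dots> = c * cnj c * cnj (cinner x x)"
    by (simp add: cinner_scaleC_right)
  also have "\<dots> = complex_of_real ((cmod c)\<^sup>2) * cinner x x"
    by (metis cinner_commute complex_norm_square)
  finally have "(norm (c *\<^sub>C x))\<^sup>2 = (cmod c)\<^sup>2 * (norm x)\<^sup>2"
    by (simp add: power2_norm_eq_inner inner_eq_Re_cinner)
  then show ?thesis
    by (metis mult_nonneg_nonneg norm_ge_zero power2_eq_imp_eq power_mult_distrib)
qed

section \<open>Bounded operators\<close>

text \<open>
  Operators live in the library's Banach space of bounded \<^emph>\<open>real\<close>-linear maps, whose norm
  is the operator norm; \<open>bounded_ops\<close> singles out the complex-linear ones.
\<close>
definition bounded_ops :: "('a::complex_hilbert \<Rightarrow>\<^sub>L 'b::complex_hilbert) set" where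
  "bounded_ops = {A. \<forall>c x. blinfun_apply A (c *\<^sub>C x) = c *\<^sub>C blinfun_apply A x}"

instantiation blinfun :: (complex_hilbert, complex_hilbert) scaleC
begin
lift_definition scaleC_blinfun :: "complex \<Rightarrow> ('a \<Rightarrow>\<^sub>L 'b) \<Rightarrow> ('a \<Rightarrow>\<^sub>L 'b)"
  is "\<lambda>c A x. c *\<^sub>C A x"
proof -
  fix c and A :: "'a \<Rightarrow> 'b"
  assume "bounded_linear A"
  moreover have "bounded_linear (\<lambda>x::'b. c *\<^sub>C x)"
    by (rule bounded_linear_intro[where K = "cmod c"])
      (auto simp: scaleC_add_right scaleR_eq_scaleC scaleC_scaleC norm_scaleC mult.commute)
  ultimately show "bounded_linear (\<lambda>x. c *\<^sub>C A x)"
    by (rule bounded_linear_compose[rotated])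
qed
instance ..
end

text \<open>The adjoint exists for \<open>A \<in> bounded_ops\<close> by the Riesz representation theorem.\<close>
definition adj :: "('a::complex_hilbert \<Rightarrow>\<^sub>L 'b::complex_hilbert) \<Rightarrow> ('b \<Rightarrow>\<^sub>L 'a)" where
  "adj A = (THE B. \<forall>x y. cinner (blinfun_apply A x) y = cinner x (blinfun_apply B y))"

definition selfadjoint :: "('a::complex_hilbert \<Rightarrow>\<^sub>L 'a) \<Rightarrow> bool" where
  "selfadjoint A \<longleftrightarrow> A \<in> bounded_ops \<and> adj A = A"

definition unitary :: "('a::complex_hilbert \<Rightarrow>\<^sub>L 'a) \<Rightarrow> bool" where
  "unitary U \<longleftrightarrow> U \<in> bounded_ops \<and> adj U o\<^sub>L U = id_blinfun \<and> U o\<^sub>L adj U = id_blinfun"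

definition partial_isometries :: "('a::complex_hilbert \<Rightarrow>\<^sub>L 'a) set" where
  "partial_isometries = {V \<in> bounded_ops. V o\<^sub>L adj V o\<^sub>L V = V}"

definition op_power :: "('a::complex_hilbert \<Rightarrow>\<^sub>L 'a) \<Rightarrow> nat \<Rightarrow> ('a \<Rightarrow>\<^sub>L 'a)" where
  "op_power A n = (((o\<^sub>L) A) ^^ n) id_blinfun"

text \<open>The library's \<open>exp\<close> is not available, since \<open>norm 1 = 1\<close> fails on the zero space.\<close>
definition op_exp :: "('a::complex_hilbert \<Rightarrow>\<^sub>L 'a) \<Rightarrow> ('a \<Rightarrow>\<^sub>L 'a)" where
  "op_exp A = (\<Sum>n. (1 / fact n) *\<^sub>R op_power A n)"

section \<open>Block operators\<close>

lift_definition block ::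
  "('a::complex_hilbert \<Rightarrow>\<^sub>L 'a) \<Rightarrow> ('a \<Rightarrow>\<^sub>L 'a) \<Rightarrow> ('a \<Rightarrow>\<^sub>L 'a) \<Rightarrow> ('a \<Rightarrow>\<^sub>L 'a)
    \<Rightarrow> ('a \<times> 'a) \<Rightarrow>\<^sub>L ('a \<times> 'a)"
  is "\<lambda>A B C D p. (A (fst p) + B (snd p), C (fst p) + D (snd p))"
  by (intro bounded_linear_Pair bounded_linear_add bounded_linear_compose[OF _ bounded_linear_fst]
      bounded_linear_compose[OF _ bounded_linear_snd])

lift_definition block12 :: "('a::complex_hilbert \<times> 'a) \<Rightarrow>\<^sub>L ('a \<times> 'a) \<Rightarrow> 'a \<Rightarrow>\<^sub>L 'a"
  is "\<lambda>T x. fst (T (0, x))"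
  by (rule bounded_linear_fst_comp bounded_linear_compose[OF bounded_linear_fst]
      bounded_linear_compose[OF _ bounded_linear_Pair[OF bounded_linear_zero bounded_linear_ident]]
      | assumption)+

definition eps :: "('a::complex_hilbert \<Rightarrow>\<^sub>L 'a) \<Rightarrow> ('a \<times> 'a) \<Rightarrow>\<^sub>L ('a \<times> 'a)" where
  "eps V = block 0 V (adj V) 0"

section \<open>The manifolds and their Finsler norms\<close>

definition pi_tangent :: "('a::complex_hilbert \<Rightarrow>\<^sub>L 'a) \<Rightarrow> ('a \<Rightarrow>\<^sub>L 'a) set" where
  "pi_tangent V = {\<i> *\<^sub>C (X o\<^sub>L V) - \<i> *\<^sub>C (V o\<^sub>L Y) | X Y. selfadjoint X \<and> selfadjoint Y}"

definition pi_norm :: "('a::complex_hilbert \<Rightarrow>\<^sub>L 'a) \<Rightarrow> ('a \<Rightarrow>\<^sub>L 'a) \<Rightarrow> real" where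
  "pi_norm V v = Inf {max (norm A) (norm B) | A B.
     selfadjoint A \<and> selfadjoint B \<and> \<i> *\<^sub>C (A o\<^sub>L V) - \<i> *\<^sub>C (V o\<^sub>L B) = v}"

definition unitary_orbit :: "('b::complex_hilbert \<Rightarrow>\<^sub>L 'b) \<Rightarrow> ('b \<Rightarrow>\<^sub>L 'b) set" where
  "unitary_orbit E = {U o\<^sub>L E o\<^sub>L adj U | U. unitary U}"

definition orbit_norm :: "('b::complex_hilbert \<Rightarrow>\<^sub>L 'b) \<Rightarrow> ('b \<Rightarrow>\<^sub>L 'b) \<Rightarrow> real" where
  "orbit_norm E w = Inf {norm X | X. selfadjoint X \<and> \<i> *\<^sub>C ((X o\<^sub>L E) - (E o\<^sub>L X)) = w}"

definition diag_orbit ::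
  "('a::complex_hilbert \<Rightarrow>\<^sub>L 'a) \<Rightarrow> (('a \<times> 'a) \<Rightarrow>\<^sub>L ('a \<times> 'a)) set" where
  "diag_orbit V = {eps (U o\<^sub>L V o\<^sub>L adj W) | U W. unitary U \<and> unitary W}"

text \<open>At \<open>E = eps V'\<close> and a tangent vector \<open>W = block 0 w (adj w) 0\<close> this is \<open>pi_norm V' w\<close>.\<close>
definition diag_orbit_norm ::
  "(('a::complex_hilbert \<times> 'a) \<Rightarrow>\<^sub>L ('a \<times> 'a)) \<Rightarrow> (('a \<times> 'a) \<Rightarrow>\<^sub>L ('a \<times> 'a)) \<Rightarrow> real" where
  "diag_orbit_norm E W = pi_norm (block12 E) (block12 W)"

definition diagonal_minimal_lifting ::
  "('a::complex_hilbert \<Rightarrow>\<^sub>L 'a) \<Rightarrow> (('a \<times> 'a) \<Rightarrow>\<^sub>L ('a \<times> 'a)) \<Rightarrow> (('a \<times> 'a) \<Rightarrow>\<^sub>L ('a \<times> 'a)) \<Rightarrow> bool"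
where
  "diagonal_minimal_lifting V \<V> A\<^sub>0 \<longleftrightarrow>
     (\<exists>A1 A2 X11 X12 X22. let A = block A1 0 0 A2; X = block X11 X12 (adj X12) X22 in
        selfadjoint A \<and> \<i> *\<^sub>C ((A o\<^sub>L eps V) - (eps V o\<^sub>L A)) = \<V> \<and>
        selfadjoint X \<and> X o\<^sub>L eps V = eps V o\<^sub>L X \<and>
        (\<forall>Y. selfadjoint Y \<and> Y o\<^sub>L eps V = eps V o\<^sub>L Y \<longrightarrow> norm (A + X) \<le> norm (A + Y)) \<and>
        A\<^sub>0 = A + block X11 0 0 X22)"

section \<open>Curves, length and minimality\<close>

definition smooth_curve :: "'c::real_normed_vector set \<Rightarrow> (real \<Rightarrow> 'c) \<Rightarrow> real \<Rightarrow> real \<Rightarrow> bool" where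
  "smooth_curve M \<gamma> a b \<longleftrightarrow>
     (\<forall>t\<in>{a..b}. \<gamma> t \<in> M) \<and>
     (\<exists>D :: nat \<Rightarrow> real \<Rightarrow> 'c. D 0 = \<gamma> \<and>
        (\<forall>n. \<forall>t\<in>{a..b}. (D n has_vector_derivative D (Suc n) t) (at t within {a..b})))"

definition curve_length ::
  "('c::real_normed_vector \<Rightarrow> 'c \<Rightarrow> real) \<Rightarrow> (real \<Rightarrow> 'c) \<Rightarrow> real \<Rightarrow> real \<Rightarrow> real" where
  "curve_length F \<gamma> a b =
     integral {a..b} (\<lambda>t. F (\<gamma> t) (vector_derivative \<gamma> (at t within {a..b})))"

text \<open>
  Only subintervals of length at most \<open>T\<close> are compared. Allowing all subintervals of
  \<open>[-T, T]\<close> would make the minimality theorem fail already for \<open>V = 1\<close>, \<open>v = \<i>\<close> on the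
  one-dimensional space: there \<open>pi_norm V v = 1 / 2\<close>, \<open>T = pi\<close>, and the curve
  \<open>t \<mapsto> eps (exp (\<i> * t))\<close> on \<open>[-pi, pi]\<close> is a closed loop of length \<open>pi\<close>, while the constant
  curve joins its endpoints. With the restriction the curve is minimal between the points of
  parameters \<open>0\<close> and \<open>t\<close> for all \<open>\<bar>t\<bar> \<le> T\<close>.
\<close>
definition minimal_along_path ::
  "'c::real_normed_vector set \<Rightarrow> ('c \<Rightarrow> 'c \<Rightarrow> real) \<Rightarrow> (real \<Rightarrow> 'c) \<Rightarrow> ereal \<Rightarrow> bool" where
  "minimal_along_path M F \<delta> T \<longleftrightarrow>
     (\<forall>t\<^sub>0 t\<^sub>1. t\<^sub>0 \<le> t\<^sub>1 \<and> {t\<^sub>0..t\<^sub>1} \<subseteq> {t. ereal \<bar>t\<bar> \<le> T} \<and> ereal (t\<^sub>1 - t\<^sub>0) \<le> T \<longrightarrow>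
        smooth_curve M \<delta> t\<^sub>0 t\<^sub>1 \<and>
        (\<forall>\<gamma> a b. a < b \<and> smooth_curve M \<gamma> a b \<and> \<gamma> a = \<delta> t\<^sub>0 \<and> \<gamma> b = \<delta> t\<^sub>1 \<longrightarrow>
           curve_length F \<delta> t\<^sub>0 t\<^sub>1 \<le> curve_length F \<gamma> a b))"

end

theory Submission
  imports Defs
begin

text \<open>
  Write \<open>m\<close> for the norm of \<open>A\<^sub>0\<close>, and call \<open>X\<close> a lift of \<open>w\<close> at \<open>E\<close> if it is selfadjoint with
  \<open>\<i> (X E - E X) = w\<close>.

  Conjugation by the symmetry \<open>diag(1, -1)\<close> turns \<open>eps V\<close> into its negative. Averaging over it
  therefore maps lifts of off-diagonal tangent vectors to block diagonal lifts, and it does not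
  increase norms. Three things follow. The two Finsler norms agree on the diagonal orbit
  (\<open>orbit_norm_eps\<close>). The operator \<open>A\<^sub>0\<close>, the average of the minimal lift \<open>A + X\<close>, is itself of
  minimal norm among all lifts of \<open>\<V>\<close>. Hence \<open>m = pi_norm V v\<close>, and \<open>\<delta>\<close> has constant speed \<open>m\<close> for
  both norms. As the diagonal orbit is contained in the unitary orbit, both claims reduce to one
  estimate: if \<open>t m \<le> \<pi> / 2\<close>, no curve in the unitary orbit from \<open>E\<close> to \<open>e\<^sup>i\<^sup>t\<^sup>Z E e\<^sup>-\<^sup>i\<^sup>t\<^sup>Z\<close>, with \<open>Z = A\<^sub>0\<close>
  and \<open>E = \<delta> t\<^sub>0\<close>, is shorter than \<open>t m\<close> (\<open>minimal_le_length\<close>).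

  Let \<open>L\<close> be the length of such a curve. Small steps \<open>e\<^sup>i\<^sup>h\<^sup>X\<close>, with \<open>X\<close> an almost minimal lift of the
  velocity, multiply up to a unitary \<open>U\<close> that carries \<open>E\<close> nearly to the end point. A step turns every
  vector by an angle of at most \<open>h * norm X\<close>, and angles satisfy the triangle inequality, so
  \<open>inner (U \<xi>) \<xi> \<ge> cos L\<close> for all unit vectors \<open>\<xi>\<close>, up to an error that tends to \<open>0\<close> with \<open>h\<close>
  (\<open>approximate_lift\<close>). On the other hand \<open>U\<close> and \<open>e\<^sup>i\<^sup>t\<^sup>Z\<close> carry \<open>E\<close> to nearly the same point, so that
  \<open>U\<close> is close to \<open>e\<^sup>i\<^sup>t\<^sup>Z b\<close> for a contraction \<open>b\<close> which commutes with \<open>E\<close>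
  (\<open>tripotent_almost_commuting\<close>). But minimality of \<open>Z\<close> forbids that \<open>b\<close> shortens the way: for every such \<open>b\<close> there are
  unit vectors \<open>\<xi>\<close> with \<open>inner (e\<^sup>i\<^sup>t\<^sup>Z b \<xi>) \<xi> \<le> cos (t m) + e\<close>, with \<open>e > 0\<close> arbitrarily small
  (\<open>minimal_moves_some_vector\<close>). In the limit \<open>cos L \<le> cos (t m)\<close>, that is, \<open>t m \<le> L\<close>.
\<close>

section \<open>Adjoints in complex Hilbert spaces\<close>

instance complex_hilbert \<subseteq> banach ..

lemma cinner_scaleC_left: "cinner (c *\<^sub>C x) y = cnj c * cinner x (y :: 'a::complex_hilbert)"
  by (metis cinner_commute cinner_scaleC_right complex_cnj_mult)

lemma cinner_eq_inner:
  "cinner x y = Complex (inner x y) (inner (\<i> *\<^sub>C x) (y :: 'a::complex_hilbert))"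
  by (simp add: complex_eq_iff inner_eq_Re_cinner cinner_scaleC_left)

lemma scaleC_one [simp]: "1 *\<^sub>C x = (x :: 'a::complex_hilbert)"
  using scaleR_eq_scaleC[of 1 x] by simp

lemma scaleC_minus_one [simp]: "(-1) *\<^sub>C x = - (x :: 'a::complex_hilbert)"
  using scaleR_eq_scaleC[of "-1" x] by simp

lemma scaleC_zero_right [simp]: "c *\<^sub>C 0 = (0 :: 'a::complex_hilbert)"
  using norm_scaleC[of c "0::'a"] by simp

lemma scaleC_minus_left: "(- c) *\<^sub>C x = - (c *\<^sub>C (x :: 'a::complex_hilbert))"
  by (metis mult_minus1 scaleC_minus_one scaleC_scaleC)

lemma scaleC_minus_right: "c *\<^sub>C (- x) = - (c *\<^sub>C (x :: 'a::complex_hilbert))"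
  by (metis mult.commute scaleC_minus_one scaleC_scaleC)

lemma scaleC_diff_right: "c *\<^sub>C (x - y) = c *\<^sub>C x - c *\<^sub>C (y :: 'a::complex_hilbert)"
  using scaleC_add_right[of c x "- y"] by (simp add: scaleC_minus_right)

lemma scaleC_scaleR: "c *\<^sub>C (r *\<^sub>R x) = r *\<^sub>R (c *\<^sub>C (x :: 'a::complex_hilbert))"
  by (simp add: scaleR_eq_scaleC scaleC_scaleC mult.commute)

lemma inner_i_left: "inner (\<i> *\<^sub>C x) y = - inner x (\<i> *\<^sub>C (y :: 'a::complex_hilbert))"
  by (simp add: inner_eq_Re_cinner cinner_scaleC_left cinner_scaleC_right)

lemma scaleC_blinfun_apply [simp]: "blinfun_apply (c *\<^sub>C A) x = c *\<^sub>C blinfun_apply A x"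
  by transfer simp

lemma bounded_ops_apply: "A \<in> bounded_ops \<Longrightarrow> blinfun_apply A (c *\<^sub>C x) = c *\<^sub>C blinfun_apply A x"
  by (simp add: bounded_ops_def)

text \<open>
  Riesz: a minimizing sequence of \<open>\<parallel>x\<parallel>\<^sup>2 - 2 f x\<close> is Cauchy by the parallelogram law, and at the
  minimum the first variation is \<open>inner y - f\<close>.
\<close>
lemma riesz_real:
  fixes f :: "'a::complex_hilbert \<Rightarrow> real"
  assumes "bounded_linear f"
  shows "\<exists>y. \<forall>x. f x = inner x y"
proof -
  interpret bounded_linear f by fact
  define J where "J x = (norm x)\<^sup>2 - 2 * f x" for x
  obtain K where K: "\<And>x. \<bar>f x\<bar> \<le> norm x * K" using bounded by auto
  have Jge: "- K\<^sup>2 \<le> J x" for x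
  proof -
    have "2 * f x \<le> 2 * (norm x * K)" using K[of x] by auto
    moreover have "0 \<le> (norm x - K)\<^sup>2" by simp
    ultimately show ?thesis unfolding J_def power2_diff by (simp add: algebra_simps)
  qed
  define I where "I = Inf (range J)"
  have bdd: "bdd_below (range J)" using Jge by (intro bdd_belowI[of _ "- K\<^sup>2"]) auto
  have I_le: "I \<le> J x" for x unfolding I_def by (rule cInf_lower[OF _ bdd]) simp
  have par: "(norm (x - y))\<^sup>2 \<le> 2 * (J x - I) + 2 * (J y - I)" for x y
  proof -
    have "J ((1/2) *\<^sub>R (x + y)) = (norm (x + y))\<^sup>2 / 4 - f x - f y"
    proof -
      have "(norm ((1/2) *\<^sub>R (x + y)))\<^sup>2 = (norm (x + y))\<^sup>2 / 4"
        unfolding norm_scaleR by (simp add: power_divide)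
      then show ?thesis unfolding J_def scaleR add real_scaleR_def by argo
    qed
    moreover have "(norm (x + y))\<^sup>2 + (norm (x - y))\<^sup>2 = 2 * (norm x)\<^sup>2 + 2 * (norm y)\<^sup>2"
      by (simp add: power2_norm_eq_inner inner_add inner_diff inner_commute)
    ultimately show ?thesis using I_le[of "(1/2) *\<^sub>R (x + y)"] unfolding J_def by simp
  qed
  have "\<exists>x. J x < I + 1 / real (Suc n)" for n
    using cInf_lessD[of "range J" "I + 1 / real (Suc n)"] by (auto simp: I_def)
  then obtain s where s: "\<And>n. J (s n) < I + 1 / real (Suc n)" by metis
  have "Cauchy s"
  proof (rule metric_CauchyI)
    fix e :: real assume "e > 0"
    then have "e\<^sup>2 / 4 > 0" by simp
    then obtain M where M: "1 / real (Suc M) < e\<^sup>2 / 4" using nat_approx_posE by blast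
    have small: "J (s n) - I < e\<^sup>2 / 4" if "n \<ge> M" for n
    proof -
      have "1 / real (Suc n) \<le> 1 / real (Suc M)" using that by (simp add: frac_le)
      with s[of n] M show ?thesis by linarith
    qed
    have "dist (s m) (s n) < e" if "m \<ge> M" "n \<ge> M" for m n
    proof -
      have "(norm (s m - s n))\<^sup>2 < e\<^sup>2"
        using par[of "s m" "s n"] small[OF that(1)] small[OF that(2)] by argo
      then show ?thesis using \<open>e > 0\<close> by (simp add: dist_norm power_less_imp_less_base)
    qed
    then show "\<exists>M. \<forall>m\<ge>M. \<forall>n\<ge>M. dist (s m) (s n) < e"
      by (intro exI[of _ M] allI impI)
  qed
  then obtain y where y: "s \<longlonglongrightarrow> y" unfolding Cauchy_convergent_iff convergent_def by (elim exE)
  have "(\<lambda>n. J (s n)) \<longlonglongrightarrow> J y" unfolding J_def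
    by (intro tendsto_diff tendsto_power tendsto_norm tendsto_mult tendsto_const tendsto y)
  moreover have "(\<lambda>n. I + 1 / real (Suc n)) \<longlonglongrightarrow> I + 0"
    using LIMSEQ_inverse_real_of_nat by (intro tendsto_add) (simp_all add: inverse_eq_divide)
  ultimately have "J y \<le> I + 0" using s by (intro LIMSEQ_le) (auto intro: less_imp_le)
  then have min: "J y \<le> J x" for x using I_le[of x] by simp
  have "f x = inner x y" for x
  proof -
    define d where "d = inner x y - f x"
    have quad: "0 \<le> r * (r * (norm x)\<^sup>2 + 2 * d)" for r
    proof -
      have "J (y + r *\<^sub>R x) = J y + r * (r * (norm x)\<^sup>2 + 2 * d)"
        unfolding J_def d_def add scaleR power2_norm_eq_inner
        by (simp add: inner_add inner_commute algebra_simps)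
      then show ?thesis using min[of "y + r *\<^sub>R x"] by simp
    qed
    \<comment> \<open>For \<open>d \<noteq> 0\<close> the quadratic in \<open>r\<close> is negative at \<open>r = - d / (norm x)\<^sup>2\<close>.\<close>
    have "d = 0"
    proof (cases "x = 0")
      case True
      then show ?thesis by (simp add: d_def zero)
    next
      case False
      then have n: "(norm x)\<^sup>2 > 0" by simp
      have "0 \<le> (- d / (norm x)\<^sup>2) * (- d / (norm x)\<^sup>2 * (norm x)\<^sup>2 + 2 * d)" by (rule quad)
      also have "\<dots> = - (d * d / (norm x)\<^sup>2)" using n by simp
      finally have "d * d \<le> 0" using n by (simp add: field_simps)
      then show ?thesis by (auto simp: mult_le_0_iff)
    qed
    then show ?thesis by (simp add: d_def)
  qed
  then show ?thesis by blast
qed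

text \<open>
  For complex-linear \<open>A\<close> the identity for the real inner product already carries the complex one,
  so that only the former is used below.
\<close>
lemma adj_unique:
  assumes "A \<in> bounded_ops" and "\<And>x y. inner (blinfun_apply A x) y = inner x (blinfun_apply B y)"
  shows "adj A = B"
  unfolding adj_def
proof (rule the_equality)
  show "\<forall>x y. cinner (blinfun_apply A x) y = cinner x (blinfun_apply B y)"
  proof (intro allI)
    fix x y
    have "inner (\<i> *\<^sub>C blinfun_apply A x) y = inner (\<i> *\<^sub>C x) (blinfun_apply B y)"
      using assms(2)[of "\<i> *\<^sub>C x" y] by (simp add: bounded_ops_apply[OF assms(1)])
    then show "cinner (blinfun_apply A x) y = cinner x (blinfun_apply B y)"
      unfolding cinner_eq_inner using assms(2) by simp
  qed
next
  fix B' assume B': "\<forall>x y. cinner (blinfun_apply A x) y = cinner x (blinfun_apply B' y)"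
  show "B' = B"
  proof (rule blinfun_eqI)
    fix y
    have "inner x (blinfun_apply B' y - blinfun_apply B y) = 0" for x
      using B' assms(2)[of x y] by (metis inner_diff_right inner_eq_Re_cinner right_minus_eq)
    then show "blinfun_apply B' y = blinfun_apply B y" by (metis inner_eq_zero_iff right_minus_eq)
  qed
qed

lemma inner_adj_right:
  assumes A: "A \<in> bounded_ops"
  shows "inner (blinfun_apply A x) y = inner x (blinfun_apply (adj A) y)"
proof -
  have "\<exists>z. \<forall>x. inner (blinfun_apply A x) y = inner x z" for y
    by (rule riesz_real)
      (rule bounded_linear_compose[OF bounded_linear_inner_left blinfun.bounded_linear_right])
  then obtain b where b: "\<And>x y. inner (blinfun_apply A x) y = inner x (b y)" by metis
  have eqI: "z = w" if "\<And>x. inner x z = inner x w" for z w :: 'a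
    using that[of "z - w"] by (metis inner_diff_right inner_eq_zero_iff right_minus_eq)
  have "bounded_linear b"
  proof (rule bounded_linear_intro)
    show "b (y + z) = b y + b z" for y z
      by (rule eqI) (simp add: b[symmetric] inner_add_right)
    show "b (r *\<^sub>R y) = r *\<^sub>R b y" for r y
      by (rule eqI) (simp add: b[symmetric])
    show "norm (b y) \<le> norm y * norm A" for y
    proof -
      have "norm (b y) * norm (b y) = inner (blinfun_apply A (b y)) y"
        by (simp add: b dot_square_norm power2_eq_square)
      also have "\<dots> \<le> norm (blinfun_apply A (b y)) * norm y" by (rule norm_cauchy_schwarz)
      also have "\<dots> \<le> norm (b y) * (norm y * norm A)"
        using mult_right_mono[OF norm_blinfun[of A "b y"], of "norm y"] by (simp add: algebra_simps)
      finally show ?thesis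
        by (cases "norm (b y) = 0") (auto simp: mult_le_cancel_left)
    qed
  qed
  then have "blinfun_apply (Blinfun b) = b" by (rule bounded_linear_Blinfun_apply)
  then have "adj A = Blinfun b" by (intro adj_unique[OF A]) (simp add: b)
  then show ?thesis by (simp add: b \<open>blinfun_apply (Blinfun b) = b\<close>)
qed

lemma inner_adj_left:
  "A \<in> bounded_ops \<Longrightarrow> inner (blinfun_apply (adj A) x) y = inner x (blinfun_apply A y)"
  by (metis inner_adj_right inner_commute)

lemma bounded_ops_add [intro, simp]: "A \<in> bounded_ops \<Longrightarrow> B \<in> bounded_ops \<Longrightarrow> A + B \<in> bounded_ops"
  by (simp add: bounded_ops_def blinfun.add_left scaleC_add_right)

lemma bounded_ops_diff [intro, simp]: "A \<in> bounded_ops \<Longrightarrow> B \<in> bounded_ops \<Longrightarrow> A - B \<in> bounded_ops"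
  by (simp add: bounded_ops_def blinfun.diff_left scaleC_diff_right)

lemma bounded_ops_scaleR [intro, simp]: "A \<in> bounded_ops \<Longrightarrow> r *\<^sub>R A \<in> bounded_ops"
  by (simp add: bounded_ops_def blinfun.scaleR_left scaleC_scaleR)

lemma bounded_ops_scaleC [intro, simp]: "A \<in> bounded_ops \<Longrightarrow> c *\<^sub>C A \<in> bounded_ops"
  by (simp add: bounded_ops_def scaleC_scaleC mult.commute)

lemma bounded_ops_compose [intro, simp]:
  "A \<in> bounded_ops \<Longrightarrow> B \<in> bounded_ops \<Longrightarrow> A o\<^sub>L B \<in> bounded_ops"
  by (simp add: bounded_ops_def)

lemma bounded_ops_id [simp]: "id_blinfun \<in> bounded_ops"
  by (simp add: bounded_ops_def)

lemma bounded_ops_zero [simp]: "0 \<in> bounded_ops"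
  by (simp add: bounded_ops_def)

lemma inner_eqI:
  fixes z w :: "'a::real_inner"
  shows "(\<And>x. inner x z = inner x w) \<Longrightarrow> z = w"
  by (metis inner_diff_right inner_eq_zero_iff right_minus_eq)

lemma bounded_ops_adj [intro, simp]: "A \<in> bounded_ops \<Longrightarrow> adj A \<in> bounded_ops"
proof -
  assume A: "A \<in> bounded_ops"
  have *: "inner x (c *\<^sub>C y) = inner (cnj c *\<^sub>C x) y" for c and x y :: "'c::complex_hilbert"
    by (simp add: inner_eq_Re_cinner cinner_scaleC_left cinner_scaleC_right)
  have "blinfun_apply (adj A) (c *\<^sub>C y) = c *\<^sub>C blinfun_apply (adj A) y" for c y
    by (rule inner_eqI)
      (simp add: * inner_adj_right[OF A, symmetric] bounded_ops_apply[OF A, symmetric] del: inner_adj_right)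
  then show ?thesis by (simp add: bounded_ops_def)
qed

lemma adj_adj [simp]: "A \<in> bounded_ops \<Longrightarrow> adj (adj A) = A"
  by (rule adj_unique) (auto simp: inner_adj_left)

lemma adj_compose:
  "A \<in> bounded_ops \<Longrightarrow> B \<in> bounded_ops \<Longrightarrow> adj (A o\<^sub>L B) = adj B o\<^sub>L adj A"
  by (rule adj_unique) (auto simp: inner_adj_right)

lemma adj_id [simp]: "adj id_blinfun = id_blinfun"
  by (rule adj_unique) auto

lemma selfadjoint_iff:
  "selfadjoint A \<longleftrightarrow>
     A \<in> bounded_ops \<and> (\<forall>x y. inner (blinfun_apply A x) y = inner x (blinfun_apply A y))"
  unfolding selfadjoint_def by (metis adj_unique inner_adj_right)

lemma selfadjointD: "selfadjoint A \<Longrightarrow> inner (blinfun_apply A x) y = inner x (blinfun_apply A y)"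
  by (simp add: selfadjoint_iff)

lemma selfadjoint_bounded_ops [simp]: "selfadjoint A \<Longrightarrow> A \<in> bounded_ops"
  by (simp add: selfadjoint_def)

lemma selfadjoint_add: "selfadjoint A \<Longrightarrow> selfadjoint B \<Longrightarrow> selfadjoint (A + B)"
  by (simp add: selfadjoint_iff blinfun.add_left inner_add_left inner_add_right)

lemma selfadjoint_diff: "selfadjoint A \<Longrightarrow> selfadjoint B \<Longrightarrow> selfadjoint (A - B)"
  by (simp add: selfadjoint_iff blinfun.diff_left inner_diff_left inner_diff_right)

lemma selfadjoint_scaleR: "selfadjoint A \<Longrightarrow> selfadjoint (r *\<^sub>R A)"
  by (simp add: selfadjoint_iff blinfun.scaleR_left)

lemma unitaryD:
  assumes "unitary U"
  shows "U \<in> bounded_ops" "blinfun_apply (adj U) (blinfun_apply U x) = x"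
    "blinfun_apply U (blinfun_apply (adj U) x) = x"
  using assms unfolding unitary_def by (metis blinfun_apply_blinfun_compose blinfun_apply_id_blinfun)+

lemma unitary_adj: "unitary U \<Longrightarrow> unitary (adj U)"
  by (auto simp: unitary_def)

lemma unitary_compose:
  assumes "unitary U" "unitary W" shows "unitary (U o\<^sub>L W)"
  using unitaryD[OF assms(1)] unitaryD[OF assms(2)] unfolding unitary_def
  by (auto simp: adj_compose intro!: blinfun_eqI)

lemma unitary_norm_apply: "unitary U \<Longrightarrow> norm (blinfun_apply U x) = norm x"
  by (metis inner_adj_right norm_eq unitaryD(1,2))

lemma unitary_norm_le: "unitary U \<Longrightarrow> norm U \<le> 1"
  by (rule norm_blinfun_bound) (auto simp: unitary_norm_apply)

lemma norm_unitary_compose_left: "unitary U \<Longrightarrow> norm (U o\<^sub>L A) \<le> norm A"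
  using norm_blinfun_compose[of U A] mult_right_mono[OF unitary_norm_le[of U], of "norm A"] by simp

lemma norm_unitary_compose_right: "unitary U \<Longrightarrow> norm (A o\<^sub>L U) \<le> norm A"
  using norm_blinfun_compose[of A U] mult_left_mono[OF unitary_norm_le[of U], of "norm A"] by simp

lemma norm_conj_le: "unitary U \<Longrightarrow> norm (U o\<^sub>L A o\<^sub>L adj U) \<le> norm A"
  by (meson norm_unitary_compose_left norm_unitary_compose_right order_trans unitary_adj)

lemma selfadjoint_conj:
  assumes "U \<in> bounded_ops" "selfadjoint A" shows "selfadjoint (U o\<^sub>L A o\<^sub>L adj U)"
  using assms inner_adj_right[OF assms(1)] inner_adj_left[OF assms(1)] selfadjointD[OF assms(2)]
  unfolding selfadjoint_iff[of "U o\<^sub>L A o\<^sub>L adj U"]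
  by auto

section \<open>One-parameter groups of operators\<close>

lemma op_power_0 [simp]: "op_power A 0 = id_blinfun"
  by (simp add: op_power_def)

lemma op_power_Suc: "op_power A (Suc n) = A o\<^sub>L op_power A n"
  by (simp add: op_power_def)

lemma norm_op_power: "norm (op_power A n) \<le> norm A ^ n"
proof (induction n)
  case 0
  show ?case by (simp add: norm_blinfun_id_le)
next
  case (Suc n)
  have "norm (op_power A (Suc n)) \<le> norm A * norm (op_power A n)"
    by (simp add: op_power_Suc norm_blinfun_compose)
  with Suc show ?case by (simp add: mult_left_mono order_trans)
qed

lemma op_power_scaleR: "op_power (r *\<^sub>R A) n = r ^ n *\<^sub>R op_power A n"
  by (induction n) (auto simp: op_power_Suc intro!: blinfun_eqI simp: blinfun.bilinear_simps)

lemma op_exp_scaleR: "op_exp (t *\<^sub>R K) = (\<Sum>n. (t ^ n / fact n) *\<^sub>R op_power K n)"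
  by (simp add: op_exp_def op_power_scaleR)

lemma summable_op_exp:
  fixes K :: "'a::complex_hilbert \<Rightarrow>\<^sub>L 'a"
  shows "summable (\<lambda>n. (t ^ n / fact n) *\<^sub>R op_power K n)"
proof (rule summable_comparison_test'[where N = 0])
  show "summable (\<lambda>n. inverse (fact n) * (\<bar>t\<bar> * norm K) ^ n)" by (rule summable_exp)
  show "norm ((t ^ n / fact n) *\<^sub>R op_power K n) \<le> inverse (fact n) * (\<bar>t\<bar> * norm K) ^ n" for n
    using mult_left_mono[OF norm_op_power[of K n], of "\<bar>t\<bar> ^ n / fact n"]
    by (simp add: power_abs power_mult_distrib field_simps)
qed

text \<open>
  The series is differentiated term by term; on a bounded interval the differentiated series is
  dominated by a multiple of the exponential series of \<open>R * norm K\<close>.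
\<close>
lemma op_exp_has_vector_derivative_left:
  fixes K :: "'a::complex_hilbert \<Rightarrow>\<^sub>L 'a"
  shows "((\<lambda>t. op_exp (t *\<^sub>R K)) has_vector_derivative (K o\<^sub>L op_exp (t *\<^sub>R K))) (at t)"
proof -
  define f where "f n t = (t ^ n / fact n) *\<^sub>R op_power K n" for n and t :: real
  define d where "d n t = (real n * t ^ (n - 1) / fact n) *\<^sub>R op_power K n" for n and t :: real
  define R where "R = \<bar>t\<bar> + 1"
  define S where "S = {- R<..<R}"
  have dSuc: "d (Suc n) s = K o\<^sub>L f n s" for n s
  proof -
    have "real (Suc n) * s ^ n / fact (Suc n) = s ^ n / fact n"
      by (simp add: fact_Suc del: of_nat_Suc)
    then show ?thesis
      by (simp add: d_def f_def op_power_Suc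
          bounded_bilinear.scaleR_right[OF bounded_bilinear_blinfun_compose])
  qed
  have sumf: "summable (\<lambda>n. f n s)" for s unfolding f_def by (rule summable_op_exp)
  have fexp: "(\<Sum>n. f n s) = op_exp (s *\<^sub>R K)" for s by (simp add: f_def op_exp_scaleR)
  have bl: "bounded_linear (\<lambda>A. K o\<^sub>L A)" by (rule bounded_bilinear.bounded_linear_right[OF bounded_bilinear_blinfun_compose])
  have sumd: "(\<Sum>n. d n s) = K o\<^sub>L op_exp (s *\<^sub>R K)" "summable (\<lambda>n. d n s)" for s
  proof -
    have s1: "summable (\<lambda>n. d (Suc n) s)"
      unfolding dSuc using bounded_linear.summable[OF bl sumf] .
    then show "summable (\<lambda>n. d n s)" using summable_Suc_iff by blast
    then have "(\<Sum>n. d n s) = (\<Sum>n. d (Suc n) s) + d 0 s" using suminf_split_head by fastforce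
    also have "\<dots> = K o\<^sub>L op_exp (s *\<^sub>R K)"
      by (simp add: dSuc bounded_linear.suminf[OF bl sumf, symmetric] fexp) (simp add: d_def)
    finally show "(\<Sum>n. d n s) = K o\<^sub>L op_exp (s *\<^sub>R K)" .
  qed
  define M where "M n = (case n of 0 \<Rightarrow> 0 | Suc n \<Rightarrow> norm K * (inverse (fact n) * (R * norm K) ^ n))" for n
  have ul: "uniform_limit S (\<lambda>n s. \<Sum>i<n. d i s) (\<lambda>s. \<Sum>i. d i s) sequentially"
  proof (rule Weierstrass_m_test)
    show "norm (d n s) \<le> M n" if "s \<in> S" for n s
    proof (cases n)
      case 0 then show ?thesis by (simp add: d_def M_def)
    next
      case (Suc m)
      have sR: "\<bar>s\<bar> \<le> R" using that by (auto simp: S_def)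
      have "norm (d n s) \<le> norm K * norm (f m s)" by (simp add: Suc dSuc norm_blinfun_compose)
      moreover have "norm (f m s) \<le> R ^ m / fact m * norm K ^ m"
        unfolding f_def using norm_op_power[of K m] power_mono[OF sR, of m]
          zero_le_power[of R m] by (auto simp: power_abs R_def intro!: mult_mono divide_right_mono)
      then have "norm K * norm (f m s) \<le> norm K * (R ^ m / fact m * norm K ^ m)"
        by (rule mult_left_mono) simp
      moreover have "norm K * (R ^ m / fact m * norm K ^ m) = M (Suc m)"
        by (simp add: M_def power_mult_distrib divide_inverse mult_ac)
      ultimately show ?thesis unfolding Suc by linarith
    qed
    have "summable (\<lambda>n. M (Suc n))" by (simp add: M_def summable_exp)
    then show "summable M" using summable_Suc_iff by blast
  qed
  have "\<exists>g. \<forall>s\<in>S. (\<lambda>n. f n s) sums g s \<and>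
      (g has_derivative (\<lambda>h. h *\<^sub>R (\<Sum>i. d i s))) (at s within S)"
  proof (rule has_derivative_series[where f' = "\<lambda>n s h. h *\<^sub>R d n s"])
    show "convex S" by (simp add: S_def)
    show "(f n has_derivative (\<lambda>h. h *\<^sub>R d n s)) (at s within S)" for n s
    proof -
      have "((\<lambda>s. s ^ n / fact n) has_real_derivative real n * s ^ (n - 1) / fact n) (at s within S)"
        by (auto intro!: derivative_eq_intros)
      then have "((\<lambda>s. (s ^ n / fact n) *\<^sub>R op_power K n) has_vector_derivative d n s) (at s within S)"
        unfolding has_real_derivative_iff_has_vector_derivative d_def
        by (rule bounded_linear.has_vector_derivative[OF bounded_linear_scaleR_left])
      then show ?thesis unfolding f_def has_vector_derivative_def .
    qed
    show "\<forall>\<^sub>F n in sequentially. \<forall>s\<in>S. \<forall>h. norm ((\<Sum>i<n. h *\<^sub>R d i s) - h *\<^sub>R (\<Sum>i. d i s)) \<le> e * norm h"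
      if "e > 0" for e
    proof -
      have "\<forall>\<^sub>F n in sequentially. \<forall>s\<in>S. norm ((\<Sum>i<n. d i s) - (\<Sum>i. d i s)) < e"
        using ul that by (auto simp: uniform_limit_iff dist_norm)
      then show ?thesis
      proof (eventually_elim, intro ballI allI)
        fix n s and h :: real assume "\<forall>s\<in>S. norm ((\<Sum>i<n. d i s) - (\<Sum>i. d i s)) < e" "s \<in> S"
        then have "norm ((\<Sum>i<n. d i s) - (\<Sum>i. d i s)) \<le> e" by fastforce
        then show "norm ((\<Sum>i<n. h *\<^sub>R d i s) - h *\<^sub>R (\<Sum>i. d i s)) \<le> e * norm h"
          by (simp add: scaleR_sum_right[symmetric] scaleR_diff_right[symmetric] mult.commute[of e] mult_left_mono)
      qed
    qed
    show "t \<in> S" by (auto simp: S_def R_def)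
    show "(\<lambda>n. f n t) sums (\<Sum>n. f n t)" using sumf by (rule summable_sums)
  qed
  then obtain g where g: "\<And>s. s \<in> S \<Longrightarrow> (\<lambda>n. f n s) sums g s"
      "\<And>s. s \<in> S \<Longrightarrow> (g has_vector_derivative (\<Sum>i. d i s)) (at s within S)"
    unfolding has_vector_derivative_def by blast
  have t: "t \<in> S" "open S" by (auto simp: S_def R_def)
  have "(g has_vector_derivative (\<Sum>i. d i t)) (at t)"
    using g(2)[OF t(1)] unfolding at_within_open[OF t] .
  then have "((\<lambda>t. op_exp (t *\<^sub>R K)) has_vector_derivative (\<Sum>i. d i t)) (at t)"
    by (rule has_vector_derivative_transform_within_open[OF _ t(2,1)])
      (metis g(1) fexp sums_unique)
  then show ?thesis by (simp add: sumd)
qed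

lemma op_exp_0 [simp]: "op_exp 0 = id_blinfun"
proof -
  have "(\<lambda>n. (1 / fact n) *\<^sub>R op_power (0::'a \<Rightarrow>\<^sub>L 'a) n) = (\<lambda>n. if n = 0 then id_blinfun else 0)"
    by (rule ext, case_tac n) (auto simp: op_power_Suc)
  then show ?thesis
    unfolding op_exp_def using sums_single[of 0 "\<lambda>_. id_blinfun::'a \<Rightarrow>\<^sub>L 'a"]
    by (simp add: sums_iff)
qed

lemma op_exp_commute:
  fixes K :: "'a::complex_hilbert \<Rightarrow>\<^sub>L 'a"
  assumes "B o\<^sub>L K = K o\<^sub>L B"
  shows "B o\<^sub>L op_exp (t *\<^sub>R K) = op_exp (t *\<^sub>R K) o\<^sub>L B"
proof -
  note bb = bounded_bilinear_blinfun_compose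
  have p: "B o\<^sub>L op_power K n = op_power K n o\<^sub>L B" for n
  proof (induction n)
    case 0 show ?case by (auto intro!: blinfun_eqI)
  next
    case (Suc n)
    then have "blinfun_apply B (blinfun_apply (op_power K n) x) = blinfun_apply (op_power K n) (blinfun_apply B x)"
      "blinfun_apply B (blinfun_apply K x) = blinfun_apply K (blinfun_apply B x)" for x
      using assms by (metis blinfun_apply_blinfun_compose)+
    then show ?case by (auto simp: op_power_Suc intro!: blinfun_eqI)
  qed
  have "B o\<^sub>L op_exp (t *\<^sub>R K) = (\<Sum>n. B o\<^sub>L ((t ^ n / fact n) *\<^sub>R op_power K n))"
    unfolding op_exp_scaleR
    by (rule bounded_linear.suminf[OF bounded_bilinear.bounded_linear_right[OF bb] summable_op_exp])
  also have "\<dots> = (\<Sum>n. ((t ^ n / fact n) *\<^sub>R op_power K n) o\<^sub>L B)"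
    by (simp add: bounded_bilinear.scaleR_left[OF bb] bounded_bilinear.scaleR_right[OF bb] p)
  also have "\<dots> = op_exp (t *\<^sub>R K) o\<^sub>L B"
    unfolding op_exp_scaleR
    by (rule bounded_linear.suminf[OF bounded_bilinear.bounded_linear_left[OF bb] summable_op_exp, symmetric])
  finally show ?thesis .
qed

text \<open>
  The unitary group \<open>e\<^sup>i\<^sup>t\<^sup>A\<close> when \<open>A\<close> is selfadjoint.
\<close>
definition evol :: "('a::complex_hilbert \<Rightarrow>\<^sub>L 'a) \<Rightarrow> real \<Rightarrow> 'a \<Rightarrow>\<^sub>L 'a" where
  "evol A t = op_exp (t *\<^sub>R (\<i> *\<^sub>C A))"

lemma op_exp_eq_evol: "op_exp ((\<i> * of_real t) *\<^sub>C A) = evol A t"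
proof -
  have "(\<i> * of_real t) *\<^sub>C A = t *\<^sub>R (\<i> *\<^sub>C A)"
    by (rule blinfun_eqI) (simp add: blinfun.scaleR_left scaleR_eq_scaleC scaleC_scaleC mult.commute)
  then show ?thesis by (simp add: evol_def)
qed

lemma evol_0 [simp]: "evol A 0 = id_blinfun"
  by (simp add: evol_def)

lemmas compose_has_vector_derivative =
  bounded_bilinear.has_vector_derivative[OF bounded_bilinear_blinfun_compose]
lemmas apply_has_vector_derivative =
  bounded_bilinear.has_vector_derivative[OF bounded_bilinear_blinfun_apply]

lemma evol_has_vector_derivative_left:
  "(evol A has_vector_derivative ((\<i> *\<^sub>C A) o\<^sub>L evol A t)) (at t within S)"
  unfolding evol_def[abs_def]
  by (rule has_vector_derivative_at_within[OF op_exp_has_vector_derivative_left])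

lemma evol_commute: "B o\<^sub>L (\<i> *\<^sub>C A) = (\<i> *\<^sub>C A) o\<^sub>L B \<Longrightarrow> B o\<^sub>L evol A t = evol A t o\<^sub>L B"
  unfolding evol_def by (rule op_exp_commute)

lemma evol_has_vector_derivative_right:
  "(evol A has_vector_derivative (evol A t o\<^sub>L (\<i> *\<^sub>C A))) (at t within S)"
  using evol_has_vector_derivative_left[of A t S] evol_commute[of "\<i> *\<^sub>C A" A t] by simp

lemma evol_minus_has_vector_derivative:
  "((\<lambda>s. evol A (- s)) has_vector_derivative - (evol A (- t) o\<^sub>L (\<i> *\<^sub>C A))) (at t within S)"
proof -
  have "((\<lambda>s. - s) has_vector_derivative -1) (at t within S)" by (auto intro!: derivative_eq_intros)
  from vector_diff_chain_within[OF this evol_has_vector_derivative_right[of A "- t" "uminus ` S"]]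
  show ?thesis by (simp add: o_def)
qed

lemma evol_bounded_ops [simp]:
  assumes "A \<in> bounded_ops" shows "evol A t \<in> bounded_ops"
proof -
  have "blinfun_apply (evol A t) (c *\<^sub>C x) = c *\<^sub>C blinfun_apply (evol A t) x" for c x
  proof -
    have "(c *\<^sub>C id_blinfun) o\<^sub>L evol A t = evol A t o\<^sub>L (c *\<^sub>C id_blinfun)"
      by (rule evol_commute, rule blinfun_eqI)
        (simp add: bounded_ops_apply[OF assms] scaleC_scaleC mult.commute)
    from arg_cong[OF this, of "\<lambda>B. blinfun_apply B x"] show ?thesis by simp
  qed
  then show ?thesis by (simp add: bounded_ops_def)
qed

lemma zero_vector_derivative_imp_eq:
  fixes f :: "real \<Rightarrow> 'a::real_normed_vector"
  assumes "\<And>s. (f has_vector_derivative 0) (at s)"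
  shows "f x = f y"
  using has_vector_derivative_zero_constant[of UNIV f] assms by (metis UNIV_I convex_UNIV)

text \<open>
  The left-hand side does not depend on \<open>s\<close>, as its derivative vanishes. The group law, the inverse
  and then unitarity all come from this.
\<close>
lemma evol_minus_add: "evol A (- s) o\<^sub>L evol A (s + t) = evol A t"
proof -
  have "((\<lambda>s. evol A (- s) o\<^sub>L evol A (s + t)) has_vector_derivative 0) (at s)" for s
  proof -
    have "((\<lambda>s. s + t) has_vector_derivative 1) (at s)" by (auto intro!: derivative_eq_intros)
    from vector_diff_chain_within[OF this evol_has_vector_derivative_left[of A "s + t"]]
    have d: "((\<lambda>s. evol A (s + t)) has_vector_derivative ((\<i> *\<^sub>C A) o\<^sub>L evol A (s + t))) (at s)"
      by (simp add: o_def)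
    show ?thesis
      by (rule has_vector_derivative_eq_rhs,
          rule compose_has_vector_derivative[OF evol_minus_has_vector_derivative d])
        (auto intro!: blinfun_eqI simp: blinfun.bilinear_simps)
  qed
  from zero_vector_derivative_imp_eq[OF this, of s 0] show ?thesis
    by (auto intro!: blinfun_eqI)
qed

lemma evol_minus_evol: "evol A (- t) o\<^sub>L evol A t = id_blinfun"
  using evol_minus_add[of A t 0] by simp

lemma evol_minus_apply [simp]:
  "blinfun_apply (evol A (- t)) (blinfun_apply (evol A t) x) = x"
  "blinfun_apply (evol A t) (blinfun_apply (evol A (- t)) x) = x"
  using evol_minus_evol[of A t] evol_minus_evol[of A "- t"]
  by (metis blinfun_apply_blinfun_compose blinfun_apply_id_blinfun minus_minus)+

lemma evol_add: "evol A (s + t) = evol A s o\<^sub>L evol A t"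
  using evol_minus_add[of A s t] by (metis (no_types, lifting) blinfun_apply_blinfun_compose blinfun_eqI evol_minus_apply(2))

text \<open>
  The derivative in \<open>t\<close> vanishes because \<open>\<i> A\<close> is skew.
\<close>
lemma inner_evol:
  assumes "selfadjoint A"
  shows "inner (blinfun_apply (evol A t) x) (blinfun_apply (evol A t) y) = inner x y"
proof -
  let ?f = "\<lambda>s. inner (blinfun_apply (evol A s) x) (blinfun_apply (evol A s) y)"
  have "(?f has_vector_derivative 0) (at s)" for s
  proof -
    have d: "((\<lambda>s. blinfun_apply (evol A s) z) has_vector_derivative
        \<i> *\<^sub>C blinfun_apply A (blinfun_apply (evol A s) z)) (at s)" for z
      using apply_has_vector_derivative[OF evol_has_vector_derivative_left has_vector_derivative_const]
      by (auto simp: blinfun.zero_right)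
    show ?thesis
      by (rule has_vector_derivative_eq_rhs,
          rule bounded_bilinear.has_vector_derivative[OF bounded_bilinear_inner d d])
        (simp add: inner_i_left selfadjointD[OF assms] bounded_ops_apply assms)
  qed
  from zero_vector_derivative_imp_eq[OF this, of t 0] show ?thesis by simp
qed

lemma adj_evol: "selfadjoint A \<Longrightarrow> adj (evol A t) = evol A (- t)"
  by (rule adj_unique) (auto, metis evol_minus_apply(2) inner_evol)

lemma unitary_evol: "selfadjoint A \<Longrightarrow> unitary (evol A t)"
  unfolding unitary_def using evol_minus_evol[of A t] evol_minus_evol[of A "- t"]
  by (simp add: adj_evol)

lemma increment_bound:
  fixes f :: "real \<Rightarrow> 'a::real_normed_vector"
  assumes "a \<le> b" and f: "\<And>t. t \<in> {a..b} \<Longrightarrow> (f has_vector_derivative f' t) (at t within {a..b})"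
    and B: "\<And>t. t \<in> {a..b} \<Longrightarrow> norm (f' t) \<le> B"
  shows "norm (f b - f a) \<le> B * (b - a)"
proof -
  have "norm (f b - f a) \<le> B * norm (b - a)"
  proof (rule differentiable_bound[of "{a..b}" f "\<lambda>t h. h *\<^sub>R f' t"])
    show "(f has_derivative (\<lambda>h. h *\<^sub>R f' t)) (at t within {a..b})" if "t \<in> {a..b}" for t
      using f[OF that] by (simp add: has_vector_derivative_def)
    show "onorm (\<lambda>h. h *\<^sub>R f' t) \<le> B" if "t \<in> {a..b}" for t
    proof (rule onorm_bound)
      show "0 \<le> B" using order_trans[OF norm_ge_zero B[OF that]] .
      show "norm (h *\<^sub>R f' t) \<le> B * norm h" for h
        using mult_right_mono[OF B[OF that], of "norm h"] by (simp add: mult.commute)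
    qed
  qed (use \<open>a \<le> b\<close> in auto)
  then show ?thesis using \<open>a \<le> b\<close> by simp
qed

section \<open>Minimal operators\<close>

text \<open>
  With \<open>N\<close> the norm, almost maximizing vectors are almost annihilated by
  \<open>T\<^sup>2 - N\<^sup>2 = (T - N) (T + N)\<close>, and \<open>(T + N) x\<close>, \<open>(T - N) x\<close> cannot both be small.
\<close>
lemma selfadjoint_approx_eigenvector:
  assumes T: "selfadjoint T" "T \<noteq> 0" and "e > 0"
  shows "\<exists>\<xi> \<sigma>. norm \<xi> = 1 \<and> (\<sigma> = 1 \<or> \<sigma> = -1) \<and> norm (blinfun_apply T \<xi> - (\<sigma> * norm T) *\<^sub>R \<xi>) \<le> e"
proof -
  define N where "N = norm T"
  have N: "N > 0" using T(2) by (simp add: N_def)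
  \<comment> \<open>Below \<open>N\<close>, but so close that a vector with \<open>norm (T x) > c * norm x\<close> makes the residual \<open>w\<close> small.\<close>
  define c where "c = sqrt (max 0 (N\<^sup>2 - e\<^sup>2))"
  have c: "0 \<le> c" "N\<^sup>2 - e\<^sup>2 \<le> c\<^sup>2" by (auto simp: c_def)
  have "c < sqrt (N\<^sup>2)" unfolding c_def using N \<open>e > 0\<close> by (intro real_sqrt_less_mono) auto
  then have "c < N" using N by simp
  then have "\<not> (\<forall>x. norm (blinfun_apply T x) \<le> c * norm x)"
    using norm_blinfun_bound[OF c(1), of T] by (auto simp: N_def)
  then obtain x where x: "c * norm x < norm (blinfun_apply T x)" by (auto simp: not_le)
  then have x0: "norm x > 0" using c(1) by (cases "x = 0") auto
  define y where "y = blinfun_apply T x"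
  define w where "w = blinfun_apply T y - N\<^sup>2 *\<^sub>R x"
  have y: "(N\<^sup>2 - e\<^sup>2) * (norm x)\<^sup>2 \<le> (norm y)\<^sup>2"
  proof -
    have "(N\<^sup>2 - e\<^sup>2) * (norm x)\<^sup>2 \<le> c\<^sup>2 * (norm x)\<^sup>2" using c(2) by (rule mult_right_mono) simp
    also have "\<dots> = (c * norm x)\<^sup>2" by (simp add: power_mult_distrib)
    also have "\<dots> \<le> (norm y)\<^sup>2" using x c(1) by (intro power_mono) (auto simp: y_def)
    finally show ?thesis .
  qed
  have "(norm w)\<^sup>2 = (norm (blinfun_apply T y))\<^sup>2 - 2 * N\<^sup>2 * (norm y)\<^sup>2 + N\<^sup>2 * N\<^sup>2 * (norm x)\<^sup>2"
  proof -
    have "inner (blinfun_apply T y) x = (norm y)\<^sup>2"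
      by (simp add: selfadjointD[OF T(1)] y_def power2_norm_eq_inner)
    moreover have "(norm w)\<^sup>2 = (norm (blinfun_apply T y))\<^sup>2 - 2 * (N\<^sup>2 * inner (blinfun_apply T y) x)
        + N\<^sup>2 * (N\<^sup>2 * (norm x)\<^sup>2)"
      unfolding w_def using dot_norm_neg[of "blinfun_apply T y" "N\<^sup>2 *\<^sub>R x"]
      by (simp add: power2_eq_square algebra_simps)
    ultimately show ?thesis by simp
  qed
  also have "(norm (blinfun_apply T y))\<^sup>2 \<le> N\<^sup>2 * (norm y)\<^sup>2"
    using power_mono[OF norm_blinfun[of T y], of 2] by (simp add: N_def power_mult_distrib)
  also have "N\<^sup>2 * (norm y)\<^sup>2 - 2 * N\<^sup>2 * (norm y)\<^sup>2 + N\<^sup>2 * N\<^sup>2 * (norm x)\<^sup>2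
      = N\<^sup>2 * (N\<^sup>2 * (norm x)\<^sup>2 - (norm y)\<^sup>2)" by (simp add: algebra_simps)
  also have "\<dots> \<le> N\<^sup>2 * (e\<^sup>2 * (norm x)\<^sup>2)"
    using y by (intro mult_left_mono) (auto simp: algebra_simps)
  finally have "(norm w)\<^sup>2 \<le> (N * e * norm x)\<^sup>2" by (simp add: power_mult_distrib mult.assoc)
  then have w: "norm w \<le> N * e * norm x"
    by (rule power2_le_imp_le) (use N \<open>e > 0\<close> in simp)
  have main: "\<exists>\<xi> \<sigma>. norm \<xi> = 1 \<and> (\<sigma> = 1 \<or> \<sigma> = -1) \<and> norm (blinfun_apply T \<xi> - (\<sigma> * N) *\<^sub>R \<xi>) \<le> e"
    if \<sigma>: "\<sigma> = 1 \<or> \<sigma> = -1" and p: "N * norm x \<le> norm (y + (\<sigma> * N) *\<^sub>R x)" for \<sigma>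
  proof -
    define p where "p = y + (\<sigma> * N) *\<^sub>R x"
    have p0: "norm p > 0" using p N x0 by (metis mult_pos_pos order_less_le_trans p_def)
    have "blinfun_apply T p - (\<sigma> * N) *\<^sub>R p = w"
      using \<sigma> unfolding p_def w_def
      by (auto simp: blinfun.bilinear_simps algebra_simps power2_eq_square y_def[symmetric])
    then have "norm (blinfun_apply T ((1 / norm p) *\<^sub>R p) - (\<sigma> * N) *\<^sub>R ((1 / norm p) *\<^sub>R p)) = norm w / norm p"
    proof -
      assume *: "blinfun_apply T p - (\<sigma> * N) *\<^sub>R p = w"
      have "blinfun_apply T ((1 / norm p) *\<^sub>R p) - (\<sigma> * N) *\<^sub>R ((1 / norm p) *\<^sub>R p) = (1 / norm p) *\<^sub>R w"
        unfolding *[symmetric] by (simp add: blinfun.bilinear_simps scaleR_diff_right mult.commute)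
      then show ?thesis by simp
    qed
    also have "\<dots> \<le> e"
    proof -
      have "norm w \<le> e * (N * norm x)" using w by (simp add: mult_ac)
      also have "\<dots> \<le> e * norm p" using p \<open>e > 0\<close> by (simp add: p_def)
      finally show ?thesis using p0 by (simp add: pos_divide_le_eq)
    qed
    finally show ?thesis using \<sigma> p0 by (intro exI[of _ "(1 / norm p) *\<^sub>R p"] exI[of _ \<sigma>]) auto
  qed
  have "2 * (N * norm x) = norm ((y + N *\<^sub>R x) - (y - N *\<^sub>R x))"
  proof -
    have "(y + N *\<^sub>R x) - (y - N *\<^sub>R x) = (2 * N) *\<^sub>R x" by (simp add: scaleR_left_distrib[symmetric])
    then show ?thesis using N by simp
  qed
  also have "\<dots> \<le> norm (y + N *\<^sub>R x) + norm (y - N *\<^sub>R x)" by (rule norm_triangle_ineq4)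
  finally have "N * norm x \<le> norm (y + (1 * N) *\<^sub>R x) \<or> N * norm x \<le> norm (y + (-1 * N) *\<^sub>R x)"
    by simp linarith
  then show ?thesis using main[of 1] main[of "-1"] unfolding N_def by blast
qed

text \<open>
  Undo the rotation \<open>e\<^sup>i\<^sup>s\<^sup>l\<close> that a true eigenvector would undergo: what remains moves with speed at most the
  norm of \<open>A \<xi> - l \<xi>\<close>.
\<close>
lemma evol_approx_eigenvector:
  assumes A: "selfadjoint A" and "0 \<le> t"
  shows "norm (blinfun_apply (evol A (- t)) \<xi> - cis (- (t * l)) *\<^sub>C \<xi>)
    \<le> norm (blinfun_apply A \<xi> - l *\<^sub>R \<xi>) * t"
proof -
  define f where "f s = blinfun_apply (evol A s) (cis (- (s * l)) *\<^sub>C \<xi>)" for s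
  have bl: "bounded_linear (\<lambda>c. c *\<^sub>C \<xi>)"
    by (rule bounded_linear_intro[where K = "norm \<xi>"])
      (auto simp: scaleC_add_left scaleR_eq_scaleC scaleC_scaleC norm_scaleC scaleC_complex_def)
  have d: "(f has_vector_derivative blinfun_apply (evol A s)
      (\<i> *\<^sub>C cis (- (s * l)) *\<^sub>C (blinfun_apply A \<xi> - l *\<^sub>R \<xi>))) (at s within S)" for s S
  proof -
    have "((\<lambda>s. cis (- (s * l))) has_vector_derivative (- l) *\<^sub>R (\<i> * cis (- (s * l)))) (at s within S)"
      unfolding has_vector_derivative_complex_iff has_real_derivative_iff_has_vector_derivative[symmetric]
      by (auto intro!: derivative_eq_intros)
    from apply_has_vector_derivative[OF evol_has_vector_derivative_right[of A s S]
        bounded_linear.has_vector_derivative[OF bl this]]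
    show ?thesis unfolding f_def
      by (rule has_vector_derivative_eq_rhs)
        (simp add: bounded_ops_apply A blinfun.bilinear_simps scaleC_diff_right scaleC_scaleR
          scaleR_eq_scaleC scaleC_scaleC scaleC_complex_def scaleC_minus_left algebra_simps)
  qed
  have "norm (f t - f 0) \<le> norm (blinfun_apply A \<xi> - l *\<^sub>R \<xi>) * (t - 0)"
    by (rule increment_bound[OF \<open>0 \<le> t\<close> d])
      (simp add: unitary_norm_apply[OF unitary_evol[OF A]] norm_scaleC)
  moreover have "f t - f 0 = blinfun_apply (evol A t) (cis (- (t * l)) *\<^sub>C \<xi> - blinfun_apply (evol A (- t)) \<xi>)"
    by (simp add: f_def blinfun.diff_right)
  ultimately show ?thesis
    by (simp add: unitary_norm_apply[OF unitary_evol[OF A]] norm_minus_commute)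
qed

lemma compose_commute_apply: "A o\<^sub>L B = B o\<^sub>L A \<Longrightarrow> blinfun_apply A (blinfun_apply B x) = blinfun_apply B (blinfun_apply A x)"
  by (metis blinfun_apply_blinfun_compose)

text \<open>
  Perturb a minimal \<open>Z\<close> by the imaginary part \<open>Y\<close> of \<open>b\<close>. Since \<open>Z + s Y\<close> has norm at least \<open>norm Z\<close>,
  it has an approximate eigenvector \<open>\<xi>\<close> for an eigenvalue of at least that modulus; comparing with
  \<open>Z\<close> itself, \<open>\<xi>\<close> is nearly an eigenvector of \<open>Z\<close> for \<open>\<sigma> * norm Z\<close>, and \<open>\<sigma> * inner (Y \<xi>) \<xi>\<close> is not
  much less than \<open>0\<close>. This is the sign for which \<open>b\<close> cannot undo the rotation of \<open>\<xi>\<close> by \<open>e\<^sup>i\<^sup>t\<^sup>Z\<close>. The vector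
  depends on \<open>b\<close>; choosing it this way takes the place of a single norming functional of \<open>Z\<close> that
  vanishes on the commutant.
\<close>
lemma minimal_moves_some_vector:
  assumes Z: "selfadjoint Z" "Z \<noteq> 0" and G: "selfadjoint G"
    and minimal: "\<And>Y. selfadjoint Y \<Longrightarrow> Y o\<^sub>L G = G o\<^sub>L Y \<Longrightarrow> norm Z \<le> norm (Z + Y)"
    and b: "b \<in> bounded_ops" "b o\<^sub>L G = G o\<^sub>L b" "norm b \<le> 1"
    and t: "0 \<le> t" "t * norm Z \<le> pi / 2" and "e > 0"
  shows "\<exists>\<xi>. norm \<xi> = 1 \<and> inner (blinfun_apply (evol Z t) (blinfun_apply b \<xi>)) \<xi> \<le> cos (t * norm Z) + e"
proof -
  define Y where "Y = (1/2) *\<^sub>R ((- \<i>) *\<^sub>C b + \<i> *\<^sub>C adj b)"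
  note badj = inner_adj_right[OF b(1)] inner_adj_left[OF b(1)]
  have Yops: "Y \<in> bounded_ops" using b(1) by (simp add: Y_def)
  have Yx: "inner (blinfun_apply Y x) y = (inner (blinfun_apply b x) (\<i> *\<^sub>C y) - inner x (\<i> *\<^sub>C blinfun_apply b y)) / 2" for x y
    by (simp add: Y_def blinfun.bilinear_simps inner_add_left inner_diff_left inner_i_left scaleC_minus_left badj(2)
        bounded_ops_apply[OF b(1)])
  have Ysa: "selfadjoint Y"
    unfolding selfadjoint_iff
  proof (intro conjI allI Yops)
    fix x y
    have "inner x (blinfun_apply Y y) = inner (blinfun_apply Y y) x" by (rule inner_commute)
    also have "\<dots> = inner (blinfun_apply Y x) y"
      unfolding Yx using inner_i_left[of "blinfun_apply b x" y] inner_i_left[of "x" "blinfun_apply b y"]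
        inner_i_left[of "blinfun_apply b y" x] inner_i_left[of y "blinfun_apply b x"]
      by (simp add: inner_commute)
    finally show "inner (blinfun_apply Y x) y = inner x (blinfun_apply Y y)" by simp
  qed
  have YG: "Y o\<^sub>L G = G o\<^sub>L Y"
  proof -
    have "adj b o\<^sub>L G = G o\<^sub>L adj b"
      using arg_cong[OF b(2), of adj] G b(1) by (simp add: adj_compose selfadjoint_def)
    then show ?thesis
      using compose_commute_apply[OF b(2)] compose_commute_apply[of "adj b" G] G
      by (auto intro!: blinfun_eqI simp: Y_def blinfun.bilinear_simps bounded_ops_apply)
  qed
  define m where "m = norm Z"
  define y where "y = norm Y"
  \<comment> \<open>All errors below add up to at most \<open>s + t * (s\<^sup>2 + 2 * s * y)\<close>, and \<open>s\<^sup>2 \<le> s\<close>.\<close>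
  define s where "s = min 1 (e / (1 + t + 2 * t * y))"
  have ty: "t * y \<ge> 0" using t by (simp add: y_def)
  have s: "0 < s" "s \<le> 1" using \<open>e > 0\<close> t ty by (auto simp: s_def)
  have se: "s * (1 + t + 2 * t * y) \<le> e"
  proof -
    have "s \<le> e / (1 + t + 2 * t * y)" by (simp add: s_def)
    then show ?thesis using t ty by (simp add: pos_le_divide_eq)
  qed
  define T where "T = Z + s *\<^sub>R Y"
  have Tsa: "selfadjoint T" unfolding T_def by (intro selfadjoint_add selfadjoint_scaleR Z Ysa)
  have N: "m \<le> norm T" unfolding m_def T_def
    by (rule minimal[OF selfadjoint_scaleR[OF Ysa]])
      (simp add: YG bounded_bilinear.scaleR_left[OF bounded_bilinear_blinfun_compose]
        bounded_bilinear.scaleR_right[OF bounded_bilinear_blinfun_compose])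
  have N': "norm T \<le> m + s * y"
    using norm_triangle_ineq[of Z "s *\<^sub>R Y"] s by (simp add: T_def m_def y_def)
  have "T \<noteq> 0" using N Z(2) by (auto simp: m_def)
  with selfadjoint_approx_eigenvector[OF Tsa, of "s\<^sup>2"] s obtain \<xi> \<sigma> where
    \<xi>: "norm \<xi> = 1" and \<sigma>: "\<sigma> = 1 \<or> \<sigma> = -1"
    and ev: "norm (blinfun_apply T \<xi> - (\<sigma> * norm T) *\<^sub>R \<xi>) \<le> s\<^sup>2" by auto
  have \<xi>\<xi>: "inner \<xi> \<xi> = 1" using \<xi> by (simp add: dot_square_norm)
  have bxi: "norm (blinfun_apply b \<xi>) \<le> 1" using norm_blinfun[of b \<xi>] b(3) \<xi> by simp
  have Yxi: "norm (blinfun_apply Y \<xi>) \<le> y" using norm_blinfun[of Y \<xi>] \<xi> by (simp add: y_def)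
  define Yv where "Yv = inner (blinfun_apply Y \<xi>) \<xi>"
  have Yv: "Yv = inner (blinfun_apply b \<xi>) (\<i> *\<^sub>C \<xi>)"
    unfolding Yv_def Yx
    using inner_i_left[of \<xi> "blinfun_apply b \<xi>"] inner_commute[of "\<i> *\<^sub>C \<xi>" "blinfun_apply b \<xi>"] by simp
  have Zev: "norm (blinfun_apply Z \<xi> - (\<sigma> * m) *\<^sub>R \<xi>) \<le> s\<^sup>2 + 2 * s * y"
  proof -
    have "blinfun_apply Z \<xi> - (\<sigma> * m) *\<^sub>R \<xi> = (blinfun_apply T \<xi> - (\<sigma> * norm T) *\<^sub>R \<xi>)
        + (\<sigma> * (norm T - m)) *\<^sub>R \<xi> - s *\<^sub>R blinfun_apply Y \<xi>"
      by (simp add: T_def blinfun.bilinear_simps algebra_simps)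
    then have "norm (blinfun_apply Z \<xi> - (\<sigma> * m) *\<^sub>R \<xi>) \<le> norm (blinfun_apply T \<xi> - (\<sigma> * norm T) *\<^sub>R \<xi>)
        + norm ((\<sigma> * (norm T - m)) *\<^sub>R \<xi>) + norm (s *\<^sub>R blinfun_apply Y \<xi>)"
      by (simp only:) (intro order_trans[OF norm_triangle_ineq4] add_right_mono norm_triangle_ineq)
    moreover have "norm ((\<sigma> * (norm T - m)) *\<^sub>R \<xi>) \<le> s * y" using \<sigma> \<xi> N N' by auto
    moreover have "norm (s *\<^sub>R blinfun_apply Y \<xi>) \<le> s * y" using Yxi s by simp
    ultimately show ?thesis using ev by linarith
  qed
  \<comment> \<open>On \<open>\<xi>\<close> the form of \<open>\<sigma> T\<close> is almost at least \<open>m\<close>, that of \<open>\<sigma> Z\<close> at most \<open>m\<close>; \<open>s \<sigma> Y\<close> is the difference.\<close>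
  have sign: "- s \<le> \<sigma> * Yv"
  proof -
    have "\<sigma> * inner (blinfun_apply Z \<xi>) \<xi> \<le> m"
      using Cauchy_Schwarz_ineq2[of "blinfun_apply Z \<xi>" \<xi>] norm_blinfun[of Z \<xi>] \<xi> \<sigma> by (auto simp: m_def)
    moreover have "\<sigma> * inner (blinfun_apply T \<xi>) \<xi> = \<sigma> * inner (blinfun_apply Z \<xi>) \<xi> + s * (\<sigma> * Yv)"
      by (simp add: T_def Yv_def blinfun.bilinear_simps inner_add_left algebra_simps)
    moreover have "norm T - s\<^sup>2 \<le> \<sigma> * inner (blinfun_apply T \<xi>) \<xi>"
    proof -
      have "\<bar>inner (blinfun_apply T \<xi> - (\<sigma> * norm T) *\<^sub>R \<xi>) \<xi>\<bar> \<le> s\<^sup>2"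
        using Cauchy_Schwarz_ineq2[of "blinfun_apply T \<xi> - (\<sigma> * norm T) *\<^sub>R \<xi>" \<xi>] ev \<xi> by simp
      then show ?thesis using \<sigma> by (auto simp: inner_diff_left \<xi>\<xi>)
    qed
    ultimately have "s * (- s) \<le> s * (\<sigma> * Yv)" using N by (simp add: power2_eq_square)
    then show ?thesis using s(1) by (simp only: mult_le_cancel_left_pos)
  qed
  define ph where "ph = cis (- (t * (\<sigma> * m))) *\<^sub>C \<xi>"
  have tm: "0 \<le> t * m" "t * m \<le> pi / 2" using t by (auto simp: m_def)
  have sc: "0 \<le> sin (t * m)" "sin (t * m) \<le> 1" "0 \<le> cos (t * m)"
    using tm by (auto intro!: sin_ge_zero cos_ge_zero)
  have "inner (blinfun_apply b \<xi>) ph = cos (t * m) * inner (blinfun_apply b \<xi>) \<xi> - sin (t * m) * (\<sigma> * Yv)"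
  proof -
    have "cis (- (t * (\<sigma> * m))) = complex_of_real (cos (t * m)) + complex_of_real (- \<sigma> * sin (t * m)) * \<i>"
      using \<sigma> by (auto simp: complex_eq_iff)
    then have "ph = cos (t * m) *\<^sub>R \<xi> + (- \<sigma> * sin (t * m)) *\<^sub>R (\<i> *\<^sub>C \<xi>)"
      by (simp only: ph_def scaleC_add_left scaleC_scaleC[symmetric] scaleR_eq_scaleC)
    then show ?thesis by (simp add: inner_add_right inner_diff_right Yv)
  qed
  also have "\<dots> \<le> cos (t * m) * 1 + 1 * s"
  proof -
    have "inner (blinfun_apply b \<xi>) \<xi> \<le> 1"
      using norm_cauchy_schwarz[of "blinfun_apply b \<xi>" \<xi>] bxi \<xi> by simp
    then have "cos (t * m) * inner (blinfun_apply b \<xi>) \<xi> \<le> cos (t * m) * 1" using sc by (intro mult_left_mono)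
    moreover have "sin (t * m) * (- (\<sigma> * Yv)) \<le> sin (t * m) * s" using sign sc by (intro mult_left_mono) auto
    moreover have "sin (t * m) * s \<le> 1 * s" using sc s by (intro mult_right_mono) auto
    ultimately show ?thesis by simp
  qed
  finally have 1: "inner (blinfun_apply b \<xi>) ph \<le> cos (t * m) + s" by simp
  have 2: "inner (blinfun_apply b \<xi>) (blinfun_apply (evol Z (- t)) \<xi> - ph) \<le> (s\<^sup>2 + 2 * s * y) * t"
  proof -
    have "inner (blinfun_apply b \<xi>) (blinfun_apply (evol Z (- t)) \<xi> - ph)
        \<le> norm (blinfun_apply b \<xi>) * norm (blinfun_apply (evol Z (- t)) \<xi> - ph)" by (rule norm_cauchy_schwarz)
    also have "\<dots> \<le> 1 * norm (blinfun_apply (evol Z (- t)) \<xi> - ph)" using bxi by (rule mult_right_mono) simp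
    also have "\<dots> \<le> norm (blinfun_apply Z \<xi> - (\<sigma> * m) *\<^sub>R \<xi>) * t"
      unfolding ph_def using evol_approx_eigenvector[OF Z(1) t(1), of \<xi> "\<sigma> * m"] by simp
    also have "\<dots> \<le> (s\<^sup>2 + 2 * s * y) * t" using Zev t(1) by (rule mult_right_mono)
    finally show ?thesis .
  qed
  have 3: "s + (s\<^sup>2 + 2 * s * y) * t \<le> e"
  proof -
    have "s\<^sup>2 * t \<le> s * t" using s t by (intro mult_right_mono) (auto simp: power2_eq_square mult_left_le)
    then show ?thesis using se by (simp add: algebra_simps)
  qed
  have "inner (blinfun_apply (evol Z t) (blinfun_apply b \<xi>)) \<xi> = inner (blinfun_apply b \<xi>) (blinfun_apply (evol Z (- t)) \<xi>)"
    using inner_adj_right[of "evol Z t"] by (simp add: adj_evol Z(1))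
  also have "\<dots> = inner (blinfun_apply b \<xi>) ph + inner (blinfun_apply b \<xi>) (blinfun_apply (evol Z (- t)) \<xi> - ph)"
    by (simp add: inner_diff_right)
  also have "\<dots> \<le> cos (t * m) + e" using 1 2 3 by linarith
  finally show ?thesis using \<xi> by (auto simp: m_def)
qed

section \<open>Symmetries and averaging\<close>

definition symmetry :: "('a::complex_hilbert \<Rightarrow>\<^sub>L 'a) \<Rightarrow> bool" where
  "symmetry S \<longleftrightarrow> selfadjoint S \<and> S o\<^sub>L S = id_blinfun"

lemma symmetry_unitary: "symmetry S \<Longrightarrow> unitary S"
  by (simp add: symmetry_def unitary_def selfadjoint_def)

lemma symmetry_apply [simp]: "symmetry S \<Longrightarrow> blinfun_apply S (blinfun_apply S x) = x"
  unfolding symmetry_def by (metis blinfun_apply_blinfun_compose blinfun_apply_id_blinfun)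

text \<open>
  For a symmetry \<open>S\<close> this is the norm-decreasing projection onto the commutant of \<open>S\<close>.
\<close>
definition average :: "('a::complex_hilbert \<Rightarrow>\<^sub>L 'a) \<Rightarrow> ('a \<Rightarrow>\<^sub>L 'a) \<Rightarrow> ('a \<Rightarrow>\<^sub>L 'a)" where
  "average S A = (1/2) *\<^sub>R (A + (S o\<^sub>L A o\<^sub>L S))"

lemma norm_half_add_le: "norm A \<le> c \<Longrightarrow> norm B \<le> c \<Longrightarrow> norm ((1/2) *\<^sub>R (A + B)) \<le> (c :: real)"
  using norm_triangle_ineq[of A B] by simp

lemma norm_symmetry_conj_le: "symmetry S \<Longrightarrow> norm (S o\<^sub>L A o\<^sub>L S) \<le> norm A"
  by (meson norm_unitary_compose_left norm_unitary_compose_right order_trans symmetry_unitary)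

lemma average_commutes: "symmetry S \<Longrightarrow> average S A o\<^sub>L S = S o\<^sub>L average S A"
  by (rule blinfun_eqI) (simp add: average_def blinfun.bilinear_simps add.commute)

lemma average_bounded_ops: "symmetry S \<Longrightarrow> A \<in> bounded_ops \<Longrightarrow> average S A \<in> bounded_ops"
  by (simp add: average_def symmetry_def)

lemma norm_average_le: "symmetry S \<Longrightarrow> norm (average S A) \<le> norm A"
  unfolding average_def by (intro norm_half_add_le norm_symmetry_conj_le order_refl)

lemma average_selfadjoint: "symmetry S \<Longrightarrow> selfadjoint A \<Longrightarrow> selfadjoint (average S A)"
  using selfadjoint_conj[of S A] unfolding average_def
  by (intro selfadjoint_scaleR selfadjoint_add) (auto simp: symmetry_def selfadjoint_def)

lemma norm_average_diff_le:
  assumes "symmetry S" shows "norm (average S A - A) \<le> norm ((A o\<^sub>L S) - (S o\<^sub>L A))"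
proof -
  have "average S A - A = (1/2) *\<^sub>R ((S o\<^sub>L A o\<^sub>L S) - (A o\<^sub>L S o\<^sub>L S))"
    by (rule blinfun_eqI) (simp add: average_def blinfun.bilinear_simps assms algebra_simps
        flip: scaleR_add_left)
  also have "(S o\<^sub>L A o\<^sub>L S) - (A o\<^sub>L S o\<^sub>L S) = - (((A o\<^sub>L S) - (S o\<^sub>L A)) o\<^sub>L S)"
    by (rule blinfun_eqI) (simp add: blinfun.bilinear_simps)
  also have "norm ((1/2) *\<^sub>R (- (((A o\<^sub>L S) - (S o\<^sub>L A)) o\<^sub>L S))) \<le> norm (((A o\<^sub>L S) - (S o\<^sub>L A)) o\<^sub>L S)"
    by simp
  also have "\<dots> \<le> norm ((A o\<^sub>L S) - (S o\<^sub>L A))"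
    by (rule norm_unitary_compose_right[OF symmetry_unitary[OF assms]])
  finally show ?thesis .
qed

text \<open>
  The commutator of the average is the average of the commutator. Hence averages over commuting
  symmetries can be taken one after the other, and what commutes with \<open>T\<close> continues to do so.
\<close>
lemma norm_average_commutator_le:
  assumes S: "symmetry S" and T: "T o\<^sub>L S = S o\<^sub>L T"
  shows "norm ((average S A o\<^sub>L T) - (T o\<^sub>L average S A)) \<le> norm ((A o\<^sub>L T) - (T o\<^sub>L A))"
proof -
  have "(average S A o\<^sub>L T) - (T o\<^sub>L average S A) = average S ((A o\<^sub>L T) - (T o\<^sub>L A))"
    by (rule blinfun_eqI)
      (simp add: average_def blinfun.bilinear_simps compose_commute_apply[OF T] algebra_simps)
  then show ?thesis using norm_average_le[OF S] by simp
qed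

section \<open>Selfadjoint tripotents and their tangent vectors\<close>

definition tripotent :: "('a::complex_hilbert \<Rightarrow>\<^sub>L 'a) \<Rightarrow> bool" where
  "tripotent G \<longleftrightarrow> selfadjoint G \<and> G o\<^sub>L G o\<^sub>L G = G"

lemma tripotent_apply [simp]:
  "tripotent G \<Longrightarrow> blinfun_apply G (blinfun_apply G (blinfun_apply G x)) = blinfun_apply G x"
  unfolding tripotent_def by (metis blinfun_apply_blinfun_compose)

lemma tripotent_selfadjoint [simp]: "tripotent G \<Longrightarrow> selfadjoint G"
  by (simp add: tripotent_def)

lemma selfadjoint_id [simp]: "selfadjoint id_blinfun"
  by (simp add: selfadjoint_def)

lemma selfadjoint_square: "selfadjoint A \<Longrightarrow> selfadjoint (A o\<^sub>L A)"
  by (simp add: selfadjoint_iff)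

text \<open>
  \<open>G\<^sup>2\<close> is an orthogonal projection, and \<open>(norm (G x))\<^sup>2 = inner x (G\<^sup>2 x)\<close>.
\<close>
lemma norm_tripotent_le:
  assumes G: "tripotent G" shows "norm G \<le> 1"
proof (rule norm_blinfun_bound)
  fix x
  let ?y = "blinfun_apply G (blinfun_apply G x)"
  note sa = selfadjointD[OF tripotent_selfadjoint[OF G]]
  have "(norm ?y)\<^sup>2 = inner x ?y"
    by (simp only: power2_norm_eq_inner sa tripotent_apply[OF G])
  then have "norm ?y * norm ?y = inner x ?y" by (simp only: power2_eq_square)
  also have "\<dots> \<le> norm x * norm ?y" by (rule norm_cauchy_schwarz)
  finally have y: "norm ?y \<le> norm x" by (cases "norm ?y = 0") (auto simp: mult_le_cancel_right)
  have "(norm (blinfun_apply G x))\<^sup>2 = inner x ?y"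
    by (simp only: power2_norm_eq_inner sa)
  also have "\<dots> \<le> norm x * norm ?y" by (rule norm_cauchy_schwarz)
  also have "\<dots> \<le> (norm x)\<^sup>2" using y by (simp add: power2_eq_square mult_left_mono)
  finally show "norm (blinfun_apply G x) \<le> 1 * norm x" by (simp add: abs_le_square_iff[symmetric])
qed simp

lemma scaleR_four: "4 *\<^sub>R y = y + y + (y + (y :: 'a::real_vector))"
  using scaleR_add_left[of 2 2 y] by (simp add: scaleR_2)

text \<open>
  The two symmetries are \<open>1 - 2 P\<close> for the spectral projections \<open>P\<close> of \<open>G\<close> at \<open>0\<close> and at \<open>-1\<close>. They
  generate the same algebra as \<open>G\<close>, so averaging over both of them maps into its commutant.
\<close>
lemma tripotent_almost_commuting:
  assumes G: "tripotent G" and A: "A \<in> bounded_ops"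
  shows "\<exists>B. B \<in> bounded_ops \<and> B o\<^sub>L G = G o\<^sub>L B \<and> norm B \<le> norm A \<and>
    norm (B - A) \<le> 7 * norm ((A o\<^sub>L G) - (G o\<^sub>L A))"
proof -
  define P where "P = G o\<^sub>L G"
  define R where "R = 2 *\<^sub>R P - id_blinfun"
  define S where "S = id_blinfun + G - P"
  define k where "k = norm ((A o\<^sub>L G) - (G o\<^sub>L A))"
  have sa: "selfadjoint P" "selfadjoint G" using G by (auto simp: P_def selfadjoint_square)
  have R: "symmetry R" unfolding symmetry_def R_def
    using sa G by (auto intro!: selfadjoint_diff selfadjoint_scaleR blinfun_eqI
        simp: blinfun.bilinear_simps P_def algebra_simps)
      (simp add: scaleR_four scaleR_2)
  have S: "symmetry S" unfolding symmetry_def S_def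
    using sa G by (auto intro!: selfadjoint_diff selfadjoint_add blinfun_eqI
        simp: blinfun.bilinear_simps P_def algebra_simps)
  have RS: "R o\<^sub>L S = S o\<^sub>L R"
    by (rule blinfun_eqI) (simp add: R_def S_def P_def blinfun.bilinear_simps G algebra_simps)
  note G1 = norm_tripotent_le[OF G]
  have kP: "norm ((A o\<^sub>L P) - (P o\<^sub>L A)) \<le> 2 * k"
  proof -
    let ?c = "(A o\<^sub>L G) - (G o\<^sub>L A)"
    have "(A o\<^sub>L P) - (P o\<^sub>L A) = (?c o\<^sub>L G) + (G o\<^sub>L ?c)"
      by (rule blinfun_eqI) (simp add: P_def blinfun.bilinear_simps)
    then have "norm ((A o\<^sub>L P) - (P o\<^sub>L A)) \<le> norm (?c o\<^sub>L G) + norm (G o\<^sub>L ?c)"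
      by (simp only: norm_triangle_ineq)
    also have "norm (?c o\<^sub>L G) \<le> k * 1"
      using norm_blinfun_compose[of ?c G] mult_left_mono[OF G1, of k] by (simp add: k_def)
    also have "norm (G o\<^sub>L ?c) \<le> 1 * k"
      using norm_blinfun_compose[of G ?c] mult_right_mono[OF G1, of k] by (simp add: k_def)
    finally show ?thesis by simp
  qed
  have kR: "norm ((A o\<^sub>L R) - (R o\<^sub>L A)) \<le> 4 * k"
  proof -
    have "(A o\<^sub>L R) - (R o\<^sub>L A) = 2 *\<^sub>R ((A o\<^sub>L P) - (P o\<^sub>L A))"
      by (rule blinfun_eqI) (simp add: R_def blinfun.bilinear_simps algebra_simps)
    then show ?thesis using kP by simp
  qed
  have kS: "norm ((A o\<^sub>L S) - (S o\<^sub>L A)) \<le> 3 * k"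
  proof -
    have "(A o\<^sub>L S) - (S o\<^sub>L A) = ((A o\<^sub>L G) - (G o\<^sub>L A)) - ((A o\<^sub>L P) - (P o\<^sub>L A))"
      by (rule blinfun_eqI) (simp add: S_def blinfun.bilinear_simps algebra_simps)
    then show ?thesis using kP norm_triangle_ineq4[of "(A o\<^sub>L G) - (G o\<^sub>L A)" "(A o\<^sub>L P) - (P o\<^sub>L A)"]
      by (simp add: k_def)
  qed
  define B1 where "B1 = average R A"
  define B where "B = average S B1"
  have "norm ((B o\<^sub>L R) - (R o\<^sub>L B)) \<le> norm ((B1 o\<^sub>L R) - (R o\<^sub>L B1))"
    unfolding B_def by (rule norm_average_commutator_le[OF S RS])
  then have BR: "B o\<^sub>L R = R o\<^sub>L B" by (simp add: B1_def average_commutes[OF R])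
  have BS: "B o\<^sub>L S = S o\<^sub>L B" unfolding B_def by (rule average_commutes[OF S])
  have Gx: "blinfun_apply G x = blinfun_apply S x - x + (1/2) *\<^sub>R (blinfun_apply R x + x)" for x
    by (simp add: R_def S_def blinfun.bilinear_simps)
  have "B o\<^sub>L G = G o\<^sub>L B"
    by (rule blinfun_eqI)
      (simp add: Gx blinfun.bilinear_simps compose_commute_apply[OF BR] compose_commute_apply[OF BS])
  moreover have "norm B \<le> norm A"
    unfolding B_def B1_def using norm_average_le[OF S] norm_average_le[OF R] order_trans by blast
  moreover have "norm (B - A) \<le> 7 * k"
  proof -
    have "norm (B - B1) \<le> norm ((B1 o\<^sub>L S) - (S o\<^sub>L B1))"
      unfolding B_def by (rule norm_average_diff_le[OF S])
    also have "\<dots> \<le> norm ((A o\<^sub>L S) - (S o\<^sub>L A))"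
      unfolding B1_def by (rule norm_average_commutator_le[OF R RS[symmetric]])
    finally have "norm (B - B1) \<le> 3 * k" using kS by simp
    moreover have "norm (B1 - A) \<le> 4 * k"
      unfolding B1_def using norm_average_diff_le[OF R] kR order_trans by blast
    ultimately show ?thesis using norm_triangle_ineq[of "B - B1" "B1 - A"] by simp
  qed
  moreover have "B \<in> bounded_ops"
    unfolding B_def B1_def by (intro average_bounded_ops S R A)
  ultimately show ?thesis unfolding k_def by blast
qed

text \<open>
  The equation is the derivative of \<open>G\<^sup>3 = G\<close>; it says that \<open>w\<close> has no diagonal part with respect to
  the spectral projections of \<open>G\<close>.
\<close>
definition tangent :: "('a::complex_hilbert \<Rightarrow>\<^sub>L 'a) \<Rightarrow> ('a \<Rightarrow>\<^sub>L 'a) \<Rightarrow> bool" where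
  "tangent G w \<longleftrightarrow> selfadjoint w \<and> (w o\<^sub>L G o\<^sub>L G) + (G o\<^sub>L w o\<^sub>L G) + (G o\<^sub>L G o\<^sub>L w) = w"

lemma tangent_apply:
  assumes "tangent G w"
  shows "blinfun_apply w (blinfun_apply G (blinfun_apply G x)) + blinfun_apply G (blinfun_apply w (blinfun_apply G x))
    + blinfun_apply G (blinfun_apply G (blinfun_apply w x)) = blinfun_apply w x"
  using assms arg_cong[of _ w "\<lambda>B. blinfun_apply B x"] unfolding tangent_def
  by (metis (no_types, lifting) blinfun.add_left blinfun_apply_blinfun_compose)

lemma selfadjoint_commutator:
  assumes "selfadjoint X" "selfadjoint G" shows "selfadjoint (\<i> *\<^sub>C ((X o\<^sub>L G) - (G o\<^sub>L X)))"
  using assms unfolding selfadjoint_iff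
  by (auto simp: blinfun.diff_left inner_i_left inner_diff_left inner_diff_right scaleC_diff_right
      bounded_ops_apply)

lemma tangent_commutator:
  assumes G: "tripotent G" and X: "selfadjoint X"
  shows "tangent G (\<i> *\<^sub>C ((X o\<^sub>L G) - (G o\<^sub>L X)))"
  unfolding tangent_def
  using selfadjoint_commutator[OF X tripotent_selfadjoint[OF G]]
  by (auto intro!: blinfun_eqI simp: blinfun.bilinear_simps scaleC_diff_right G
      bounded_ops_apply[OF selfadjoint_bounded_ops[OF tripotent_selfadjoint[OF G]], symmetric])

lemma tangent_diff: "tangent G v \<Longrightarrow> tangent G w \<Longrightarrow> tangent G (v - w)"
  unfolding tangent_def
  by (auto simp: selfadjoint_diff bounded_bilinear.diff_left[OF bounded_bilinear_blinfun_compose]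
      bounded_bilinear.diff_right[OF bounded_bilinear_blinfun_compose] algebra_simps)

text \<open>
  On the block of \<open>w\<close> between the eigenvalues \<open>\<lambda>\<close> and \<open>\<mu>\<close> of \<open>G\<close>, a lift has to divide by \<open>\<mu> - \<lambda>\<close> while
  the commutator \<open>c\<close> multiplies by it. This agrees up to sign if the difference is \<open>1\<close>; between the
  eigenvalues \<open>1\<close> and \<open>-1\<close>, the blocks which \<open>G\<^sup>2 c G\<^sup>2\<close> cuts out, a factor \<open>4\<close> has to be removed.
\<close>
lemma tangent_lift:
  assumes G: "tripotent G" and w: "tangent G w"
  shows "\<exists>X. selfadjoint X \<and> \<i> *\<^sub>C ((X o\<^sub>L G) - (G o\<^sub>L X)) = w \<and> norm X \<le> 4 * norm w"
proof -
  define c where "c = (w o\<^sub>L G) - (G o\<^sub>L w)"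
  define d where "d = c - (3/4) *\<^sub>R (G o\<^sub>L G o\<^sub>L c o\<^sub>L G o\<^sub>L G)"
  define X where "X = (- \<i>) *\<^sub>C d"
  have sa: "selfadjoint G" "selfadjoint w" using G w by (auto simp: tangent_def)
  then have Gw: "G \<in> bounded_ops" "w \<in> bounded_ops" by auto
  have cskew: "inner (blinfun_apply c x) y = - inner x (blinfun_apply c y)" for x y
    by (simp add: c_def blinfun.bilinear_simps inner_diff_left inner_diff_right selfadjointD sa)
  have dskew: "inner (blinfun_apply d x) y = - inner x (blinfun_apply d y)" for x y
    by (simp add: d_def blinfun.bilinear_simps inner_diff_left inner_diff_right selfadjointD sa cskew)
  have dops: "d \<in> bounded_ops" unfolding d_def c_def using Gw by auto
  have "selfadjoint X"
    unfolding selfadjoint_iff using dops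
    by (simp add: X_def inner_i_left scaleC_minus_left dskew bounded_ops_apply[symmetric])
  moreover have "\<i> *\<^sub>C ((X o\<^sub>L G) - (G o\<^sub>L X)) = w"
  proof (rule blinfun_eqI)
    fix x
    let ?G = "blinfun_apply G" and ?w = "blinfun_apply w"
    have t: "?G (?w (?G z)) = - ?G (?G (?w (?G (?G z))))" for z
    proof -
      have "?G (?w (?G (?G (?G z))) + ?G (?w (?G (?G z))) + ?G (?G (?w (?G z)))) = ?G (?w (?G z))"
        using tangent_apply[OF w, of "?G z"] by simp
      then have "?G (?w (?G z)) + ?G (?G (?w (?G (?G z)))) + ?G (?w (?G z)) = ?G (?w (?G z))"
        by (simp add: blinfun.add_right G)
      then show ?thesis by (simp add: add_eq_0_iff2 add.commute)
    qed
    have "blinfun_apply (\<i> *\<^sub>C ((X o\<^sub>L G) - (G o\<^sub>L X))) x = blinfun_apply d (?G x) - ?G (blinfun_apply d x)"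
      by (simp add: X_def blinfun.bilinear_simps scaleC_diff_right scaleC_scaleC bounded_ops_apply[OF Gw(1)])
    also have "\<dots> = ?w (?G (?G x)) + ?G (?w (?G x)) + ?G (?G (?w x))"
    proof -
      define q where "q = ?G (?w (?G x))"
      define h where "h = (1/2) *\<^sub>R q"
      have p: "?G (?G (?w (?G (?G x)))) = - q" using t[of x] by (simp add: q_def)
      have q: "q = h + h" by (simp add: h_def flip: scaleR_add_left)
      have "(3/4) *\<^sub>R (q + q) = h + h + h" 
      proof -
        have "h + h + h = (1/2 + 1/2 + 1/2) *\<^sub>R q" by (simp only: h_def scaleR_add_left)
        then show ?thesis by (simp flip: scaleR_2)
      qed
      then have qq: "(3/4) *\<^sub>R q + (3/4) *\<^sub>R q = h + h + h" by (simp add: scaleR_add_right)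
      have "blinfun_apply d (?G x) = ?w (?G (?G x)) - q + ((3/4) *\<^sub>R q + (3/4) *\<^sub>R q)"
        by (simp add: d_def c_def blinfun.bilinear_simps G p q_def algebra_simps)
      moreover have "?G (blinfun_apply d x) = q - ?G (?G (?w x)) - ((3/4) *\<^sub>R q + (3/4) *\<^sub>R q)"
        by (simp add: d_def c_def blinfun.bilinear_simps G p q_def algebra_simps)
      ultimately show ?thesis unfolding qq q_def[symmetric] by (simp add: q)
    qed
    also have "\<dots> = ?w x" by (rule tangent_apply[OF w])
    finally show "blinfun_apply (\<i> *\<^sub>C ((X o\<^sub>L G) - (G o\<^sub>L X))) x = ?w x" .
  qed
  moreover have "norm X \<le> 4 * norm w"
  proof -
    note G1 = norm_tripotent_le[OF G]
    have l: "norm (G o\<^sub>L A) \<le> norm A" "norm (A o\<^sub>L G) \<le> norm A" for A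
      using norm_blinfun_compose[of G A] mult_right_mono[OF G1, of "norm A"]
        norm_blinfun_compose[of A G] mult_left_mono[OF G1, of "norm A"] by auto
    have c: "norm c \<le> 2 * norm w"
      unfolding c_def using norm_triangle_ineq4[of "w o\<^sub>L G" "G o\<^sub>L w"] l[of w] by linarith
    have assoc: "G o\<^sub>L G o\<^sub>L c = G o\<^sub>L (G o\<^sub>L c)" by (rule blinfun_eqI) simp
    have "norm (G o\<^sub>L G o\<^sub>L c o\<^sub>L G o\<^sub>L G) \<le> norm (G o\<^sub>L (G o\<^sub>L c))"
      using l(2)[of "G o\<^sub>L G o\<^sub>L c"] l(2)[of "G o\<^sub>L G o\<^sub>L c o\<^sub>L G"] by (simp add: assoc)
    also have "\<dots> \<le> norm c" using l(1)[of c] l(1)[of "G o\<^sub>L c"] by simp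
    finally have "norm d \<le> norm c + (3/4) * norm c"
      unfolding d_def using norm_triangle_ineq4[of c "(3/4) *\<^sub>R (G o\<^sub>L G o\<^sub>L c o\<^sub>L G o\<^sub>L G)"] by simp
    moreover have "norm X \<le> norm d"
      by (rule norm_blinfun_bound) (auto simp: X_def norm_scaleC norm_blinfun)
    ultimately show ?thesis using c norm_ge_zero[of w] by linarith
  qed
  ultimately show ?thesis by blast
qed

lemma orbit_norm_le:
  "selfadjoint X \<Longrightarrow> \<i> *\<^sub>C ((X o\<^sub>L G) - (G o\<^sub>L X)) = w \<Longrightarrow> orbit_norm G w \<le> norm X"
  unfolding orbit_norm_def by (rule cInf_lower) (auto intro: bdd_belowI[of _ 0])

lemma orbit_norm_ge:
  assumes "tripotent G" "tangent G w"
    and "\<And>X. selfadjoint X \<Longrightarrow> \<i> *\<^sub>C ((X o\<^sub>L G) - (G o\<^sub>L X)) = w \<Longrightarrow> c \<le> norm X"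
  shows "c \<le> orbit_norm G w"
  unfolding orbit_norm_def using tangent_lift[OF assms(1,2)] assms(3) by (intro cInf_greatest) auto

lemma orbit_norm_nonneg: "tripotent G \<Longrightarrow> tangent G w \<Longrightarrow> 0 \<le> orbit_norm G w"
  by (rule orbit_norm_ge) auto

lemma orbit_norm_le_norm: "tripotent G \<Longrightarrow> tangent G w \<Longrightarrow> orbit_norm G w \<le> 4 * norm w"
  using tangent_lift[of G w] orbit_norm_le[of _ G w] by force

lemma orbit_norm_almost_attained:
  assumes "tripotent G" "tangent G w" "e > 0"
  shows "\<exists>X. selfadjoint X \<and> \<i> *\<^sub>C ((X o\<^sub>L G) - (G o\<^sub>L X)) = w \<and> norm X \<le> orbit_norm G w + e"
proof (rule ccontr)
  assume "\<not> ?thesis"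
  then have "orbit_norm G w + e \<le> orbit_norm G w" by (intro orbit_norm_ge assms(1,2)) force
  with \<open>e > 0\<close> show False by simp
qed

lemma scaleC_blinfun_add: "c *\<^sub>C ((A :: 'a::complex_hilbert \<Rightarrow>\<^sub>L 'a) + B) = c *\<^sub>C A + c *\<^sub>C B"
  by (rule blinfun_eqI) (simp add: blinfun.add_left scaleC_add_right)

lemma norm_scaleC_blinfun_le: "norm (c *\<^sub>C (A :: 'a::complex_hilbert \<Rightarrow>\<^sub>L 'a)) \<le> cmod c * norm A"
  by (rule norm_blinfun_bound)
    (auto simp: norm_scaleC mult.assoc intro!: mult_left_mono norm_blinfun)

lemma norm_commutator_le:
  "norm (\<i> *\<^sub>C ((X o\<^sub>L G) - (G o\<^sub>L (X :: 'a::complex_hilbert \<Rightarrow>\<^sub>L 'a)))) \<le> 2 * norm X * norm G"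
proof -
  have "norm (\<i> *\<^sub>C ((X o\<^sub>L G) - (G o\<^sub>L X))) \<le> norm ((X o\<^sub>L G) - (G o\<^sub>L X))"
    using norm_scaleC_blinfun_le[of \<i> "(X o\<^sub>L G) - (G o\<^sub>L X)"] by simp
  also have "\<dots> \<le> norm (X o\<^sub>L G) + norm (G o\<^sub>L X)" by (rule norm_triangle_ineq4)
  also have "\<dots> \<le> 2 * norm X * norm G"
    using norm_blinfun_compose[of X G] norm_blinfun_compose[of G X] by (simp add: mult.commute)
  finally show ?thesis .
qed

text \<open>
  The error that \<open>X\<close> leaves is again tangent at \<open>G\<close>, so it has a lift of comparable norm.
\<close>
lemma orbit_norm_perturb:
  assumes G: "tripotent G" and w: "tangent G w" and X: "selfadjoint X"
  shows "orbit_norm G w \<le> norm X + 4 * norm (w - \<i> *\<^sub>C ((X o\<^sub>L G) - (G o\<^sub>L X)))"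
proof -
  let ?d = "w - \<i> *\<^sub>C ((X o\<^sub>L G) - (G o\<^sub>L X))"
  obtain Y where Y: "selfadjoint Y" "\<i> *\<^sub>C ((Y o\<^sub>L G) - (G o\<^sub>L Y)) = ?d" "norm Y \<le> 4 * norm ?d"
    using tangent_lift[OF G tangent_diff[OF w tangent_commutator[OF G X]]] by blast
  have "((X + Y) o\<^sub>L G) - (G o\<^sub>L (X + Y)) = ((X o\<^sub>L G) - (G o\<^sub>L X)) + ((Y o\<^sub>L G) - (G o\<^sub>L Y))"
    by (rule blinfun_eqI) (simp add: blinfun.bilinear_simps)
  then have "\<i> *\<^sub>C (((X + Y) o\<^sub>L G) - (G o\<^sub>L (X + Y))) = w"
    by (simp only: scaleC_blinfun_add Y(2)) simp
  from orbit_norm_le[OF selfadjoint_add[OF X Y(1)] this] show ?thesis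
    using norm_triangle_ineq[of X Y] Y(3) by linarith
qed

section \<open>Conjugation by one-parameter groups\<close>

lemma evol_generator:
  "blinfun_apply (evol X t) (\<i> *\<^sub>C blinfun_apply X x) = \<i> *\<^sub>C blinfun_apply X (blinfun_apply (evol X t) x)"
  using compose_commute_apply[OF evol_commute[of "\<i> *\<^sub>C X" X t], of x] by simp

lemma conj_evol_has_vector_derivative:
  assumes "W \<in> bounded_ops"
  shows "((\<lambda>s. evol X s o\<^sub>L W o\<^sub>L evol X (- s)) has_vector_derivative
    (evol X t o\<^sub>L (\<i> *\<^sub>C ((X o\<^sub>L W) - (W o\<^sub>L X))) o\<^sub>L evol X (- t))) (at t within S)"
  by (rule has_vector_derivative_eq_rhs,
      rule compose_has_vector_derivative[OF compose_has_vector_derivative[OF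
        evol_has_vector_derivative_right has_vector_derivative_const] evol_minus_has_vector_derivative])
    (auto intro!: blinfun_eqI simp: blinfun.bilinear_simps scaleC_diff_right bounded_ops_apply[OF assms]
      evol_generator)

lemma norm_conj_evol_le: "selfadjoint X \<Longrightarrow> norm (evol X s o\<^sub>L W o\<^sub>L evol X (- s)) \<le> norm W"
  using norm_conj_le[OF unitary_evol, of X s W] by (simp add: adj_evol)

lemma conj_evol_first_order:
  assumes X: "selfadjoint X" and W: "W \<in> bounded_ops" and "0 \<le> h"
  shows "norm ((evol X h o\<^sub>L W o\<^sub>L evol X (- h)) - W) \<le> 2 * norm X * norm W * h"
proof -
  let ?f = "\<lambda>s. evol X s o\<^sub>L W o\<^sub>L evol X (- s)"
  have "norm (?f h - ?f 0) \<le> (2 * norm X * norm W) * (h - 0)"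
    by (rule increment_bound[OF \<open>0 \<le> h\<close> conj_evol_has_vector_derivative[OF W]])
      (rule order_trans[OF norm_conj_evol_le[OF X] norm_commutator_le])
  moreover have "?f 0 = W" by (rule blinfun_eqI) simp
  ultimately show ?thesis by simp
qed

text \<open>
  The first order estimate, applied to the velocity \<open>D\<close>, bounds the derivative of the remainder.
\<close>
lemma conj_evol_second_order:
  assumes X: "selfadjoint X" and W: "W \<in> bounded_ops" and "0 \<le> h"
  shows "norm ((evol X h o\<^sub>L W o\<^sub>L evol X (- h)) - W - h *\<^sub>R (\<i> *\<^sub>C ((X o\<^sub>L W) - (W o\<^sub>L X))))
    \<le> 4 * (norm X)\<^sup>2 * norm W * h\<^sup>2"
proof -
  define D where "D = \<i> *\<^sub>C ((X o\<^sub>L W) - (W o\<^sub>L X))"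
  have D: "D \<in> bounded_ops" "norm D \<le> 2 * norm X * norm W"
    unfolding D_def using X W norm_commutator_le by auto
  let ?f = "\<lambda>s. (evol X s o\<^sub>L W o\<^sub>L evol X (- s)) - s *\<^sub>R D"
  have "norm (?f h - ?f 0) \<le> (4 * (norm X)\<^sup>2 * norm W * h) * (h - 0)"
  proof (rule increment_bound[OF \<open>0 \<le> h\<close>])
    show "(?f has_vector_derivative ((evol X s o\<^sub>L D o\<^sub>L evol X (- s)) - D)) (at s within {0..h})" for s
      unfolding D_def
      by (rule has_vector_derivative_diff[OF conj_evol_has_vector_derivative[OF W]])
        (auto intro!: derivative_eq_intros)
    show "norm ((evol X s o\<^sub>L D o\<^sub>L evol X (- s)) - D) \<le> 4 * (norm X)\<^sup>2 * norm W * h" if "s \<in> {0..h}" for s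
    proof -
      have "norm ((evol X s o\<^sub>L D o\<^sub>L evol X (- s)) - D) \<le> 2 * norm X * norm D * s"
        using that by (intro conj_evol_first_order X D) auto
      also have "\<dots> \<le> 2 * norm X * (2 * norm X * norm W) * h"
        using that D(2) by (intro mult_mono mult_nonneg_nonneg) auto
      finally show ?thesis by (simp add: power2_eq_square mult_ac)
    qed
  qed
  moreover have "?f 0 = W" by (rule blinfun_eqI) simp
  ultimately have "norm ((evol X h o\<^sub>L W o\<^sub>L evol X (- h)) - h *\<^sub>R D - W) \<le> 4 * (norm X)\<^sup>2 * norm W * h\<^sup>2"
    by (simp add: power2_eq_square mult_ac)
  then show ?thesis unfolding D_def[symmetric] by (simp add: algebra_simps)
qed

section \<open>Angles between vectors\<close>

text \<open>
  This is the triangle inequality for angles. Split \<open>a\<close> and \<open>c\<close> into their components along \<open>b\<close> and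
  orthogonal to it; the orthogonal components have norms \<open>sin (arccos p)\<close> and \<open>sin (arccos q)\<close>.
\<close>
lemma inner_ge_cos_trans:
  fixes a b c :: "'a::real_inner"
  assumes n: "norm a = 1" "norm b = 1" "norm c = 1"
    and ab: "cos \<alpha> \<le> inner a b" and bc: "cos \<beta> \<le> inner b c"
    and "0 \<le> \<alpha>" "0 \<le> \<beta>" "\<alpha> + \<beta> \<le> pi"
  shows "cos (\<alpha> + \<beta>) \<le> inner a c"
proof -
  define p where "p = inner a b"
  define q where "q = inner b c"
  have p: "\<bar>p\<bar> \<le> 1" and q: "\<bar>q\<bar> \<le> 1"
    using Cauchy_Schwarz_ineq2[of a b] Cauchy_Schwarz_ineq2[of b c] n by (auto simp: p_def q_def)
  have bb: "inner b b = 1" using n by (simp add: dot_square_norm)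
  have perp: "(norm (z - inner z b *\<^sub>R b))\<^sup>2 = 1 - (inner z b)\<^sup>2" if "norm z = 1" for z
  proof -
    have "inner z z = 1" using that by (simp add: dot_square_norm)
    then show ?thesis
      unfolding power2_norm_eq_inner using bb inner_commute[of b z]
      by (simp add: inner_diff_left inner_diff_right power2_eq_square)
  qed
  have "(norm (a - p *\<^sub>R b))\<^sup>2 = 1 - p\<^sup>2" "(norm (c - q *\<^sub>R b))\<^sup>2 = 1 - q\<^sup>2"
    using perp[OF n(1)] perp[OF n(3)] by (simp_all add: p_def q_def inner_commute[of b c])
  then have "norm (a - p *\<^sub>R b) = sqrt (1 - p\<^sup>2)" "norm (c - q *\<^sub>R b) = sqrt (1 - q\<^sup>2)"
    by (metis norm_ge_zero real_sqrt_unique)+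
  then have s: "norm (a - p *\<^sub>R b) = sin (arccos p)" "norm (c - q *\<^sub>R b) = sin (arccos q)"
    using p q by (auto simp: sin_arccos_abs)
  have "inner a c = p * q + inner (a - p *\<^sub>R b) (c - q *\<^sub>R b)"
    using bb inner_commute[of b c] inner_commute[of b a]
    by (simp add: p_def q_def inner_diff_left inner_diff_right)
  moreover have "\<bar>inner (a - p *\<^sub>R b) (c - q *\<^sub>R b)\<bar> \<le> sin (arccos p) * sin (arccos q)"
    using Cauchy_Schwarz_ineq2[of "a - p *\<^sub>R b" "c - q *\<^sub>R b"] s by simp
  moreover have "cos (arccos p + arccos q) = p * q - sin (arccos p) * sin (arccos q)"
    using p q by (simp add: cos_add cos_arccos_abs)
  ultimately have "cos (arccos p + arccos q) \<le> inner a c" by linarith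
  moreover have "cos (\<alpha> + \<beta>) \<le> cos (arccos p + arccos q)"
  proof (rule cos_monotone_0_pi_le)
    have "arccos p \<le> arccos (cos \<alpha>)" "arccos q \<le> arccos (cos \<beta>)"
      using ab bc p q by (auto intro!: arccos_le_arccos simp: p_def q_def)
    then show "arccos p + arccos q \<le> \<alpha> + \<beta>" using assms(6-8) by (simp add: arccos_cos)
    show "0 \<le> arccos p + arccos q" using p q by (simp add: arccos_lbound add_nonneg_nonneg)
  qed (use assms in auto)
  ultimately show ?thesis by linarith
qed

text \<open>
  Two unit vectors at distance \<open>\<beta>\<close> have inner product \<open>1 - \<beta>\<^sup>2 / 2\<close>. Their angle exceeds \<open>\<beta>\<close>, but only
  by a term of higher order, which disappears when many small angles are added.
\<close>
lemma cos_le_chord: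
  fixes \<beta> :: real
  assumes "0 \<le> \<beta>" "\<beta> \<le> 1" shows "cos (\<beta> + \<beta>\<^sup>2) \<le> 1 - \<beta>\<^sup>2 / 2"
proof -
  define x where "x = (\<beta> + \<beta>\<^sup>2) / 2"
  have b2: "0 \<le> \<beta>\<^sup>2" "\<beta>\<^sup>2 \<le> \<beta>"
    using assms mult_left_le[of \<beta> \<beta>] by (simp_all add: power2_eq_square)
  have x: "0 \<le> x" "x \<le> \<beta>"
    unfolding x_def using assms(1) b2 add_nonneg_nonneg[of \<beta> "\<beta>\<^sup>2"] by auto
  have "\<bar>sin x - (\<Sum>m<2. sin_coeff m * x ^ m)\<bar> \<le> inverse (fact 2) * \<bar>x\<bar> ^ 2" by (rule Maclaurin_sin_bound)
  then have "\<bar>sin x - x\<bar> \<le> x\<^sup>2 / 2"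
    by (simp add: numeral_2_eq_2 sin_coeff_def)
  moreover have "x\<^sup>2 \<le> \<beta>\<^sup>2" using x by (intro power_mono)
  ultimately have "\<beta> / 2 \<le> sin x" unfolding x_def by argo
  then have "(\<beta> / 2)\<^sup>2 \<le> (sin x)\<^sup>2" using assms by (intro power_mono) auto
  moreover have "cos (\<beta> + \<beta>\<^sup>2) = 1 - 2 * (sin x)\<^sup>2"
  proof -
    have "2 * x = \<beta> + \<beta>\<^sup>2" by (simp add: x_def)
    then show ?thesis using cos_double_sin[of x] by simp
  qed
  ultimately show ?thesis by (simp add: power_divide)
qed

lemma evol_angle:
  assumes X: "selfadjoint X" and h: "0 \<le> h" "h * norm X \<le> 1" and \<eta>: "norm \<eta> = 1"
  shows "cos (h * norm X + (h * norm X)\<^sup>2) \<le> inner (blinfun_apply (evol X h) \<eta>) \<eta>"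
proof -
  let ?f = "\<lambda>s. blinfun_apply (evol X s) \<eta>"
  have "norm (?f h - ?f 0) \<le> norm X * (h - 0)"
  proof (rule increment_bound[OF h(1)])
    show "(?f has_vector_derivative blinfun_apply (evol X s) (\<i> *\<^sub>C blinfun_apply X \<eta>)) (at s within {0..h})" for s
      using apply_has_vector_derivative[OF evol_has_vector_derivative_right has_vector_derivative_const]
      by (auto simp: blinfun.zero_right)
    show "norm (blinfun_apply (evol X s) (\<i> *\<^sub>C blinfun_apply X \<eta>)) \<le> norm X" for s
      using norm_blinfun[of X \<eta>] \<eta> by (simp add: unitary_norm_apply[OF unitary_evol[OF X]] norm_scaleC)
  qed
  then have "norm (?f h - \<eta>) \<le> h * norm X" by (simp add: mult.commute)
  then have "(norm (?f h - \<eta>))\<^sup>2 \<le> (h * norm X)\<^sup>2" by (intro power_mono) auto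
  moreover have "(norm (?f h - \<eta>))\<^sup>2 = 2 - 2 * inner (?f h) \<eta>"
    using unitary_norm_apply[OF unitary_evol[OF X], of h \<eta>] \<eta> dot_norm_neg[of "?f h" \<eta>] by simp
  ultimately show ?thesis using cos_le_chord[of "h * norm X"] h by simp
qed

section \<open>Curves of tripotents\<close>

lemma increment_bound_between:
  fixes f :: "real \<Rightarrow> 'a::real_normed_vector"
  assumes "r \<in> {a..b}" "s \<in> {a..b}"
    and f: "\<And>t. t \<in> {a..b} \<Longrightarrow> (f has_vector_derivative f' t) (at t within {a..b})"
    and B: "\<And>t. t \<in> {a..b} \<Longrightarrow> norm (f' t) \<le> B"
  shows "norm (f s - f r) \<le> B * \<bar>s - r\<bar>"
proof -
  have *: "norm (f s - f r) \<le> B * (s - r)" if "r \<le> s" "r \<in> {a..b}" "s \<in> {a..b}" for r s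
    by (rule increment_bound[OF that(1)])
      (use that B in \<open>auto intro!: has_vector_derivative_within_subset[OF f]\<close>)
  show ?thesis using *[of r s] *[of s r] assms(1,2)
    by (cases "r \<le> s") (auto simp: norm_minus_commute)
qed

text \<open>
  Being complex linear, selfadjoint or off-diagonal are closed real-linear conditions, which
  therefore pass from a curve to its velocity. One-sided derivatives at the end points are included,
  and they are unique because the interval is not a point.
\<close>
lemma derivative_in_kernel:
  fixes f :: "real \<Rightarrow> 'a::real_normed_vector"
  assumes "bounded_linear L" "a < b" "t \<in> {a..b}" "\<And>s. s \<in> {a..b} \<Longrightarrow> L (f s) = 0"
    and f: "(f has_vector_derivative f') (at t within {a..b})"
  shows "L f' = 0"
proof -
  have "((\<lambda>s. L (f s)) has_vector_derivative L f') (at t within {a..b})"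
    by (rule bounded_linear.has_vector_derivative[OF assms(1) f])
  moreover have "((\<lambda>s. L (f s)) has_vector_derivative 0) (at t within {a..b})"
    by (rule has_vector_derivative_transform[OF assms(3) _ has_vector_derivative_const[of 0]])
      (simp add: assms(4))
  ultimately show ?thesis
    using vector_derivative_unique_within_closed_interval[unfolded box_real, OF assms(2,3)] by blast
qed

lemma derivative_bounded_ops:
  fixes \<gamma> :: "real \<Rightarrow> 'a::complex_hilbert \<Rightarrow>\<^sub>L 'b::complex_hilbert"
  assumes "a < b" "t \<in> {a..b}" "\<And>s. s \<in> {a..b} \<Longrightarrow> \<gamma> s \<in> bounded_ops"
    and d: "(\<gamma> has_vector_derivative \<gamma>') (at t within {a..b})"
  shows "\<gamma>' \<in> bounded_ops"
proof -
  have "blinfun_apply \<gamma>' (c *\<^sub>C x) - c *\<^sub>C blinfun_apply \<gamma>' x = 0" for c x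
  proof (rule derivative_in_kernel[OF _ assms(1,2) _ d])
    have "bounded_linear (\<lambda>x::'b. c *\<^sub>C x)"
      by (rule bounded_linear_intro[where K = "cmod c"])
        (auto simp: scaleC_add_right scaleR_eq_scaleC scaleC_scaleC norm_scaleC mult.commute)
    from bounded_linear_compose[OF this blinfun.bounded_linear_left[of x]]
    have "bounded_linear (\<lambda>A :: 'a \<Rightarrow>\<^sub>L 'b. c *\<^sub>C blinfun_apply A x)" .
    then show "bounded_linear (\<lambda>A :: 'a \<Rightarrow>\<^sub>L 'b. blinfun_apply A (c *\<^sub>C x) - c *\<^sub>C blinfun_apply A x)"
      by (rule bounded_linear_sub[OF blinfun.bounded_linear_left[of "c *\<^sub>C x"]])
  qed (simp add: assms(3) bounded_ops_apply)
  then show ?thesis by (simp add: bounded_ops_def)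
qed

lemma derivative_selfadjoint:
  assumes "a < b" "t \<in> {a..b}" and sa: "\<And>s. s \<in> {a..b} \<Longrightarrow> selfadjoint (\<gamma> s)"
    and d: "(\<gamma> has_vector_derivative \<gamma>') (at t within {a..b})"
  shows "selfadjoint \<gamma>'"
proof -
  have "inner (blinfun_apply \<gamma>' x) y - inner x (blinfun_apply \<gamma>' y) = 0" for x y
  proof (rule derivative_in_kernel[OF _ assms(1,2) _ d])
    show "bounded_linear (\<lambda>A. inner (blinfun_apply A x) y - inner x (blinfun_apply A y))"
      by (rule bounded_linear_sub[OF
            bounded_linear_compose[OF bounded_linear_inner_left blinfun.bounded_linear_left]
            bounded_linear_compose[OF bounded_linear_inner_right blinfun.bounded_linear_left]])
  qed (simp add: selfadjointD[OF sa])
  moreover have "\<gamma>' \<in> bounded_ops" by (rule derivative_bounded_ops[OF assms(1,2) _ d]) (simp add: sa)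
  ultimately show ?thesis by (simp add: selfadjoint_iff)
qed

lemma derivative_tangent:
  assumes "a < b" "t \<in> {a..b}" and trip: "\<And>s. s \<in> {a..b} \<Longrightarrow> tripotent (\<gamma> s)"
    and d: "(\<gamma> has_vector_derivative \<gamma>') (at t within {a..b})"
  shows "tangent (\<gamma> t) \<gamma>'"
proof -
  have "selfadjoint \<gamma>'" by (rule derivative_selfadjoint[OF assms(1,2) _ d]) (simp add: trip)
  moreover have "((\<lambda>s. \<gamma> s o\<^sub>L \<gamma> s o\<^sub>L \<gamma> s) has_vector_derivative
      ((\<gamma> t o\<^sub>L \<gamma> t o\<^sub>L \<gamma>') + (((\<gamma> t o\<^sub>L \<gamma>') + (\<gamma>' o\<^sub>L \<gamma> t)) o\<^sub>L \<gamma> t))) (at t within {a..b})"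
    by (intro compose_has_vector_derivative d)
  then have "(\<gamma> has_vector_derivative
      ((\<gamma> t o\<^sub>L \<gamma> t o\<^sub>L \<gamma>') + (((\<gamma> t o\<^sub>L \<gamma>') + (\<gamma>' o\<^sub>L \<gamma> t)) o\<^sub>L \<gamma> t))) (at t within {a..b})"
    by (rule has_vector_derivative_transform[OF assms(2), rotated]) (use trip in \<open>simp add: tripotent_def\<close>)
  then have "\<gamma>' = (\<gamma> t o\<^sub>L \<gamma> t o\<^sub>L \<gamma>') + (((\<gamma> t o\<^sub>L \<gamma>') + (\<gamma>' o\<^sub>L \<gamma> t)) o\<^sub>L \<gamma> t)"
    by (rule vector_derivative_unique_within_closed_interval[unfolded box_real, OF assms(1,2) d])
  ultimately show ?thesis
    unfolding tangent_def by (simp add: bounded_bilinear.add_left[OF bounded_bilinear_blinfun_compose] algebra_simps)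
qed

text \<open>
  The bound \<open>K\<close> on velocity and acceleration makes the errors of small steps uniform along the curve.
\<close>
locale tripotent_curve =
  fixes \<gamma> \<gamma>' \<gamma>'' :: "real \<Rightarrow> 'a::complex_hilbert \<Rightarrow>\<^sub>L 'a" and a b K :: real
  assumes ab: "a < b"
    and trip: "\<And>t. t \<in> {a..b} \<Longrightarrow> tripotent (\<gamma> t)"
    and d1: "\<And>t. t \<in> {a..b} \<Longrightarrow> (\<gamma> has_vector_derivative \<gamma>' t) (at t within {a..b})"
    and d2: "\<And>t. t \<in> {a..b} \<Longrightarrow> (\<gamma>' has_vector_derivative \<gamma>'' t) (at t within {a..b})"
    and K1: "\<And>t. t \<in> {a..b} \<Longrightarrow> norm (\<gamma>' t) \<le> K"
    and K2: "\<And>t. t \<in> {a..b} \<Longrightarrow> norm (\<gamma>'' t) \<le> K"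
begin

definition speed :: "real \<Rightarrow> real" where
  "speed t = orbit_norm (\<gamma> t) (\<gamma>' t)"

text \<open>
  A bound for the norms of almost minimal lifts, by \<open>orbit_norm_le_norm\<close>.
\<close>
definition M :: real where "M = 4 * K + 1"

text \<open>
  A Lipschitz constant of the speed. It makes the speed integrable, so that the length of the curve is
  a genuine integral, and it controls the Riemann sums.
\<close>
definition lip :: real where "lip = 4 * (K + 2 * M * K)"

lemma K_nonneg: "0 \<le> K"
  using order_trans[OF norm_ge_zero K1[of a]] ab by simp

lemma M_ge_1: "1 \<le> M"
  using K_nonneg by (simp add: M_def)

lemma lip_nonneg: "0 \<le> lip"
  using K_nonneg M_ge_1 by (simp add: lip_def)

lemma tangent: "t \<in> {a..b} \<Longrightarrow> tangent (\<gamma> t) (\<gamma>' t)"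
  by (rule derivative_tangent[OF ab _ trip d1])

lemma speed_nonneg: "t \<in> {a..b} \<Longrightarrow> 0 \<le> speed t"
  unfolding speed_def by (intro orbit_norm_nonneg trip tangent)

lemma almost_minimal_lift:
  assumes "t \<in> {a..b}" "0 < e" "e \<le> 1"
  shows "\<exists>X. selfadjoint X \<and> \<i> *\<^sub>C ((X o\<^sub>L \<gamma> t) - (\<gamma> t o\<^sub>L X)) = \<gamma>' t \<and> norm X \<le> speed t + e \<and> norm X \<le> M"
proof -
  obtain X where X: "selfadjoint X" "\<i> *\<^sub>C ((X o\<^sub>L \<gamma> t) - (\<gamma> t o\<^sub>L X)) = \<gamma>' t" "norm X \<le> speed t + e"
    using orbit_norm_almost_attained[OF trip[OF assms(1)] tangent[OF assms(1)] assms(2)]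
    unfolding speed_def by blast
  have "speed t \<le> 4 * norm (\<gamma>' t)"
    unfolding speed_def by (rule orbit_norm_le_norm[OF trip[OF assms(1)] tangent[OF assms(1)]])
  then have "norm X \<le> M" using X(3) K1[OF assms(1)] assms(3) by (simp add: M_def)
  with X show ?thesis by blast
qed

text \<open>
  A lift at \<open>r\<close> is nearly a lift at \<open>s\<close>, and what is missing is tangent at \<open>\<gamma> s\<close>, hence has a lift of
  comparable norm.
\<close>
lemma speed_le:
  assumes r: "r \<in> {a..b}" and s: "s \<in> {a..b}"
  shows "speed s \<le> speed r + lip * \<bar>s - r\<bar>"
proof (rule field_le_epsilon)
  fix e :: real assume "e > 0"
  define e' where "e' = min e 1"
  have e': "0 < e'" "e' \<le> 1" "e' \<le> e" using \<open>e > 0\<close> by (auto simp: e'_def)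
  obtain X where X: "selfadjoint X" "\<i> *\<^sub>C ((X o\<^sub>L \<gamma> r) - (\<gamma> r o\<^sub>L X)) = \<gamma>' r"
    "norm X \<le> speed r + e'" "norm X \<le> M"
    using almost_minimal_lift[OF r e'(1,2)] by blast
  have g: "norm (\<gamma> s - \<gamma> r) \<le> K * \<bar>s - r\<bar>" by (rule increment_bound_between[OF r s d1 K1])
  have g': "norm (\<gamma>' s - \<gamma>' r) \<le> K * \<bar>s - r\<bar>" by (rule increment_bound_between[OF r s d2 K2])
  let ?d = "\<i> *\<^sub>C ((X o\<^sub>L (\<gamma> s - \<gamma> r)) - ((\<gamma> s - \<gamma> r) o\<^sub>L X))"
  have "\<i> *\<^sub>C ((X o\<^sub>L \<gamma> s) - (\<gamma> s o\<^sub>L X)) = \<gamma>' r + ?d"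
    unfolding X(2)[symmetric]
    by (rule blinfun_eqI) (simp add: blinfun.bilinear_simps scaleC_diff_right)
  then have "norm (\<gamma>' s - \<i> *\<^sub>C ((X o\<^sub>L \<gamma> s) - (\<gamma> s o\<^sub>L X))) = norm ((\<gamma>' s - \<gamma>' r) - ?d)"
    by (simp only: diff_diff_eq)
  also have "\<dots> \<le> norm (\<gamma>' s - \<gamma>' r) + norm ?d" by (rule norm_triangle_ineq4)
  also have "norm ?d \<le> 2 * norm X * norm (\<gamma> s - \<gamma> r)" by (rule norm_commutator_le)
  also have "\<dots> \<le> 2 * M * (K * \<bar>s - r\<bar>)"
    using X(4) g K_nonneg M_ge_1 by (intro mult_mono) auto
  finally have "norm (\<gamma>' s - \<i> *\<^sub>C ((X o\<^sub>L \<gamma> s) - (\<gamma> s o\<^sub>L X))) \<le> (K + 2 * M * K) * \<bar>s - r\<bar>"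
    using g' by (simp add: algebra_simps)
  moreover have "speed s \<le> norm X + 4 * norm (\<gamma>' s - \<i> *\<^sub>C ((X o\<^sub>L \<gamma> s) - (\<gamma> s o\<^sub>L X)))"
    unfolding speed_def by (rule orbit_norm_perturb[OF trip[OF s] tangent[OF s] X(1)])
  ultimately show "speed s \<le> speed r + lip * \<bar>s - r\<bar> + e"
    using X(3) e'(3) by (simp add: lip_def algebra_simps)
qed

lemma speed_continuous: "continuous_on {a..b} speed"
proof -
  have "lip-lipschitz_on {a..b} speed"
  proof (rule lipschitz_onI)
    fix r s assume "r \<in> {a..b}" "s \<in> {a..b}"
    then show "dist (speed r) (speed s) \<le> lip * dist r s"
      using speed_le[of r s] speed_le[of s r] by (auto simp: dist_real_def abs_minus_commute abs_le_iff)
  qed (rule lip_nonneg)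
  then show ?thesis by (rule lipschitz_on_continuous_on)
qed

lemma speed_integrable: "a \<le> r \<Longrightarrow> s \<le> b \<Longrightarrow> speed integrable_on {r..s}"
  by (intro integrable_continuous_real continuous_on_subset[OF speed_continuous]) auto

lemma speed_integral_step:
  assumes "a \<le> s" "0 \<le> h" "s + h \<le> b"
  shows "h * speed s \<le> integral {s..s + h} speed + lip * h\<^sup>2"
proof -
  have "integral {s..s + h} (\<lambda>_. speed s - lip * h) \<le> integral {s..s + h} speed"
  proof (rule integral_le)
    show "speed s - lip * h \<le> speed t" if "t \<in> {s..s + h}" for t
    proof -
      have "speed s \<le> speed t + lip * \<bar>s - t\<bar>" using that assms by (intro speed_le) auto
      moreover have "lip * \<bar>s - t\<bar> \<le> lip * h" using that lip_nonneg by (intro mult_left_mono) auto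
      ultimately show ?thesis by linarith
    qed
  qed (use assms speed_integrable in auto)
  then show ?thesis using assms by (simp add: algebra_simps power2_eq_square)
qed

lemma integral_speed_combine:
  assumes "a \<le> s" "0 \<le> h" "s + h \<le> b"
  shows "integral {a..s + h} speed = integral {a..s} speed + integral {s..s + h} speed"
  using assms speed_integrable[of a "s + h"] by (intro Henstock_Kurzweil_Integration.integral_combine[symmetric]) auto

text \<open>
  Both \<open>\<gamma>\<close> and the conjugate of \<open>\<gamma> s\<close> by \<open>e\<^sup>i\<^sup>h\<^sup>X\<close> start at \<open>\<gamma> s\<close> with velocity \<open>\<gamma>' s\<close>, so they differ in
  second order only.
\<close>
lemma curve_step:
  assumes s: "a \<le> s" "s + h \<le> b" and h: "0 < h" "h \<le> 1"
  shows "\<exists>X. selfadjoint X \<and> norm X \<le> speed s + h \<and> norm X \<le> M \<and>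
    norm ((evol X h o\<^sub>L \<gamma> s o\<^sub>L evol X (- h)) - \<gamma> (s + h)) \<le> (K + 4 * M\<^sup>2) * h\<^sup>2"
proof -
  have s': "s \<in> {a..b}" using s h by auto
  obtain X where X: "selfadjoint X" "\<i> *\<^sub>C ((X o\<^sub>L \<gamma> s) - (\<gamma> s o\<^sub>L X)) = \<gamma>' s"
    "norm X \<le> speed s + h" "norm X \<le> M"
    using almost_minimal_lift[OF s' h] by blast
  have "norm ((\<gamma> (s + h) - (s + h) *\<^sub>R \<gamma>' s) - (\<gamma> s - s *\<^sub>R \<gamma>' s)) \<le> (K * h) * (s + h - s)"
  proof (rule increment_bound)
    show "((\<lambda>u. \<gamma> u - u *\<^sub>R \<gamma>' s) has_vector_derivative (\<gamma>' u - \<gamma>' s)) (at u within {s..s + h})"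
      if "u \<in> {s..s + h}" for u
    proof (rule has_vector_derivative_diff)
      show "(\<gamma> has_vector_derivative \<gamma>' u) (at u within {s..s + h})"
        using that s by (intro has_vector_derivative_within_subset[OF d1]) auto
      show "((\<lambda>u. u *\<^sub>R \<gamma>' s) has_vector_derivative \<gamma>' s) (at u within {s..s + h})"
        by (auto intro!: derivative_eq_intros)
    qed
    show "norm (\<gamma>' u - \<gamma>' s) \<le> K * h" if "u \<in> {s..s + h}" for u
    proof -
      have "norm (\<gamma>' u - \<gamma>' s) \<le> K * \<bar>u - s\<bar>"
        using that s by (intro increment_bound_between[OF s' _ d2 K2]) auto
      also have "\<dots> \<le> K * h" using that K_nonneg by (intro mult_left_mono) auto
      finally show ?thesis .
    qed
  qed (use h in simp)
  then have 1: "norm (\<gamma> (s + h) - \<gamma> s - h *\<^sub>R \<gamma>' s) \<le> K * h\<^sup>2"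
    by (simp add: power2_eq_square algebra_simps)
  have "norm ((evol X h o\<^sub>L \<gamma> s o\<^sub>L evol X (- h)) - \<gamma> s - h *\<^sub>R \<gamma>' s) \<le> 4 * (norm X)\<^sup>2 * norm (\<gamma> s) * h\<^sup>2"
    using conj_evol_second_order[OF X(1), of "\<gamma> s" h] h trip[OF s'] by (simp add: X(2))
  also have "\<dots> \<le> 4 * M\<^sup>2 * 1 * h\<^sup>2"
    using X(4) norm_tripotent_le[OF trip[OF s']] h by (intro mult_mono power_mono) auto
  finally have 2: "norm ((evol X h o\<^sub>L \<gamma> s o\<^sub>L evol X (- h)) - \<gamma> s - h *\<^sub>R \<gamma>' s) \<le> 4 * M\<^sup>2 * h\<^sup>2" by simp
  have "(evol X h o\<^sub>L \<gamma> s o\<^sub>L evol X (- h)) - \<gamma> (s + h)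
      = ((evol X h o\<^sub>L \<gamma> s o\<^sub>L evol X (- h)) - \<gamma> s - h *\<^sub>R \<gamma>' s) - (\<gamma> (s + h) - \<gamma> s - h *\<^sub>R \<gamma>' s)"
    by simp
  then have "norm ((evol X h o\<^sub>L \<gamma> s o\<^sub>L evol X (- h)) - \<gamma> (s + h)) \<le> 4 * M\<^sup>2 * h\<^sup>2 + K * h\<^sup>2"
    by (simp only:) (rule order_trans[OF norm_triangle_ineq4 add_mono[OF 2 1]])
  then show ?thesis using X by (intro exI[of _ X]) (simp add: algebra_simps)
qed

text \<open>
  The excess of a step over the length of its piece of the curve, in units of \<open>h\<^sup>2\<close>: \<open>1\<close> for the lift
  being only almost minimal, \<open>M\<^sup>2\<close> for passing from chords to angles, \<open>lip\<close> for replacing the integral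
  of the speed by its value at the left end.
\<close>
definition defect :: real where "defect = 1 + M\<^sup>2 + lip"

text \<open>
  \<open>U\<close> is a product of \<open>k\<close> steps. Conjugation by unitaries is isometric, so the errors of the end
  points add up, and so do the angles. Only the total error has to vanish as \<open>n\<close> grows, and it is of
  order \<open>n h\<^sup>2\<close>. An exact lift of the curve to the unitary group would be the solution of a differential
  equation; approximate ones suffice because the inequality to be proved is preserved by limits.
\<close>
lemma approximate_lift:
  assumes n: "0 < n" and h: "h = (b - a) / real n" "h * M \<le> 1"
    and small: "integral {a..b} speed + real n * defect * h\<^sup>2 \<le> pi"
  shows "k \<le> n \<Longrightarrow> \<exists>U. unitary U \<and>
    norm ((U o\<^sub>L \<gamma> a o\<^sub>L adj U) - \<gamma> (a + real k * h)) \<le> real k * ((K + 4 * M\<^sup>2) * h\<^sup>2) \<and>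
    (\<forall>\<xi>. norm \<xi> = 1 \<longrightarrow>
      cos (integral {a..a + real k * h} speed + real k * defect * h\<^sup>2) \<le> inner (blinfun_apply U \<xi>) \<xi>)"
proof (induction k)
  case 0
  have "(id_blinfun o\<^sub>L \<gamma> a o\<^sub>L adj id_blinfun) - \<gamma> (a + real 0 * h) = 0"
    by (rule blinfun_eqI) (simp add: blinfun.diff_left)
  then show ?case
    by (intro exI[of _ id_blinfun]) (auto simp: unitary_def dot_square_norm intro!: blinfun_eqI)
next
  case (Suc k)
  then obtain U where U: "unitary U"
    "norm ((U o\<^sub>L \<gamma> a o\<^sub>L adj U) - \<gamma> (a + real k * h)) \<le> real k * ((K + 4 * M\<^sup>2) * h\<^sup>2)"
    "\<And>\<xi>. norm \<xi> = 1 \<Longrightarrow>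
      cos (integral {a..a + real k * h} speed + real k * defect * h\<^sup>2) \<le> inner (blinfun_apply U \<xi>) \<xi>"
    by auto
  have h0: "0 < h" using ab n h(1) by simp
  have h1: "h \<le> 1"
  proof -
    have "h * 1 \<le> h * M" using M_ge_1 h0 by (intro mult_left_mono) auto
    then show ?thesis using h(2) by linarith
  qed
  define s where "s = a + real k * h"
  have nh: "a + real n * h = b" using n by (simp add: h(1))
  have "real (Suc k) * h \<le> real n * h" using Suc.prems h0 by (intro mult_right_mono) auto
  then have s: "a \<le> s" "s + h \<le> b" "s + h = a + real (Suc k) * h"
    using h0 nh by (auto simp: s_def algebra_simps)
  obtain X where X: "selfadjoint X" "norm X \<le> speed s + h" "norm X \<le> M"
    "norm ((evol X h o\<^sub>L \<gamma> s o\<^sub>L evol X (- h)) - \<gamma> (s + h)) \<le> (K + 4 * M\<^sup>2) * h\<^sup>2"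
    using curve_step[OF s(1,2) h0 h1] by blast
  define E where "E = evol X h"
  have E: "unitary E" "adj E = evol X (- h)"
    unfolding E_def by (auto simp: unitary_evol adj_evol X(1))
  define \<alpha> where "\<alpha> = integral {a..s} speed + real k * defect * h\<^sup>2"
  define \<beta> where "\<beta> = h * norm X + (h * norm X)\<^sup>2"
  have \<beta>: "\<beta> \<le> integral {s..s + h} speed + defect * h\<^sup>2"
  proof -
    have "h * norm X \<le> h * (speed s + h)" using X(2) h0 by (intro mult_left_mono) auto
    moreover have "(h * norm X)\<^sup>2 \<le> (h * M)\<^sup>2" using X(3) h0 by (intro power_mono mult_left_mono) auto
    moreover have "h * speed s \<le> integral {s..s + h} speed + lip * h\<^sup>2"
      using s h0 by (intro speed_integral_step) auto
    ultimately show ?thesis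
      by (simp add: \<beta>_def defect_def power_mult_distrib algebra_simps power2_eq_square)
  qed
  have defect: "0 \<le> defect * h\<^sup>2" using lip_nonneg by (simp add: defect_def)
  have int_nonneg: "0 \<le> integral {r..t} speed" if "a \<le> r" "t \<le> b" for r t
    using that speed_integrable[OF that] by (intro integral_nonneg) (auto intro: speed_nonneg)
  have \<alpha>0: "0 \<le> \<alpha>" using int_nonneg[of a s] s h0 defect by (simp add: \<alpha>_def mult.assoc)
  have \<beta>0: "0 \<le> \<beta>" using h0 by (simp add: \<beta>_def)
  have sum: "\<alpha> + \<beta> \<le> integral {a..s + h} speed + real (Suc k) * defect * h\<^sup>2"
    using \<beta> integral_speed_combine[of s h] s h0 by (simp add: \<alpha>_def algebra_simps)
  have le_pi: "integral {a..s + h} speed + real (Suc k) * defect * h\<^sup>2 \<le> pi"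
  proof -
    have "integral {a..b} speed = integral {a..s + h} speed + integral {s + h..b} speed"
      using s h0 integral_speed_combine[of "s + h" "b - (s + h)"] by simp
    moreover have "real (Suc k) * (defect * h\<^sup>2) \<le> real n * (defect * h\<^sup>2)"
      using Suc.prems defect by (intro mult_right_mono) auto
    ultimately show ?thesis using small int_nonneg[of "s + h" b] s h0 by (simp add: mult.assoc)
  qed
  have "unitary (E o\<^sub>L U)" by (rule unitary_compose[OF E(1) U(1)])
  moreover have "norm (((E o\<^sub>L U) o\<^sub>L \<gamma> a o\<^sub>L adj (E o\<^sub>L U)) - \<gamma> (a + real (Suc k) * h))
      \<le> real (Suc k) * ((K + 4 * M\<^sup>2) * h\<^sup>2)"
  proof -
    let ?d = "(U o\<^sub>L \<gamma> a o\<^sub>L adj U) - \<gamma> s"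
    have "((E o\<^sub>L U) o\<^sub>L \<gamma> a o\<^sub>L adj (E o\<^sub>L U)) - \<gamma> (s + h)
        = (E o\<^sub>L ?d o\<^sub>L adj E) + ((evol X h o\<^sub>L \<gamma> s o\<^sub>L evol X (- h)) - \<gamma> (s + h))"
      by (rule blinfun_eqI)
        (simp add: adj_compose unitaryD(1)[OF E(1)] unitaryD(1)[OF U(1)] blinfun.bilinear_simps E(2)
          flip: E_def)
    then have "norm (((E o\<^sub>L U) o\<^sub>L \<gamma> a o\<^sub>L adj (E o\<^sub>L U)) - \<gamma> (s + h))
        \<le> norm (E o\<^sub>L ?d o\<^sub>L adj E) + (K + 4 * M\<^sup>2) * h\<^sup>2"
      by (simp only:) (rule order_trans[OF norm_triangle_ineq add_left_mono[OF X(4)]])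
    moreover have "norm (E o\<^sub>L ?d o\<^sub>L adj E) \<le> real k * ((K + 4 * M\<^sup>2) * h\<^sup>2)"
      using norm_conj_le[OF E(1), of ?d] U(2) by (simp add: s_def)
    ultimately show ?thesis unfolding s(3)[symmetric] by (simp add: algebra_simps)
  qed
  moreover have "cos (integral {a..a + real (Suc k) * h} speed + real (Suc k) * defect * h\<^sup>2)
      \<le> inner (blinfun_apply (E o\<^sub>L U) \<xi>) \<xi>" if \<xi>: "norm \<xi> = 1" for \<xi>
  proof -
    have nU: "norm (blinfun_apply U \<xi>) = 1" using \<xi> by (simp add: unitary_norm_apply[OF U(1)])
    have "cos (integral {a..s + h} speed + real (Suc k) * defect * h\<^sup>2) \<le> cos (\<beta> + \<alpha>)"
      using sum le_pi \<alpha>0 \<beta>0 by (intro cos_monotone_0_pi_le) auto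
    also have "\<dots> \<le> inner (blinfun_apply E (blinfun_apply U \<xi>)) \<xi>"
    proof (rule inner_ge_cos_trans[where b = "blinfun_apply U \<xi>"])
      show "cos \<beta> \<le> inner (blinfun_apply E (blinfun_apply U \<xi>)) (blinfun_apply U \<xi>)"
        unfolding \<beta>_def E_def
      proof (rule evol_angle[OF X(1) _ _ nU])
        have "h * norm X \<le> h * M" using X(3) h0 by (intro mult_left_mono) auto
        then show "h * norm X \<le> 1" using h(2) by linarith
      qed (use h0 in simp)
      show "cos \<alpha> \<le> inner (blinfun_apply U \<xi>) \<xi>"
        using U(3)[OF \<xi>] by (simp add: \<alpha>_def s_def)
    qed (use \<xi> nU \<alpha>0 \<beta>0 sum le_pi unitary_norm_apply[OF E(1)] in auto)
    finally show ?thesis by (simp add: s(3))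
  qed
  ultimately show ?case by blast
qed

text \<open>
  If the curve were shorter, then \<open>U = e\<^sup>i\<^sup>t\<^sup>Z W\<close> with \<open>W\<close> almost commuting with \<open>\<gamma> a\<close>, and replacing \<open>W\<close> by a
  contraction \<open>B\<close> in the commutant would yield a vector which \<open>U\<close> turns by almost \<open>t * norm Z\<close> or more, although
  \<open>U\<close> turns no vector by more than about \<open>L\<close>.
\<close>
lemma minimal_le_length:
  assumes Z: "selfadjoint Z"
    and minimal: "\<And>Y. selfadjoint Y \<Longrightarrow> Y o\<^sub>L \<gamma> a = \<gamma> a o\<^sub>L Y \<Longrightarrow> norm Z \<le> norm (Z + Y)"
    and t: "0 \<le> t" "t * norm Z \<le> pi / 2"
    and end_eq: "\<gamma> b = evol Z t o\<^sub>L \<gamma> a o\<^sub>L evol Z (- t)"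
  shows "t * norm Z \<le> integral {a..b} speed"
proof (rule ccontr)
  assume less: "\<not> ?thesis"
  define L where "L = integral {a..b} speed"
  have L: "0 \<le> L" "L < t * norm Z"
    using less speed_integrable[of a b]
    by (auto simp: L_def intro!: integral_nonneg intro: speed_nonneg)
  have "Z \<noteq> 0" using L by auto
  define G where "G = \<gamma> a"
  have G: "tripotent G" using trip[of a] ab by (simp add: G_def)
  define h where "h n = (b - a) / real n" for n
  define \<epsilon> where "\<epsilon> n = real n * ((K + 4 * M\<^sup>2) * (h n)\<^sup>2)" for n
  have lim: "(\<lambda>n. c * (h n) ^ 1) \<longlonglongrightarrow> 0" "(\<lambda>n. real n * c * (h n)\<^sup>2) \<longlonglongrightarrow> 0" for c
  proof -
    have i: "(\<lambda>n. inverse (real n)) \<longlonglongrightarrow> 0" by (rule LIMSEQ_inverse_real_of_nat[THEN LIMSEQ_imp_Suc])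
    from tendsto_mult_left[OF i, of "c * (b - a)"] show "(\<lambda>n. c * (h n) ^ 1) \<longlonglongrightarrow> 0"
      by (simp add: h_def divide_inverse mult.assoc)
    have eq: "real n * c * (h n)\<^sup>2 = c * (b - a)\<^sup>2 * inverse (real n)" for n
      by (cases "n = 0") (simp_all add: h_def field_simps power2_eq_square)
    then show "(\<lambda>n. real n * c * (h n)\<^sup>2) \<longlonglongrightarrow> 0"
      using tendsto_mult_left[OF i, of "c * (b - a)\<^sup>2"] by (simp only: eq mult_zero_right)
  qed
  have \<epsilon>: "\<epsilon> \<longlonglongrightarrow> 0" using lim(2)[of "K + 4 * M\<^sup>2"] unfolding \<epsilon>_def[abs_def] by (simp add: mult.assoc)
  have key: "cos (L + real n * defect * (h n)\<^sup>2) \<le> cos (t * norm Z) + (8 * \<epsilon> n + h n)"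
    if n: "0 < n" "h n * M \<le> 1" "L + real n * defect * (h n)\<^sup>2 \<le> pi" for n
  proof -
    obtain U where U: "unitary U" "norm ((U o\<^sub>L G o\<^sub>L adj U) - \<gamma> b) \<le> \<epsilon> n"
      "\<And>\<xi>. norm \<xi> = 1 \<Longrightarrow> cos (L + real n * defect * (h n)\<^sup>2) \<le> inner (blinfun_apply U \<xi>) \<xi>"
      using approximate_lift[OF n(1) h_def n(2) _ order_refl] n(3) n(1)
      unfolding L_def \<epsilon>_def G_def by (auto simp: h_def)
    define W where "W = evol Z (- t) o\<^sub>L U"
    have Wu: "unitary W" unfolding W_def by (intro unitary_compose unitary_evol Z U)
    have UW: "blinfun_apply U x = blinfun_apply (evol Z t) (blinfun_apply W x)" for x by (simp add: W_def)
    have "(W o\<^sub>L G) - (G o\<^sub>L W) = evol Z (- t) o\<^sub>L ((U o\<^sub>L G o\<^sub>L adj U) - \<gamma> b) o\<^sub>L U"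
      by (rule blinfun_eqI) (simp add: end_eq G_def W_def blinfun.bilinear_simps unitaryD[OF U(1)])
    then have comm: "norm ((W o\<^sub>L G) - (G o\<^sub>L W)) \<le> \<epsilon> n"
      by (simp only:) (rule order_trans[OF norm_unitary_compose_right[OF U(1)]
          order_trans[OF norm_unitary_compose_left[OF unitary_evol[OF Z]] U(2)]])
    obtain B where B: "B \<in> bounded_ops" "B o\<^sub>L G = G o\<^sub>L B" "norm B \<le> norm W"
      "norm (B - W) \<le> 7 * norm ((W o\<^sub>L G) - (G o\<^sub>L W))"
      using tripotent_almost_commuting[OF G unitaryD(1)[OF Wu]] by blast
    have B1: "norm B \<le> 1" using B(3) unitary_norm_le[OF Wu] by simp
    have hn: "0 < h n" using n(1) ab by (simp add: h_def)
    obtain \<xi> where \<xi>: "norm \<xi> = 1"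
      "inner (blinfun_apply (evol Z t) (blinfun_apply B \<xi>)) \<xi> \<le> cos (t * norm Z) + h n"
      using minimal_moves_some_vector[OF Z \<open>Z \<noteq> 0\<close> tripotent_selfadjoint[OF G] minimal[folded G_def] B(1,2) B1 t hn]
      by blast
    have "inner (blinfun_apply (evol Z t) (blinfun_apply (W - B) \<xi>)) \<xi> \<le> norm (blinfun_apply (W - B) \<xi>)"
      using norm_cauchy_schwarz[of "blinfun_apply (evol Z t) (blinfun_apply (W - B) \<xi>)" \<xi>] \<xi>(1)
      by (simp add: unitary_norm_apply[OF unitary_evol[OF Z]])
    also have "\<dots> \<le> norm (B - W)"
      using norm_blinfun[of "W - B" \<xi>] \<xi>(1) by (simp add: norm_minus_commute)
    also have "\<dots> \<le> 7 * \<epsilon> n" using B(4) comm by linarith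
    finally have "inner (blinfun_apply U \<xi>) \<xi> \<le> cos (t * norm Z) + h n + 7 * \<epsilon> n"
      using \<xi>(2) by (simp add: UW blinfun.bilinear_simps inner_diff_left)
    moreover have "0 \<le> \<epsilon> n" using U(2) order_trans[OF norm_ge_zero] by blast
    ultimately show ?thesis using U(3)[OF \<xi>(1)] by linarith
  qed
  have "\<forall>\<^sub>F n in sequentially. 0 < n \<and> h n * M \<le> 1 \<and> L + real n * defect * (h n)\<^sup>2 \<le> pi"
  proof (intro eventually_conj)
    show "\<forall>\<^sub>F n::nat in sequentially. 0 < n" by (rule eventually_gt_at_top)
    have "\<forall>\<^sub>F n in sequentially. M * h n ^ 1 < 1" by (rule order_tendstoD(2)[OF lim(1)]) simp
    then show "\<forall>\<^sub>F n in sequentially. h n * M \<le> 1" by eventually_elim (simp add: mult.commute)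
    have "L < pi" using L t pi_gt_zero by linarith
    then have "\<forall>\<^sub>F n in sequentially. real n * defect * (h n)\<^sup>2 < pi - L"
      by (intro order_tendstoD(2)[OF lim(2)]) simp
    then show "\<forall>\<^sub>F n in sequentially. L + real n * defect * (h n)\<^sup>2 \<le> pi" by eventually_elim simp
  qed
  then have "\<forall>\<^sub>F n in sequentially. cos (L + real n * defect * (h n)\<^sup>2) \<le> cos (t * norm Z) + (8 * \<epsilon> n + h n)"
    by eventually_elim (use key in blast)
  moreover have "(\<lambda>n. cos (L + real n * defect * (h n)\<^sup>2)) \<longlonglongrightarrow> cos (L + 0)"
    by (intro tendsto_cos tendsto_add tendsto_const lim)
  moreover have "(\<lambda>n. cos (t * norm Z) + (8 * \<epsilon> n + h n)) \<longlonglongrightarrow> cos (t * norm Z) + (8 * 0 + 0)"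
    using lim(1)[of 1] by (intro tendsto_add tendsto_const tendsto_mult \<epsilon>) simp
  ultimately have "cos (L + 0) \<le> cos (t * norm Z) + (8 * 0 + 0)"
    by (intro tendsto_le[of sequentially]) auto
  moreover have "cos (t * norm Z) < cos L"
    using L t pi_gt_zero by (intro cos_monotone_0_pi) auto
  ultimately show False by simp
qed

end

section \<open>Block operators\<close>

lemma block_apply [simp]:
  "blinfun_apply (block A B C D) (x, y) =
    (blinfun_apply A x + blinfun_apply B y, blinfun_apply C x + blinfun_apply D y)"
  by (simp add: block.rep_eq)

lemma block12_apply [simp]: "blinfun_apply (block12 T) x = fst (blinfun_apply T (0, x))"
  by (simp add: block12.rep_eq)

lemma blinfun_prod_eqI: "(\<And>x y. blinfun_apply S (x, y) = blinfun_apply T (x, y)) \<Longrightarrow> S = T"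
  by (rule blinfun_eqI) (metis surj_pair)

lemma scaleC_Pair [simp]: "c *\<^sub>C (x, y) = (c *\<^sub>C x, c *\<^sub>C y)"
  by (simp add: scaleC_prod_def)

lemma block_bounded_ops_iff:
  "block A 0 0 D \<in> bounded_ops \<longleftrightarrow> A \<in> bounded_ops \<and> D \<in> bounded_ops"
  by (auto simp: bounded_ops_def)

lemma block_add: "block A B C D + block A' B' C' D' = block (A + A') (B + B') (C + C') (D + D')"
  by (rule blinfun_prod_eqI) (simp add: blinfun.add_left algebra_simps)

lemma adj_block_diag:
  "U \<in> bounded_ops \<Longrightarrow> W \<in> bounded_ops \<Longrightarrow> adj (block U 0 0 W) = block (adj U) 0 0 (adj W)"
  by (rule adj_unique) (auto simp: block_bounded_ops_iff inner_adj_right[of U] inner_adj_right[of W])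

lemma block_diag_inject: "block A 0 0 D = block A' 0 0 D' \<longleftrightarrow> A = A' \<and> D = D'"
proof
  assume "block A 0 0 D = block A' 0 0 D'"
  then have "blinfun_apply (block A 0 0 D) (x, y) = blinfun_apply (block A' 0 0 D') (x, y)" for x y by simp
  then show "A = A' \<and> D = D'" by (auto intro!: blinfun_eqI)
qed simp

lemma block_diag_compose: "block A 0 0 D o\<^sub>L block A' 0 0 D' = block (A o\<^sub>L A') 0 0 (D o\<^sub>L D')"
  by (rule blinfun_prod_eqI) simp

lemma block_diag_id: "block id_blinfun 0 0 id_blinfun = id_blinfun"
  by (rule blinfun_prod_eqI) simp

lemma selfadjoint_block_diag: "selfadjoint (block A 0 0 D) \<longleftrightarrow> selfadjoint A \<and> selfadjoint D"
  unfolding selfadjoint_def block_bounded_ops_iff by (auto simp: adj_block_diag block_diag_inject)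

lemma unitary_block_diag: "unitary (block U 0 0 W) \<longleftrightarrow> unitary U \<and> unitary W"
  unfolding unitary_def block_bounded_ops_iff
  by (auto simp: adj_block_diag block_diag_compose block_diag_inject simp flip: block_diag_id)

lemma norm_block_diag: "norm (block A 0 0 D) = max (norm A) (norm D)"
proof (rule antisym)
  let ?m = "max (norm A) (norm D)"
  show "norm (block A 0 0 D) \<le> ?m"
  proof (rule norm_blinfun_bound)
    fix p :: "'a \<times> 'a"
    obtain x y where p: "p = (x, y)" by (cases p)
    have "norm (blinfun_apply A x) \<le> ?m * norm x" "norm (blinfun_apply D y) \<le> ?m * norm y"
      using norm_blinfun[of A x] norm_blinfun[of D y] mult_right_mono[of "norm A" ?m "norm x"]
        mult_right_mono[of "norm D" ?m "norm y"] by auto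
    then have "(norm (blinfun_apply A x))\<^sup>2 + (norm (blinfun_apply D y))\<^sup>2 \<le> (?m * norm x)\<^sup>2 + (?m * norm y)\<^sup>2"
      by (intro add_mono power_mono) auto
    also have "\<dots> = ?m\<^sup>2 * ((norm x)\<^sup>2 + (norm y)\<^sup>2)" by (simp add: power_mult_distrib algebra_simps)
    finally have "sqrt ((norm (blinfun_apply A x))\<^sup>2 + (norm (blinfun_apply D y))\<^sup>2)
        \<le> sqrt (?m\<^sup>2 * ((norm x)\<^sup>2 + (norm y)\<^sup>2))" by (rule real_sqrt_le_mono)
    then show "norm (blinfun_apply (block A 0 0 D) p) \<le> ?m * norm p"
      by (simp add: p norm_Pair real_sqrt_mult abs_of_nonneg le_max_iff_disj)
  qed (simp add: le_max_iff_disj)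
  have "norm A \<le> norm (block A 0 0 D)"
  proof (rule norm_blinfun_bound)
    show "norm (blinfun_apply A x) \<le> norm (block A 0 0 D) * norm x" for x
      using norm_blinfun[of "block A 0 0 D" "(x, 0)"] by (simp add: norm_Pair)
  qed simp
  moreover have "norm D \<le> norm (block A 0 0 D)"
  proof (rule norm_blinfun_bound)
    show "norm (blinfun_apply D x) \<le> norm (block A 0 0 D) * norm x" for x
      using norm_blinfun[of "block A 0 0 D" "(0, x)"] by (simp add: norm_Pair)
  qed simp
  ultimately show "?m \<le> norm (block A 0 0 D)" by simp
qed

text \<open>
  Block diagonal operators are those that commute with this symmetry, off-diagonal ones those that
  anticommute with it.
\<close>
definition grading :: "('a::complex_hilbert \<times> 'a) \<Rightarrow>\<^sub>L ('a \<times> 'a)" where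
  "grading = block id_blinfun 0 0 (- id_blinfun)"

lemma grading_apply [simp]: "blinfun_apply grading (x, y) = (x, - y)"
  by (simp add: grading_def blinfun.minus_left)

lemma symmetry_grading: "symmetry grading"
proof -
  have "selfadjoint (- id_blinfun)" using selfadjoint_scaleR[OF selfadjoint_id, of "-1"] by simp
  then show ?thesis
    unfolding symmetry_def grading_def by (auto simp: selfadjoint_block_diag blinfun.minus_left blinfun.minus_right intro!: blinfun_prod_eqI)
qed

lemma average_grading_block: "average grading (block A B C D) = block A 0 0 D"
  by (rule blinfun_prod_eqI)
    (simp add: average_def blinfun.bilinear_simps flip: scaleR_add_left)

lift_definition corner11 :: "('a::complex_hilbert \<times> 'a) \<Rightarrow>\<^sub>L ('a \<times> 'a) \<Rightarrow> 'a \<Rightarrow>\<^sub>L 'a"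
  is "\<lambda>T x. fst (T (x, 0))"
  by (rule bounded_linear_compose[OF bounded_linear_fst]
      bounded_linear_compose[OF _ bounded_linear_Pair[OF bounded_linear_ident bounded_linear_zero]]
      | assumption)+

lift_definition corner22 :: "('a::complex_hilbert \<times> 'a) \<Rightarrow>\<^sub>L ('a \<times> 'a) \<Rightarrow> 'a \<Rightarrow>\<^sub>L 'a"
  is "\<lambda>T x. snd (T (0, x))"
  by (rule bounded_linear_compose[OF bounded_linear_snd]
      bounded_linear_compose[OF _ bounded_linear_Pair[OF bounded_linear_zero bounded_linear_ident]]
      | assumption)+

lemma commutes_grading_block_diag:
  assumes "T o\<^sub>L grading = grading o\<^sub>L T"
  shows "T = block (corner11 T) 0 0 (corner22 T)"
proof (rule blinfun_prod_eqI)
  fix x y :: 'a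
  have *: "blinfun_apply T (a, - b) = blinfun_apply grading (blinfun_apply T (a, b))" for a b
    using compose_commute_apply[OF assms, of "(a, b)"] by simp
  obtain p q where pq: "blinfun_apply T (x, 0) = (p, q)" by fastforce
  obtain r s where rs: "blinfun_apply T (0, y) = (r, s)" by fastforce
  have "q = 0" using *[of x 0] pq by simp (metis eq_neg_iff_add_eq_0 scaleR_2 scaleR_eq_0_iff zero_neq_numeral)
  moreover have "r = 0"
  proof -
    have "blinfun_apply T (0, - y) = - blinfun_apply T (0, y)"
      using blinfun.minus_right[of T "(0, y)"] by simp
    then have "- r = r" using *[of 0 y] rs by simp
    then show ?thesis by (metis eq_neg_iff_add_eq_0 scaleR_2 scaleR_eq_0_iff zero_neq_numeral)
  qed
  moreover have "blinfun_apply T (x, y) = blinfun_apply T (x, 0) + blinfun_apply T (0, y)"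
    by (simp flip: blinfun.add_right)
  ultimately show "blinfun_apply T (x, y) = blinfun_apply (block (corner11 T) 0 0 (corner22 T)) (x, y)"
    by (simp add: corner11.rep_eq corner22.rep_eq pq rs)
qed

section \<open>The tripotent of a partial isometry\<close>

lemma eps_apply [simp]: "blinfun_apply (eps V) (x, y) = (blinfun_apply V y, blinfun_apply (adj V) x)"
  by (simp add: eps_def)

lemma block12_eps [simp]: "block12 (eps V) = V"
  by (rule blinfun_eqI) simp

lemma selfadjoint_eps:
  assumes V: "V \<in> bounded_ops" shows "selfadjoint (eps V)"
  unfolding selfadjoint_iff
proof (intro conjI allI)
  show "eps V \<in> bounded_ops"
    unfolding bounded_ops_def using V by (auto simp: bounded_ops_apply)
  show "inner (blinfun_apply (eps V) p) q = inner p (blinfun_apply (eps V) q)" for p q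
    by (cases p, cases q) (simp add: inner_adj_right[OF V] inner_adj_left[OF V])
qed

lemma tripotent_eps:
  assumes "V \<in> partial_isometries" shows "tripotent (eps V)"
proof -
  have V: "V \<in> bounded_ops" "V o\<^sub>L adj V o\<^sub>L V = V" using assms by (auto simp: partial_isometries_def)
  have "adj V o\<^sub>L (V o\<^sub>L adj V) = adj V"
    using arg_cong[OF V(2), of adj] V(1) by (simp add: adj_compose)
  then have "blinfun_apply (adj V) (blinfun_apply V (blinfun_apply (adj V) x)) = blinfun_apply (adj V) x"
    and "blinfun_apply V (blinfun_apply (adj V) (blinfun_apply V x)) = blinfun_apply V x" for x
    using V(2) by (metis blinfun_apply_blinfun_compose)+
  then show ?thesis
    unfolding tripotent_def using selfadjoint_eps[OF V(1)] by (auto intro!: blinfun_prod_eqI)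
qed

lemma grading_eps: "grading o\<^sub>L eps V o\<^sub>L grading = - eps V"
  by (rule blinfun_prod_eqI) (simp add: blinfun.minus_left blinfun.minus_right)

lemma eps_of_anticommuting:
  assumes T: "selfadjoint T" and anti: "grading o\<^sub>L T o\<^sub>L grading = - T"
  shows "block12 T \<in> bounded_ops" "T = eps (block12 T)"
proof -
  have *: "blinfun_apply grading (blinfun_apply T (a, - b)) = - blinfun_apply T (a, b)" for a b
    using arg_cong[OF anti, of "\<lambda>S. blinfun_apply S (a, b)"] by (simp add: blinfun.minus_left)
  have self: "z = - z \<Longrightarrow> z = 0" for z :: 'a
    by (metis eq_neg_iff_add_eq_0 scaleR_2 scaleR_eq_0_iff zero_neq_numeral)
  have T1: "fst (blinfun_apply T (x, 0)) = 0" for x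
    using *[of x 0] by (cases "blinfun_apply T (x, 0)") (auto intro: self)
  have T2: "snd (blinfun_apply T (0, y)) = 0" for y
  proof -
    have "blinfun_apply T (0, - y) = - blinfun_apply T (0, y)"
      using blinfun.minus_right[of T "(0, y)"] by simp
    then show ?thesis using *[of 0 y] by (cases "blinfun_apply T (0, y)") (auto intro: self)
  qed
  have Tc: "blinfun_apply T (c *\<^sub>C p) = c *\<^sub>C blinfun_apply T p" for c p
    using T by (simp add: bounded_ops_apply)
  show w: "block12 T \<in> bounded_ops"
    using Tc[of _ "(0, _)"] by (simp add: bounded_ops_def scaleC_prod_def)
  have adjw: "snd (blinfun_apply T (x, 0)) = blinfun_apply (adj (block12 T)) x" for x
  proof (rule inner_eqI)
    fix y
    have "inner y (snd (blinfun_apply T (x, 0))) = inner (0, y) (blinfun_apply T (x, 0))"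
      by (simp add: inner_prod_def)
    also have "\<dots> = inner (blinfun_apply T (0, y)) (x, 0)" by (rule selfadjointD[OF T, symmetric])
    also have "\<dots> = inner (blinfun_apply (block12 T) y) x" by (simp add: inner_prod_def)
    also have "\<dots> = inner y (blinfun_apply (adj (block12 T)) x)" by (rule inner_adj_right[OF w])
    finally show "inner y (snd (blinfun_apply T (x, 0))) = inner y (blinfun_apply (adj (block12 T)) x)" .
  qed
  show "T = eps (block12 T)"
  proof (rule blinfun_prod_eqI)
    fix x y
    have "blinfun_apply T (x, y) = blinfun_apply T (x, 0) + blinfun_apply T (0, y)"
      by (simp flip: blinfun.add_right)
    then show "blinfun_apply T (x, y) = blinfun_apply (eps (block12 T)) (x, y)"
      by (simp add: prod_eq_iff T1 T2 adjw)
  qed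
qed

lemma commutator_block_diag_eps:
  assumes "selfadjoint A" "selfadjoint B" "V \<in> bounded_ops"
  shows "\<i> *\<^sub>C ((block A 0 0 B o\<^sub>L eps V) - (eps V o\<^sub>L block A 0 0 B)) = eps (\<i> *\<^sub>C (A o\<^sub>L V) - \<i> *\<^sub>C (V o\<^sub>L B))"
proof -
  let ?w = "\<i> *\<^sub>C (A o\<^sub>L V) - \<i> *\<^sub>C (V o\<^sub>L B)"
  have "adj ?w = \<i> *\<^sub>C (B o\<^sub>L adj V) - \<i> *\<^sub>C (adj V o\<^sub>L A)"
    using assms
    by (intro adj_unique) (auto simp: blinfun.diff_left inner_diff_left inner_diff_right inner_i_left
        selfadjointD inner_adj_right bounded_ops_apply)
  then show ?thesis
    by (intro blinfun_prod_eqI) (simp add: blinfun.diff_left scaleC_diff_right)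
qed

text \<open>
  The sign changes because \<open>grading\<close> anticommutes with \<open>eps V\<close>: an off-diagonal commutator is kept by
  the average, a vanishing one stays zero.
\<close>
lemma average_grading_commutator:
  "(average grading X o\<^sub>L eps V) - (eps V o\<^sub>L average grading X)
    = (1/2) *\<^sub>R (((X o\<^sub>L eps V) - (eps V o\<^sub>L X)) - (grading o\<^sub>L ((X o\<^sub>L eps V) - (eps V o\<^sub>L X)) o\<^sub>L grading))"
proof (rule blinfun_eqI)
  fix p
  have *: "blinfun_apply (eps V) (blinfun_apply grading q) = - blinfun_apply grading (blinfun_apply (eps V) q)" for q
    by (cases q) (simp add: blinfun.minus_right)
  show "blinfun_apply ((average grading X o\<^sub>L eps V) - (eps V o\<^sub>L average grading X)) p
    = blinfun_apply ((1/2) *\<^sub>R (((X o\<^sub>L eps V) - (eps V o\<^sub>L X)) - (grading o\<^sub>L ((X o\<^sub>L eps V) - (eps V o\<^sub>L X)) o\<^sub>L grading))) p"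
    by (simp add: average_def blinfun.bilinear_simps * algebra_simps)
qed

text \<open>
  Block diagonal lifts are lifts, and averaging over \<open>grading\<close> turns any lift into a block diagonal one
  without increasing the norm.
\<close>
lemma orbit_norm_eps:
  assumes V: "V \<in> bounded_ops"
  shows "orbit_norm (eps V) (eps w) = pi_norm V w"
proof -
  let ?S = "{norm X |X. selfadjoint X \<and> \<i> *\<^sub>C ((X o\<^sub>L eps V) - (eps V o\<^sub>L X)) = eps w}"
  let ?R = "{max (norm A) (norm B) |A B. selfadjoint A \<and> selfadjoint B \<and> \<i> *\<^sub>C (A o\<^sub>L V) - \<i> *\<^sub>C (V o\<^sub>L B) = w}"
  have sub: "?R \<subseteq> ?S"
  proof
    fix r assume "r \<in> ?R"
    then obtain A B where AB: "selfadjoint A" "selfadjoint B" "\<i> *\<^sub>C (A o\<^sub>L V) - \<i> *\<^sub>C (V o\<^sub>L B) = w" "r = max (norm A) (norm B)"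
      by blast
    then show "r \<in> ?S"
      using commutator_block_diag_eps[OF AB(1,2) V]
      by (intro CollectI exI[of _ "block A 0 0 B"]) (auto simp: selfadjoint_block_diag norm_block_diag)
  qed
  have dom: "\<exists>r\<in>?R. r \<le> s" if "s \<in> ?S" for s
  proof -
    from that obtain X where X: "selfadjoint X" "\<i> *\<^sub>C ((X o\<^sub>L eps V) - (eps V o\<^sub>L X)) = eps w" "s = norm X" by blast
    define Y where "Y = average grading X"
    define A where "A = corner11 Y"
    define B where "B = corner22 Y"
    have Y: "Y = block A 0 0 B"
      unfolding A_def B_def Y_def by (intro commutes_grading_block_diag average_commutes symmetry_grading)
    have "selfadjoint Y" unfolding Y_def by (intro average_selfadjoint symmetry_grading X)
    then have AB: "selfadjoint A" "selfadjoint B" by (auto simp: Y selfadjoint_block_diag)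
    have "\<i> *\<^sub>C ((Y o\<^sub>L eps V) - (eps V o\<^sub>L Y))
      = (1/2) *\<^sub>R (\<i> *\<^sub>C ((X o\<^sub>L eps V) - (eps V o\<^sub>L X)) - (grading o\<^sub>L \<i> *\<^sub>C ((X o\<^sub>L eps V) - (eps V o\<^sub>L X)) o\<^sub>L grading))"
      unfolding Y_def average_grading_commutator
      by (rule blinfun_eqI) (simp add: blinfun.bilinear_simps scaleC_scaleR scaleC_diff_right
          bounded_ops_apply symmetry_grading[unfolded symmetry_def])
    also have "\<dots> = (1/2) *\<^sub>R (eps w - - eps w)" unfolding X(2) grading_eps ..
    also have "\<dots> = eps w" by (simp flip: scaleR_2)
    finally have "eps (\<i> *\<^sub>C (A o\<^sub>L V) - \<i> *\<^sub>C (V o\<^sub>L B)) = eps w"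
      using commutator_block_diag_eps[OF AB V] by (simp add: Y)
    then have "\<i> *\<^sub>C (A o\<^sub>L V) - \<i> *\<^sub>C (V o\<^sub>L B) = w" by (metis block12_eps)
    moreover have "max (norm A) (norm B) \<le> s"
      using norm_average_le[OF symmetry_grading, of X] by (simp add: X(3) norm_block_diag Y[unfolded Y_def])
    ultimately show ?thesis using AB by blast
  qed
  have bdd: "bdd_below ?S" "bdd_below ?R" by (auto intro!: bdd_belowI[of _ 0] simp: le_max_iff_disj)
  \<comment> \<open>If there is no lift, both infima are taken over the empty set.\<close>
  have "Inf ?S = Inf ?R"
  proof (cases "?S = {}")
    case True
    then show ?thesis using sub by (simp only: subset_empty)
  next
    case False
    then have "?R \<noteq> {}" using dom by blast
    show ?thesis
    proof (rule antisym)
      show "Inf ?S \<le> Inf ?R" by (rule cInf_superset_mono[OF \<open>?R \<noteq> {}\<close> bdd(1) sub])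
      show "Inf ?R \<le> Inf ?S" by (rule cInf_mono[OF False bdd(2) dom])
    qed
  qed
  then show ?thesis by (simp only: orbit_norm_def pi_norm_def)
qed

lemma diag_orbit_norm_eq:
  assumes "selfadjoint E" "grading o\<^sub>L E o\<^sub>L grading = - E" "selfadjoint W" "grading o\<^sub>L W o\<^sub>L grading = - W"
  shows "diag_orbit_norm E W = orbit_norm E W"
  using orbit_norm_eps[OF eps_of_anticommuting(1)[OF assms(1,2)], of "block12 W"]
  unfolding diag_orbit_norm_def
  by (simp flip: eps_of_anticommuting(2)[OF assms(1,2)] eps_of_anticommuting(2)[OF assms(3,4)])

section \<open>Orbits\<close>

lemma block_diag_conj_eps:
  assumes "U \<in> bounded_ops" "V \<in> bounded_ops" "W \<in> bounded_ops"
  shows "block U 0 0 W o\<^sub>L eps V o\<^sub>L adj (block U 0 0 W) = eps (U o\<^sub>L V o\<^sub>L adj W)"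
  by (rule blinfun_prod_eqI) (simp add: adj_block_diag assms adj_compose)

lemma diag_orbit_subset:
  assumes "V \<in> bounded_ops" shows "diag_orbit V \<subseteq> unitary_orbit (eps V)"
proof
  fix E assume "E \<in> diag_orbit V"
  then obtain U W where "unitary U" "unitary W" "E = eps (U o\<^sub>L V o\<^sub>L adj W)" by (auto simp: diag_orbit_def)
  then have "E = block U 0 0 W o\<^sub>L eps V o\<^sub>L adj (block U 0 0 W)" "unitary (block U 0 0 W)"
    by (auto simp: block_diag_conj_eps unitaryD(1) assms unitary_block_diag)
  then show "E \<in> unitary_orbit (eps V)" unfolding unitary_orbit_def by blast
qed

lemma tripotent_conj: "unitary U \<Longrightarrow> tripotent G \<Longrightarrow> tripotent (U o\<^sub>L G o\<^sub>L adj U)"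
  unfolding tripotent_def[of "U o\<^sub>L G o\<^sub>L adj U"]
  by (auto intro!: selfadjoint_conj blinfun_eqI simp: unitaryD)

lemma commutator_conj:
  assumes "unitary U"
  shows "\<i> *\<^sub>C (((U o\<^sub>L X o\<^sub>L adj U) o\<^sub>L (U o\<^sub>L G o\<^sub>L adj U)) - ((U o\<^sub>L G o\<^sub>L adj U) o\<^sub>L (U o\<^sub>L X o\<^sub>L adj U)))
    = U o\<^sub>L \<i> *\<^sub>C ((X o\<^sub>L G) - (G o\<^sub>L X)) o\<^sub>L adj U"
  by (rule blinfun_eqI)
    (simp add: unitaryD[OF assms] blinfun.bilinear_simps scaleC_diff_right bounded_ops_apply)

lemma conj_adj_conj: "unitary U \<Longrightarrow> adj U o\<^sub>L (U o\<^sub>L A o\<^sub>L adj U) o\<^sub>L adj (adj U) = A"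
  by (rule blinfun_eqI) (simp add: unitaryD)

lemma orbit_norm_conj:
  assumes U: "unitary U"
  shows "orbit_norm (U o\<^sub>L G o\<^sub>L adj U) (U o\<^sub>L w o\<^sub>L adj U) = orbit_norm G w"
proof -
  let ?S = "\<lambda>G w. {norm X |X. selfadjoint X \<and> \<i> *\<^sub>C ((X o\<^sub>L G) - (G o\<^sub>L X)) = w}"
  have sub: "?S G w \<subseteq> ?S (U o\<^sub>L G o\<^sub>L adj U) (U o\<^sub>L w o\<^sub>L adj U)" if U: "unitary U" for U G w
  proof
    fix r assume "r \<in> ?S G w"
    then obtain X where X: "selfadjoint X" "\<i> *\<^sub>C ((X o\<^sub>L G) - (G o\<^sub>L X)) = w" "r = norm X" by blast
    have "norm X \<le> norm (U o\<^sub>L X o\<^sub>L adj U)"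
      using norm_conj_le[OF unitary_adj[OF U], of "U o\<^sub>L X o\<^sub>L adj U"] by (simp only: conj_adj_conj[OF U])
    then have "r = norm (U o\<^sub>L X o\<^sub>L adj U)" using norm_conj_le[OF U, of X] X(3) by simp
    moreover have "selfadjoint (U o\<^sub>L X o\<^sub>L adj U)" by (rule selfadjoint_conj[OF unitaryD(1)[OF U] X(1)])
    ultimately show "r \<in> ?S (U o\<^sub>L G o\<^sub>L adj U) (U o\<^sub>L w o\<^sub>L adj U)"
      using commutator_conj[OF U, of X G] X(2) by blast
  qed
  have "?S (U o\<^sub>L G o\<^sub>L adj U) (U o\<^sub>L w o\<^sub>L adj U) \<subseteq> ?S G w"
    using sub[OF unitary_adj[OF U], of "U o\<^sub>L G o\<^sub>L adj U" "U o\<^sub>L w o\<^sub>L adj U"]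
    by (simp only: conj_adj_conj[OF U])
  with sub[OF U, of G w] have "?S (U o\<^sub>L G o\<^sub>L adj U) (U o\<^sub>L w o\<^sub>L adj U) = ?S G w" by (rule antisym[rotated])
  then show ?thesis by (simp only: orbit_norm_def)
qed

section \<open>Lengths of smooth curves\<close>

lemma smooth_curve_tripotent:
  assumes g: "smooth_curve M \<gamma> a b" "a < b" and M: "\<And>G. G \<in> M \<Longrightarrow> tripotent G"
  shows "\<exists>\<gamma>' \<gamma>'' K. tripotent_curve \<gamma> \<gamma>' \<gamma>'' a b K"
proof -
  obtain D where D: "D 0 = \<gamma>" "\<And>n t. t \<in> {a..b} \<Longrightarrow> (D n has_vector_derivative D (Suc n) t) (at t within {a..b})"
    and \<gamma>: "\<And>t. t \<in> {a..b} \<Longrightarrow> \<gamma> t \<in> M"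
    using g(1) unfolding smooth_curve_def by blast
  have "\<exists>K. \<forall>t\<in>{a..b}. norm (D n t) \<le> K" for n
  proof -
    have "continuous_on {a..b} (D n)" by (rule continuous_on_vector_derivative) (rule D(2))
    then have "bounded (D n ` {a..b})" by (intro compact_imp_bounded compact_continuous_image) auto
    then show ?thesis by (auto simp: bounded_iff)
  qed
  then obtain K where K: "\<And>n t. t \<in> {a..b} \<Longrightarrow> norm (D n t) \<le> K n" by metis
  have "tripotent_curve \<gamma> (D 1) (D 2) a b (max (K 1) (K 2))"
    using g(2) M \<gamma> D(2)[of _ 0] D(2)[of _ 1] K[of _ 1] K[of _ 2]
    by unfold_locales (auto simp: D(1) numeral_2_eq_2 le_max_iff_disj)
  then show ?thesis by blast
qed

lemma (in tripotent_curve) vector_derivative_eq: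
  "t \<in> {a..b} \<Longrightarrow> vector_derivative \<gamma> (at t within {a..b}) = \<gamma>' t"
  using vector_derivative_within_cbox[unfolded box_real, OF ab _ d1] .

lemma (in tripotent_curve) curve_length_eq: "curve_length orbit_norm \<gamma> a b = integral {a..b} speed"
  unfolding curve_length_def by (rule integral_cong) (simp add: vector_derivative_eq speed_def)

text \<open>
  Velocities of a curve of off-diagonal operators are off-diagonal, and there the two norms agree.
\<close>
lemma diag_curve_length_eq:
  assumes "tripotent_curve \<gamma> \<gamma>' \<gamma>'' a b K"
    and anti: "\<And>t. t \<in> {a..b} \<Longrightarrow> grading o\<^sub>L \<gamma> t o\<^sub>L grading = - \<gamma> t"
  shows "curve_length diag_orbit_norm \<gamma> a b = curve_length orbit_norm \<gamma> a b"
proof -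
  interpret tripotent_curve \<gamma> \<gamma>' \<gamma>'' a b K by fact
  show ?thesis
    unfolding curve_length_def
  proof (rule integral_cong)
    fix t assume t: "t \<in> {a..b}"
    note bb = bounded_bilinear_blinfun_compose
    have "bounded_linear (\<lambda>T. (grading o\<^sub>L T o\<^sub>L grading) + T)"
      by (rule bounded_linear_add[OF bounded_linear_compose[OF bounded_bilinear.bounded_linear_left[OF bb]
              bounded_bilinear.bounded_linear_right[OF bb]] bounded_linear_ident])
    then have "(grading o\<^sub>L \<gamma>' t o\<^sub>L grading) + \<gamma>' t = 0"
      by (rule derivative_in_kernel[OF _ ab t _ d1[OF t]]) (simp add: anti)
    then have "grading o\<^sub>L \<gamma>' t o\<^sub>L grading = - \<gamma>' t" by (simp add: eq_neg_iff_add_eq_0)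
    then show "diag_orbit_norm (\<gamma> t) (vector_derivative \<gamma> (at t within {a..b}))
        = orbit_norm (\<gamma> t) (vector_derivative \<gamma> (at t within {a..b}))"
      using tangent[OF t] trip[OF t] anti[OF t]
      by (simp add: vector_derivative_eq[OF t] diag_orbit_norm_eq tangent_def)
  qed
qed

text \<open>
  Each derivative is again a conjugated operator, with the commutator with \<open>X\<close> applied once more.
\<close>
lemma smooth_curve_conj_evol:
  assumes X: "X \<in> bounded_ops" and G: "G \<in> bounded_ops"
    and M: "\<And>t. evol X t o\<^sub>L G o\<^sub>L evol X (- t) \<in> M"
  shows "smooth_curve M (\<lambda>t. evol X t o\<^sub>L G o\<^sub>L evol X (- t)) a b"
proof -
  define c where "c W = \<i> *\<^sub>C ((X o\<^sub>L W) - (W o\<^sub>L X))" for W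
  define D where "D n t = evol X t o\<^sub>L (c ^^ n) G o\<^sub>L evol X (- t)" for n t
  have ops: "(c ^^ n) G \<in> bounded_ops" for n by (induction n) (auto simp: c_def X G)
  have "(D n has_vector_derivative D (Suc n) t) (at t within {a..b})" for n t
    using conj_evol_has_vector_derivative[OF ops, of X n t "{a..b}"]
    unfolding D_def[abs_def] by (simp add: c_def)
  moreover have "D 0 = (\<lambda>t. evol X t o\<^sub>L G o\<^sub>L evol X (- t))" by (simp add: D_def[abs_def])
  ultimately show ?thesis unfolding smooth_curve_def using M by blast
qed

lemma minimal_along_pathI:
  assumes "\<And>t\<^sub>0 t\<^sub>1. smooth_curve M \<delta> t\<^sub>0 t\<^sub>1"
    and "\<And>t\<^sub>0 t\<^sub>1 \<gamma> a b. t\<^sub>0 \<le> t\<^sub>1 \<Longrightarrow> ereal (t\<^sub>1 - t\<^sub>0) \<le> T \<Longrightarrow> a < b \<Longrightarrow> smooth_curve M \<gamma> a b \<Longrightarrow>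
      \<gamma> a = \<delta> t\<^sub>0 \<Longrightarrow> \<gamma> b = \<delta> t\<^sub>1 \<Longrightarrow> curve_length F \<delta> t\<^sub>0 t\<^sub>1 \<le> curve_length F \<gamma> a b"
  shows "minimal_along_path M F \<delta> T"
  unfolding minimal_along_path_def using assms by blast

theorem theorem5p7:
  fixes V v :: "'a::complex_hilbert \<Rightarrow>\<^sub>L 'a"
    and \<V> A\<^sub>0 :: "('a \<times> 'a) \<Rightarrow>\<^sub>L ('a \<times> 'a)"
    and \<delta> :: "real \<Rightarrow> ('a \<times> 'a) \<Rightarrow>\<^sub>L ('a \<times> 'a)"
    and T :: ereal
  assumes "V \<in> partial_isometries"
    and "v \<in> pi_tangent V"
    and "\<V> = block 0 v (adj v) 0"
    and "diagonal_minimal_lifting V \<V> A\<^sub>0"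
    and "\<delta> = (\<lambda>t. op_exp ((\<i> * of_real t) *\<^sub>C A\<^sub>0) o\<^sub>L eps V o\<^sub>L op_exp (- (\<i> * of_real t) *\<^sub>C A\<^sub>0))"
    and "T = (if v = 0 then \<infinity> else ereal (pi / (2 * pi_norm V v)))"
  shows "\<delta> 0 = eps V \<and>
    (\<delta> has_vector_derivative \<V>) (at 0) \<and>
    minimal_along_path (diag_orbit V) diag_orbit_norm \<delta> T \<and>
    minimal_along_path (unitary_orbit (eps V)) orbit_norm \<delta> T"
proof -
  note bb = bounded_bilinear_blinfun_compose
  have V: "V \<in> bounded_ops" using assms(1) by (simp add: partial_isometries_def)
  define \<epsilon> where "\<epsilon> = eps V"
  have \<epsilon>: "tripotent \<epsilon>" unfolding \<epsilon>_def by (rule tripotent_eps[OF assms(1)])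
  have \<epsilon>ops: "\<epsilon> \<in> bounded_ops" using \<epsilon> by simp
  have \<V>: "\<V> = eps v" by (simp add: assms(3) eps_def)
  have \<delta>: "\<delta> = (\<lambda>t. evol A\<^sub>0 t o\<^sub>L \<epsilon> o\<^sub>L evol A\<^sub>0 (- t))"
  proof -
    have "- (\<i> * complex_of_real t) = \<i> * of_real (- t)" for t by simp
    then show ?thesis by (simp only: assms(5) op_exp_eq_evol \<epsilon>_def)
  qed
  obtain A1 A2 X11 X12 X22 A X where
    A: "A = block A1 0 0 A2" "selfadjoint A" "\<i> *\<^sub>C ((A o\<^sub>L \<epsilon>) - (\<epsilon> o\<^sub>L A)) = \<V>"
    and X: "X = block X11 X12 (adj X12) X22" "selfadjoint X" "X o\<^sub>L \<epsilon> = \<epsilon> o\<^sub>L X"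
    and minX: "\<And>Y. selfadjoint Y \<Longrightarrow> Y o\<^sub>L \<epsilon> = \<epsilon> o\<^sub>L Y \<Longrightarrow> norm (A + X) \<le> norm (A + Y)"
    and A\<^sub>0: "A\<^sub>0 = A + block X11 0 0 X22"
    using assms(4) unfolding diagonal_minimal_lifting_def Let_def \<epsilon>_def by blast
  define X\<^sub>0 where "X\<^sub>0 = average grading X"
  have X\<^sub>0: "X\<^sub>0 = block X11 0 0 X22" unfolding X\<^sub>0_def X(1) by (rule average_grading_block)
  have X\<^sub>0sa: "selfadjoint X\<^sub>0" unfolding X\<^sub>0_def by (intro average_selfadjoint symmetry_grading X)
  have X\<^sub>0\<epsilon>: "X\<^sub>0 o\<^sub>L \<epsilon> = \<epsilon> o\<^sub>L X\<^sub>0"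
    using average_grading_commutator[of X V] X(3) unfolding X\<^sub>0_def \<epsilon>_def by simp
  have A\<^sub>0X: "A\<^sub>0 = A + X\<^sub>0" by (simp add: A\<^sub>0 X\<^sub>0)
  have A\<^sub>0sa: "selfadjoint A\<^sub>0" unfolding A\<^sub>0X by (intro selfadjoint_add A X\<^sub>0sa)
  have A\<^sub>0avg: "A\<^sub>0 = average grading (A + X)"
    unfolding A(1) X(1) block_add average_grading_block A\<^sub>0 by simp
  have A\<^sub>0\<epsilon>: "\<i> *\<^sub>C ((A\<^sub>0 o\<^sub>L \<epsilon>) - (\<epsilon> o\<^sub>L A\<^sub>0)) = \<V>"
    using A(3) X\<^sub>0\<epsilon> by (simp add: A\<^sub>0X bounded_bilinear.add_left[OF bb] bounded_bilinear.add_right[OF bb])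
  have minimal: "norm A\<^sub>0 \<le> norm (A\<^sub>0 + Y)" if "selfadjoint Y" "Y o\<^sub>L \<epsilon> = \<epsilon> o\<^sub>L Y" for Y
  proof -
    have "norm A\<^sub>0 \<le> norm (A + X)" unfolding A\<^sub>0avg by (rule norm_average_le[OF symmetry_grading])
    also have "\<dots> \<le> norm (A + (X\<^sub>0 + Y))"
      using that X\<^sub>0sa X\<^sub>0\<epsilon> by (intro minX selfadjoint_add)
        (auto simp: bounded_bilinear.add_left[OF bb] bounded_bilinear.add_right[OF bb])
    finally show ?thesis by (simp add: A\<^sub>0X add.assoc)
  qed
  define m where "m = norm A\<^sub>0"
  have m_orbit: "orbit_norm \<epsilon> \<V> = m"
  proof (rule antisym)
    show "orbit_norm \<epsilon> \<V> \<le> m" unfolding m_def by (rule orbit_norm_le[OF A\<^sub>0sa A\<^sub>0\<epsilon>])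
    have "tangent \<epsilon> \<V>" using tangent_commutator[OF \<epsilon> A\<^sub>0sa] by (simp only: A\<^sub>0\<epsilon>)
    then show "m \<le> orbit_norm \<epsilon> \<V>"
    proof (rule orbit_norm_ge[OF \<epsilon>])
      fix Z assume Z: "selfadjoint Z" "\<i> *\<^sub>C ((Z o\<^sub>L \<epsilon>) - (\<epsilon> o\<^sub>L Z)) = \<V>"
      have "\<i> *\<^sub>C \<i> *\<^sub>C blinfun_apply ((Z o\<^sub>L \<epsilon>) - (\<epsilon> o\<^sub>L Z)) x
          = \<i> *\<^sub>C \<i> *\<^sub>C blinfun_apply ((A\<^sub>0 o\<^sub>L \<epsilon>) - (\<epsilon> o\<^sub>L A\<^sub>0)) x" for x
        using Z(2) A\<^sub>0\<epsilon> by (metis scaleC_blinfun_apply)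
      then have "(Z o\<^sub>L \<epsilon>) - (\<epsilon> o\<^sub>L Z) = (A\<^sub>0 o\<^sub>L \<epsilon>) - (\<epsilon> o\<^sub>L A\<^sub>0)"
        by (intro blinfun_eqI) (simp add: scaleC_scaleC)
      \<comment> \<open>Two lifts differ by an element of the commutant.\<close>
      then have "(Z - A\<^sub>0) o\<^sub>L \<epsilon> = \<epsilon> o\<^sub>L (Z - A\<^sub>0)"
        by (simp add: bounded_bilinear.diff_left[OF bb] bounded_bilinear.diff_right[OF bb] algebra_simps)
      from minimal[OF selfadjoint_diff[OF Z(1) A\<^sub>0sa] this] show "m \<le> norm Z" by (simp add: m_def)
    qed
  qed
  have m_pi: "pi_norm V v = m"
    using m_orbit orbit_norm_eps[OF V, of v] by (simp add: \<V> \<epsilon>_def)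
  \<comment> \<open>For \<open>v = 0\<close> the time is unrestricted, but then the zero operator is a lift and \<open>m = 0\<close>.\<close>
  have t_le: "t * m \<le> pi / 2" if "0 \<le> t" "ereal t \<le> T" for t
  proof (cases "v = 0")
    case True
    have "eps (0 :: 'a \<Rightarrow>\<^sub>L 'a) = 0"
    proof -
      have "adj (0 :: 'a \<Rightarrow>\<^sub>L 'a) = 0" by (rule adj_unique) auto
      then show ?thesis by (intro blinfun_prod_eqI) (simp add: zero_prod_def)
    qed
    then have "m \<le> norm (0 :: ('a \<times> 'a) \<Rightarrow>\<^sub>L ('a \<times> 'a))"
      unfolding m_orbit[symmetric] \<V> True
      by (intro orbit_norm_le) (auto simp: selfadjoint_iff intro!: blinfun_eqI)
    then have "m = 0" by (simp add: m_def)
    then show ?thesis by simp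
  next
    case False
    have "m \<noteq> 0"
    proof
      assume "m = 0"
      then have "\<V> = 0" using A\<^sub>0\<epsilon> by (auto simp: m_def intro!: blinfun_eqI)
      then have "v = 0" using block12_eps[of v] unfolding \<V> by (auto intro!: blinfun_eqI)
      with False show False by simp
    qed
    then have "m > 0" by (simp add: m_def)
    moreover have "t \<le> pi / (2 * m)" using that(2) False by (simp add: assms(6) m_pi)
    ultimately show ?thesis by (simp add: field_simps)
  qed
  have adjE: "adj (evol A\<^sub>0 t) = evol A\<^sub>0 (- t)" for t by (rule adj_evol[OF A\<^sub>0sa])
  have unE: "unitary (evol A\<^sub>0 t)" for t by (rule unitary_evol[OF A\<^sub>0sa])
  have \<delta>_conj: "\<delta> t = evol A\<^sub>0 t o\<^sub>L \<epsilon> o\<^sub>L adj (evol A\<^sub>0 t)" for t by (simp add: \<delta> adjE)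
  have \<delta>_diag: "\<delta> t \<in> diag_orbit V" for t
  proof -
    have "A\<^sub>0 o\<^sub>L grading = grading o\<^sub>L A\<^sub>0"
      unfolding A\<^sub>0avg by (rule average_commutes[OF symmetry_grading])
    then have "grading o\<^sub>L (\<i> *\<^sub>C A\<^sub>0) = (\<i> *\<^sub>C A\<^sub>0) o\<^sub>L grading"
      by (intro blinfun_eqI) (simp add: compose_commute_apply bounded_ops_apply symmetry_grading[unfolded symmetry_def])
    from evol_commute[OF this, of t] have E: "evol A\<^sub>0 t = block (corner11 (evol A\<^sub>0 t)) 0 0 (corner22 (evol A\<^sub>0 t))"
      by (intro commutes_grading_block_diag) simp
    then have un: "unitary (corner11 (evol A\<^sub>0 t))" "unitary (corner22 (evol A\<^sub>0 t))"
      using unE[of t] by (metis unitary_block_diag)+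
    have "\<delta> t = eps (corner11 (evol A\<^sub>0 t) o\<^sub>L V o\<^sub>L adj (corner22 (evol A\<^sub>0 t)))"
      unfolding \<delta>_conj \<epsilon>_def using block_diag_conj_eps[OF unitaryD(1)[OF un(1)] V unitaryD(1)[OF un(2)]]
      by (simp only: E[symmetric])
    with un show ?thesis unfolding diag_orbit_def by blast
  qed
  have \<delta>_unitary: "\<delta> t \<in> unitary_orbit \<epsilon>" for t
    unfolding \<delta>_conj unitary_orbit_def using unE by blast
  have deriv: "(\<delta> has_vector_derivative (evol A\<^sub>0 t o\<^sub>L \<V> o\<^sub>L evol A\<^sub>0 (- t))) (at t within S)" for t S
    unfolding \<delta> A\<^sub>0\<epsilon>[symmetric] by (rule conj_evol_has_vector_derivative[OF \<epsilon>ops])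
  have smooth_diag: "smooth_curve (diag_orbit V) \<delta> t\<^sub>0 t\<^sub>1" for t\<^sub>0 t\<^sub>1
    using smooth_curve_conj_evol[OF selfadjoint_bounded_ops[OF A\<^sub>0sa] \<epsilon>ops] \<delta>_diag unfolding \<delta> by blast
  have smooth_unitary: "smooth_curve (unitary_orbit \<epsilon>) \<delta> t\<^sub>0 t\<^sub>1" for t\<^sub>0 t\<^sub>1
    using smooth_curve_conj_evol[OF selfadjoint_bounded_ops[OF A\<^sub>0sa] \<epsilon>ops] \<delta>_unitary unfolding \<delta> by blast
  have orbit_tripotent: "tripotent G" if "G \<in> unitary_orbit \<epsilon>" for G
    using that tripotent_conj[OF _ \<epsilon>] unfolding unitary_orbit_def by blast
  have length_\<delta>: "curve_length orbit_norm \<delta> t\<^sub>0 t\<^sub>1 = (t\<^sub>1 - t\<^sub>0) * m" if "t\<^sub>0 \<le> t\<^sub>1" for t\<^sub>0 t\<^sub>1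
  proof (cases "t\<^sub>0 = t\<^sub>1")
    case True
    then show ?thesis by (simp add: curve_length_def)
  next
    case False
    then have less: "t\<^sub>0 < t\<^sub>1" using that by simp
    have "curve_length orbit_norm \<delta> t\<^sub>0 t\<^sub>1 = integral {t\<^sub>0..t\<^sub>1} (\<lambda>_. m)"
      unfolding curve_length_def
    proof (rule integral_cong)
      fix t assume t: "t \<in> {t\<^sub>0..t\<^sub>1}"
      have "vector_derivative \<delta> (at t within {t\<^sub>0..t\<^sub>1}) = evol A\<^sub>0 t o\<^sub>L \<V> o\<^sub>L adj (evol A\<^sub>0 t)"
        using vector_derivative_within_cbox[unfolded box_real, OF less t deriv] by (simp add: adjE)
      then show "orbit_norm (\<delta> t) (vector_derivative \<delta> (at t within {t\<^sub>0..t\<^sub>1})) = m"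
        unfolding \<delta>_conj by (simp add: orbit_norm_conj[OF unE] m_orbit)
    qed
    then show ?thesis using that by simp
  qed
  have main: "(t\<^sub>1 - t\<^sub>0) * m \<le> curve_length orbit_norm \<gamma> a b"
    if t: "t\<^sub>0 \<le> t\<^sub>1" "ereal (t\<^sub>1 - t\<^sub>0) \<le> T" and ab: "a < b"
      and g: "smooth_curve (unitary_orbit \<epsilon>) \<gamma> a b" and ends: "\<gamma> a = \<delta> t\<^sub>0" "\<gamma> b = \<delta> t\<^sub>1" for t\<^sub>0 t\<^sub>1 \<gamma> a b
  proof -
    obtain \<gamma>' \<gamma>'' K where "tripotent_curve \<gamma> \<gamma>' \<gamma>'' a b K"
      using smooth_curve_tripotent[OF g ab orbit_tripotent] by blast
    then interpret tripotent_curve \<gamma> \<gamma>' \<gamma>'' a b K .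
    have "(t\<^sub>1 - t\<^sub>0) * norm A\<^sub>0 \<le> integral {a..b} speed"
    proof (rule minimal_le_length[OF A\<^sub>0sa])
      \<comment> \<open>\<open>A\<^sub>0\<close> commutes with its exponential, so conjugation carries minimality from \<open>\<epsilon>\<close> to \<open>\<delta> t\<^sub>0\<close>.\<close>
      show "norm A\<^sub>0 \<le> norm (A\<^sub>0 + Y)" if Y: "selfadjoint Y" "Y o\<^sub>L \<gamma> a = \<gamma> a o\<^sub>L Y" for Y
      proof -
        let ?U = "evol A\<^sub>0 (- t\<^sub>0)"
        define Y' where "Y' = ?U o\<^sub>L Y o\<^sub>L adj ?U"
        have "selfadjoint Y'" unfolding Y'_def by (rule selfadjoint_conj[OF unitaryD(1)[OF unE] Y(1)])
        moreover have "Y' o\<^sub>L \<epsilon> = \<epsilon> o\<^sub>L Y'"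
        proof (rule blinfun_eqI)
          fix x
          have "blinfun_apply Y (blinfun_apply (\<delta> t\<^sub>0) (blinfun_apply (evol A\<^sub>0 t\<^sub>0) x))
              = blinfun_apply (\<delta> t\<^sub>0) (blinfun_apply Y (blinfun_apply (evol A\<^sub>0 t\<^sub>0) x))"
            using compose_commute_apply[OF Y(2)] by (simp add: ends)
          then show "blinfun_apply (Y' o\<^sub>L \<epsilon>) x = blinfun_apply (\<epsilon> o\<^sub>L Y') x"
            by (simp add: Y'_def adjE \<delta>)
        qed
        ultimately have "norm A\<^sub>0 \<le> norm (A\<^sub>0 + Y')" by (rule minimal)
        also have "A\<^sub>0 + Y' = ?U o\<^sub>L (A\<^sub>0 + Y) o\<^sub>L adj ?U"
        proof (rule blinfun_eqI)
          fix x
          have "A\<^sub>0 o\<^sub>L (\<i> *\<^sub>C A\<^sub>0) = (\<i> *\<^sub>C A\<^sub>0) o\<^sub>L A\<^sub>0"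
            by (rule blinfun_eqI) (simp add: bounded_ops_apply A\<^sub>0sa)
          from compose_commute_apply[OF evol_commute[OF this, of "- t\<^sub>0"], of "blinfun_apply (evol A\<^sub>0 t\<^sub>0) x"]
          show "blinfun_apply (A\<^sub>0 + Y') x = blinfun_apply (?U o\<^sub>L (A\<^sub>0 + Y) o\<^sub>L adj ?U) x"
            by (simp add: Y'_def adjE blinfun.bilinear_simps)
        qed
        also have "norm \<dots> \<le> norm (A\<^sub>0 + Y)" by (rule norm_conj_le[OF unE])
        finally show ?thesis .
      qed
      show "\<gamma> b = evol A\<^sub>0 (t\<^sub>1 - t\<^sub>0) o\<^sub>L \<gamma> a o\<^sub>L evol A\<^sub>0 (- (t\<^sub>1 - t\<^sub>0))"
      proof -
        have "evol A\<^sub>0 t\<^sub>1 = evol A\<^sub>0 (t\<^sub>1 - t\<^sub>0) o\<^sub>L evol A\<^sub>0 t\<^sub>0"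
          "evol A\<^sub>0 (- t\<^sub>1) = evol A\<^sub>0 (- t\<^sub>0) o\<^sub>L evol A\<^sub>0 (- (t\<^sub>1 - t\<^sub>0))"
          by (simp_all flip: evol_add)
        then show ?thesis unfolding ends \<delta> by (auto intro!: blinfun_eqI)
      qed
    qed (use t t_le in \<open>auto simp: m_def\<close>)
    then show ?thesis by (simp add: curve_length_eq m_def)
  qed
  have diag_length: "curve_length diag_orbit_norm \<gamma> a b = curve_length orbit_norm \<gamma> a b"
    "smooth_curve (unitary_orbit \<epsilon>) \<gamma> a b"
    if g: "smooth_curve (diag_orbit V) \<gamma> a b" and ab: "a \<le> b" for \<gamma> a b
  proof -
    show g': "smooth_curve (unitary_orbit \<epsilon>) \<gamma> a b"
      using g diag_orbit_subset[OF V] unfolding smooth_curve_def \<epsilon>_def by blast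
    show "curve_length diag_orbit_norm \<gamma> a b = curve_length orbit_norm \<gamma> a b"
    proof (cases "a = b")
      case True
      then show ?thesis by (simp add: curve_length_def)
    next
      case False
      then obtain \<gamma>' \<gamma>'' K where c: "tripotent_curve \<gamma> \<gamma>' \<gamma>'' a b K"
        using smooth_curve_tripotent[OF g' _ orbit_tripotent] ab by force
      have "grading o\<^sub>L \<gamma> t o\<^sub>L grading = - \<gamma> t" if "t \<in> {a..b}" for t
      proof -
        have "\<gamma> t \<in> diag_orbit V" using g that unfolding smooth_curve_def by blast
        then obtain V' where "\<gamma> t = eps V'" unfolding diag_orbit_def by blast
        then show ?thesis by (simp only: grading_eps)
      qed
      then show ?thesis by (rule diag_curve_length_eq[OF c])
    qed
  qed
  have "minimal_along_path (unitary_orbit \<epsilon>) orbit_norm \<delta> T"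
    by (rule minimal_along_pathI[OF smooth_unitary]) (simp only: length_\<delta> main)
  moreover have "minimal_along_path (diag_orbit V) diag_orbit_norm \<delta> T"
    by (rule minimal_along_pathI[OF smooth_diag])
      (simp add: diag_length smooth_diag length_\<delta> main)
  moreover have "\<delta> 0 = eps V" by (auto simp: \<delta> \<epsilon>_def intro!: blinfun_eqI)
  moreover have "(\<delta> has_vector_derivative \<V>) (at 0)"
  proof -
    have "evol A\<^sub>0 0 o\<^sub>L \<V> o\<^sub>L evol A\<^sub>0 (- 0) = \<V>" by (rule blinfun_eqI) simp
    then show ?thesis using deriv[of 0 UNIV] by simp
  qed
  ultimately show ?thesis unfolding \<epsilon>_def by blast
qed

end
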